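(* Suppose that $U$, $f$ and $L$ satisfy the standing assumptions (1) and (2) listed in the context. Fix constants $\alpha\in(0,1)$, $\beta\in(0,1)$ and $\eta\in(0,1)$. Let $\{\boldsymbol{\mu}_k\}_{k=1}^{\infty}\subset\mathbf{M}$ be a sequence of relaxed controls computed by the Hamiltonian-based algorithm described in the context, i.e., for every $k=1,2,\ldots$, $\boldsymbol{\mu}_{k+1}=\boldsymbol{\mu}_{k,\mathrm{next}}$ is obtained by applying the algorithm (with the constants $\alpha,\beta,\eta$ and with any admissible choice of $\boldsymbol{\nu}$ in Step 2) to $\boldsymbol{\mu}_k$. Then $$\lim_{k\to\infty}\theta(\boldsymbol{\mu}_k)=0.$$
   Context: Setting. $U\subset\mathbb{R}^k$ is a compact set, $t_f>0$ and $x_0\in\mathbb{R}^n$ are fixed, $f$ is a function from $\mathbb{R}^n\times U$ to $\mathbb{R}^n$, and $L:\mathbb{R}^n\times U\to\mathbb{R}$ is an (absolutely integrable) cost function. Standing assumptions. (1) $f(x,u)$ is twice continuously differentiable in $x\in\mathbb{R}^n$ for every $u\in U$; the functions $f(x,u)$, $\frac{\partial f}{\partial x}(x,u)$ and $\frac{\partial^2 f}{\partial x^2}(x,u)$ are locally Lipschitz continuous in $(x,u)\in\mathbb{R}^n\times U$; and there exists $K>0$ such that $\|f(x,u)\|\le K(\|x\|+1)$ for every $x\in\mathbb{R}^n$ and $u\in U$. (2) $L(x,u)$ is continuously differentiable in $x\in\mathbb{R}^n$ for every $u\in U$; and $L(x,u)$ and $\frac{\partial L}{\partial x}(x,u)$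 are locally Lipschitz continuous in $(x,u)\in\mathbb{R}^n\times U$. Relaxed controls. $M$ is the space of Borel probability measures on $U$. A relaxed control is a mapping $\boldsymbol{\mu}=\{\mu(t):t\in[0,t_f]\}$ from $[0,t_f]$ to $M$ that is measurable in the sense that for every continuous $\phi:U\to\mathbb{R}$ the function $t\mapsto\int_U\phi(u)\,d\mu(t)$ is Lebesgue measurable. $\mathbf{M}$ is the space of relaxed controls; convex combinations of relaxed controls are taken pointwise in $t$, in the sense of measures. State, cost, costate. For $\boldsymbol{\mu}\in\mathbf{M}$, the state trajectory $x(t)$ is the absolutely continuous solution of $\dot{x}(t)=\int_U f(x(t),u)\,d\mu(t)$ with $x(0)=x_0$; the cost is $J(\boldsymbol{\mu})=\int_0^{t_f}\int_U L(x(t),u)\,d\mu(t)\,dt$; and the costate trajectory $p(t)\in\mathbb{R}^n$ is the solution of $$\dot{p}(t)=-\int_U\Big(\frac{\partial f}{\partial x}(x(t),u)^{\top}p(t)+\frac{\partial L}{\partial x}(x(t),u)^{\top}\Big)d\mu(t),\qquad p(t_f)=0.$$ Hamiltonian. For $x,p\in\mathbb{R}^n$ and $\nu\in M$, $H(x,\nu,p)=\int_U\big(p^{\top}f(x,u)+L(x,u)\big)d\nu$. Optimality function. For $\boldsymbol{\mu}\in\mathbf{M}$ with associated state $x$ and costate $p$, $$\theta(\boldsymbol{\mu})=\min_{\boldsymbol{\nu}\in\mathbf{M}}\int_0^{t_f}\big(H(x(t),\nu(t),p(t))-H(x(t),\mu(t),p(t))\big)dt ,$$ where the minimum exists and $\theta(\boldsymbol{\mu})\le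 0$. Algorithm (given constants $\alpha,\beta,\eta\in(0,1)$). Given $\boldsymbol{\mu}\in\mathbf{M}$, compute $\boldsymbol{\mu}_{\mathrm{next}}\in\mathbf{M}$ as follows. Step 0: if $\theta(\boldsymbol{\mu})=0$, set $\boldsymbol{\mu}_{\mathrm{next}}=\boldsymbol{\mu}$ and exit. Step 1: compute the state and costate trajectories $x$ and $p$ associated with $\boldsymbol{\mu}$. Step 2: compute a relaxed control $\boldsymbol{\nu}\in\mathbf{M}$ that is an $\eta$-minimizer of the Hamiltonian, namely $$\int_0^{t_f}\big(H(x(t),\nu(t),p(t))-H(x(t),\mu(t),p(t))\big)dt\le\eta\,\theta(\boldsymbol{\mu}).$$ Step 3: compute $\ell_\mu=\min\big\{\ell\in\{0,1,2,\ldots\}: J(\boldsymbol{\mu}+\beta^{\ell}(\boldsymbol{\nu}-\boldsymbol{\mu}))-J(\boldsymbol{\mu})\le\alpha\beta^{\ell}\eta\,\theta(\boldsymbol{\mu})\big\}$ and set $\lambda_\mu=\beta^{\ell_\mu}$. Step 4: set $\boldsymbol{\mu}_{\mathrm{next}}=\boldsymbol{\mu}+\lambda_\mu(\boldsymbol{\nu}-\boldsymbol{\mu})$. *)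

theory Defs
  imports "HOL-Probability.Probability"
begin

section \<open>Regularity of the data\<close>

definition locally_lipschitz_on :: "'a::metric_space set \<Rightarrow> ('a \<Rightarrow> 'b::metric_space) \<Rightarrow> bool" where
  "locally_lipschitz_on S g \<longleftrightarrow>
     (\<forall>z\<in>S. \<exists>r>0. \<exists>C. C-lipschitz_on (cball z r \<inter> S) g)"

text \<open>
  \<open>dx g x u\<close> is the partial Frechet derivative of \<open>g\<close> with respect to its first argument at
  \<open>(x, u)\<close>, as a bounded linear map. It is meaningful only where \<open>\<lambda>y. g y u\<close> is differentiable
  at \<open>x\<close>. Being curried like \<open>g\<close>, it can be iterated: \<open>dx (dx g)\<close> is the second derivative in \<open>x\<close>.
\<close>

definition dx ::
  "('a::euclidean_space \<Rightarrow> 'b \<Rightarrow> 'c::real_normed_vector) \<Rightarrow> 'a \<Rightarrow> 'b \<Rightarrow> 'a \<Rightarrow>\<^sub>L 'c" where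
  "dx g x u = Blinfun (frechet_derivative (\<lambda>y. g y u) (at x))"

definition C1_in_x :: "'b set \<Rightarrow> ('a::euclidean_space \<Rightarrow> 'b \<Rightarrow> 'c::real_normed_vector) \<Rightarrow> bool" where
  "C1_in_x U g \<longleftrightarrow>
     (\<forall>u\<in>U. (\<forall>x. (\<lambda>y. g y u) differentiable at x) \<and> continuous_on UNIV (\<lambda>x. dx g x u))"

definition C2_in_x :: "'b set \<Rightarrow> ('a::euclidean_space \<Rightarrow> 'b \<Rightarrow> 'c::real_normed_vector) \<Rightarrow> bool" where
  "C2_in_x U g \<longleftrightarrow> C1_in_x U g \<and> C1_in_x U (dx g)"

definition standing_assumption_f ::
  "(real^'k) set \<Rightarrow> (real^'n \<Rightarrow> real^'k \<Rightarrow> real^'n) \<Rightarrow> bool" where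
  "standing_assumption_f U f \<longleftrightarrow>
     C2_in_x U f \<and>
     locally_lipschitz_on (UNIV \<times> U) (\<lambda>(x, u). f x u) \<and>
     locally_lipschitz_on (UNIV \<times> U) (\<lambda>(x, u). dx f x u) \<and>
     locally_lipschitz_on (UNIV \<times> U) (\<lambda>(x, u). dx (dx f) x u) \<and>
     (\<exists>K>0. \<forall>x. \<forall>u\<in>U. norm (f x u) \<le> K * (norm x + 1))"

definition standing_assumption_L ::
  "(real^'k) set \<Rightarrow> (real^'n \<Rightarrow> real^'k \<Rightarrow> real) \<Rightarrow> bool" where
  "standing_assumption_L U L \<longleftrightarrow>
     C1_in_x U L \<and>
     locally_lipschitz_on (UNIV \<times> U) (\<lambda>(x, u). L x u) \<and>
     locally_lipschitz_on (UNIV \<times> U) (\<lambda>(x, u). dx L x u)"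


section \<open>Relaxed controls\<close>

definition borel_probs :: "'u::topological_space set \<Rightarrow> 'u measure set" where
  "borel_probs U = {\<nu>. prob_space \<nu> \<and> sets \<nu> = sets (restrict_space borel U)}"

text \<open>
  A relaxed control is represented by a total function on the reals; only its values on
  \<open>{0..tf}\<close> are relevant.
\<close>

definition relaxed_controls :: "'u::topological_space set \<Rightarrow> real \<Rightarrow> (real \<Rightarrow> 'u measure) set" where
  "relaxed_controls U tf =
     {\<mu>. (\<forall>t\<in>{0..tf}. \<mu> t \<in> borel_probs U) \<and>
         (\<forall>\<phi> :: 'u \<Rightarrow> real. continuous_on U \<phi> \<longrightarrow>
            (\<lambda>t. LINT u|\<mu> t. \<phi> u) \<in> borel_measurable (lebesgue_on {0..tf}))}"

text \<open>For \<open>0 \<le> c \<le> 1\<close>, the measure \<open>M + c (N - M) = (1 - c) M + c N\<close>, for \<open>M\<close>, \<open>N\<close> on the same space.\<close>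

definition mix_measure :: "real \<Rightarrow> 'u measure \<Rightarrow> 'u measure \<Rightarrow> 'u measure" where
  "mix_measure c M N =
     measure_of (space M) (sets M)
       (\<lambda>A. ennreal (1 - c) * emeasure M A + ennreal c * emeasure N A)"

definition mix_control ::
  "real \<Rightarrow> (real \<Rightarrow> 'u measure) \<Rightarrow> (real \<Rightarrow> 'u measure) \<Rightarrow> real \<Rightarrow> 'u measure" where
  "mix_control c \<mu> \<nu> = (\<lambda>t. mix_measure c (\<mu> t) (\<nu> t))"


section \<open>State, costate and cost\<close>

text \<open>
  Absolute continuity on an interval \<open>S\<close>; a division is a finite family of non-overlapping
  compact intervals \<open>k = {Inf k..Sup k}\<close>.
\<close>

definition abs_continuous_on :: "real set \<Rightarrow> (real \<Rightarrow> 'a::real_normed_vector) \<Rightarrow> bool" where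
  "abs_continuous_on S g \<longleftrightarrow>
     (\<forall>\<epsilon>>0. \<exists>\<delta>>0. \<forall>d T. d division_of T \<and> T \<subseteq> S \<and> (\<Sum>k\<in>d. Sup k - Inf k) < \<delta> \<longrightarrow>
        (\<Sum>k\<in>d. norm (g (Sup k) - g (Inf k))) < \<epsilon>)"

definition is_state ::
  "real \<Rightarrow> real^'n \<Rightarrow> (real^'n \<Rightarrow> real^'k \<Rightarrow> real^'n) \<Rightarrow> (real \<Rightarrow> (real^'k) measure) \<Rightarrow>
     (real \<Rightarrow> real^'n) \<Rightarrow> bool" where
  "is_state tf x0 f \<mu> x \<longleftrightarrow>
     abs_continuous_on {0..tf} x \<and> x 0 = x0 \<and>
     (AE t in lebesgue_on {0..tf}.
        (x has_vector_derivative (LINT u|\<mu> t. f (x t) u)) (at t within {0..tf}))"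

text \<open>
  Under the standing assumption on \<open>f\<close> the solution exists and is unique on \<open>{0..tf}\<close>; its values
  outside that interval are unspecified and never used. The same applies to the costate below.
\<close>

definition state_traj ::
  "real \<Rightarrow> real^'n \<Rightarrow> (real^'n \<Rightarrow> real^'k \<Rightarrow> real^'n) \<Rightarrow> (real \<Rightarrow> (real^'k) measure) \<Rightarrow>
     real \<Rightarrow> real^'n" where
  "state_traj tf x0 f \<mu> = (SOME x. is_state tf x0 f \<mu> x)"

definition cost ::
  "real \<Rightarrow> real^'n \<Rightarrow> (real^'n \<Rightarrow> real^'k \<Rightarrow> real^'n) \<Rightarrow> (real^'n \<Rightarrow> real^'k \<Rightarrow> real) \<Rightarrow>
     (real \<Rightarrow> (real^'k) measure) \<Rightarrow> real" where
  "cost tf x0 f L \<mu> =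
     (LINT t|lebesgue_on {0..tf}. LINT u|\<mu> t. L (state_traj tf x0 f \<mu> t) u)"

text \<open>The column vector of the partial derivatives of \<open>L\<close> in \<open>x\<close>, i.e. the transpose of the row \<open>dx L\<close>.\<close>

definition grad_x ::
  "(real^'n \<Rightarrow> real^'k \<Rightarrow> real) \<Rightarrow> real^'n \<Rightarrow> real^'k \<Rightarrow> real^'n" where
  "grad_x L x u = (\<chi> i. blinfun_apply (dx L x u) (axis i 1))"

definition is_costate ::
  "real \<Rightarrow> (real^'n \<Rightarrow> real^'k \<Rightarrow> real^'n) \<Rightarrow> (real^'n \<Rightarrow> real^'k \<Rightarrow> real) \<Rightarrow>
     (real \<Rightarrow> (real^'k) measure) \<Rightarrow> (real \<Rightarrow> real^'n) \<Rightarrow> (real \<Rightarrow> real^'n) \<Rightarrow> bool" where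
  "is_costate tf f L \<mu> x p \<longleftrightarrow>
     abs_continuous_on {0..tf} p \<and> p tf = 0 \<and>
     (AE t in lebesgue_on {0..tf}.
        (p has_vector_derivative
           - (LINT u|\<mu> t. transpose (matrix (blinfun_apply (dx f (x t) u))) *v p t
                            + grad_x L (x t) u)) (at t within {0..tf}))"

definition costate_traj ::
  "real \<Rightarrow> real^'n \<Rightarrow> (real^'n \<Rightarrow> real^'k \<Rightarrow> real^'n) \<Rightarrow> (real^'n \<Rightarrow> real^'k \<Rightarrow> real) \<Rightarrow>
     (real \<Rightarrow> (real^'k) measure) \<Rightarrow> real \<Rightarrow> real^'n" where
  "costate_traj tf x0 f L \<mu> = (SOME p. is_costate tf f L \<mu> (state_traj tf x0 f \<mu>) p)"


section \<open>Hamiltonian, optimality function and algorithm\<close>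

definition hamiltonian ::
  "(real^'n \<Rightarrow> real^'k \<Rightarrow> real^'n) \<Rightarrow> (real^'n \<Rightarrow> real^'k \<Rightarrow> real) \<Rightarrow>
     real^'n \<Rightarrow> (real^'k) measure \<Rightarrow> real^'n \<Rightarrow> real" where
  "hamiltonian f L x \<nu> p = (LINT u|\<nu>. p \<bullet> f x u + L x u)"

definition hamiltonian_gap ::
  "real \<Rightarrow> real^'n \<Rightarrow> (real^'n \<Rightarrow> real^'k \<Rightarrow> real^'n) \<Rightarrow> (real^'n \<Rightarrow> real^'k \<Rightarrow> real) \<Rightarrow>
     (real \<Rightarrow> (real^'k) measure) \<Rightarrow> (real \<Rightarrow> (real^'k) measure) \<Rightarrow> real" where
  "hamiltonian_gap tf x0 f L \<mu> \<nu> =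
     (let x = state_traj tf x0 f \<mu>; p = costate_traj tf x0 f L \<mu> in
      LINT t|lebesgue_on {0..tf}.
        hamiltonian f L (x t) (\<nu> t) (p t) - hamiltonian f L (x t) (\<mu> t) (p t))"

text \<open>\<open>LEAST\<close> on the reals denotes the (attained) minimum, not the infimum.\<close>

definition optimality_fun ::
  "(real^'k) set \<Rightarrow> real \<Rightarrow> real^'n \<Rightarrow> (real^'n \<Rightarrow> real^'k \<Rightarrow> real^'n) \<Rightarrow>
     (real^'n \<Rightarrow> real^'k \<Rightarrow> real) \<Rightarrow> (real \<Rightarrow> (real^'k) measure) \<Rightarrow> real" where
  "optimality_fun U tf x0 f L \<mu> =
     (LEAST r. r \<in> hamiltonian_gap tf x0 f L \<mu> ` relaxed_controls U tf)"

definition armijo_exponent ::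
  "(real^'k) set \<Rightarrow> real \<Rightarrow> real^'n \<Rightarrow> (real^'n \<Rightarrow> real^'k \<Rightarrow> real^'n) \<Rightarrow>
     (real^'n \<Rightarrow> real^'k \<Rightarrow> real) \<Rightarrow> real \<Rightarrow> real \<Rightarrow> real \<Rightarrow>
     (real \<Rightarrow> (real^'k) measure) \<Rightarrow> (real \<Rightarrow> (real^'k) measure) \<Rightarrow> nat" where
  "armijo_exponent U tf x0 f L \<alpha> \<beta> \<eta> \<mu> \<nu> =
     (LEAST l. cost tf x0 f L (mix_control (\<beta> ^ l) \<mu> \<nu>) - cost tf x0 f L \<mu>
                 \<le> \<alpha> * \<beta> ^ l * \<eta> * optimality_fun U tf x0 f L \<mu>)"

text \<open>
  One iteration, as a relation because the \<open>\<eta>\<close>-minimizer \<open>\<nu>\<close> may be chosen freely.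
  Controls are compared on \<open>{0..tf}\<close> only.
\<close>

definition algorithm_step ::
  "(real^'k) set \<Rightarrow> real \<Rightarrow> real^'n \<Rightarrow> (real^'n \<Rightarrow> real^'k \<Rightarrow> real^'n) \<Rightarrow>
     (real^'n \<Rightarrow> real^'k \<Rightarrow> real) \<Rightarrow> real \<Rightarrow> real \<Rightarrow> real \<Rightarrow>
     (real \<Rightarrow> (real^'k) measure) \<Rightarrow> (real \<Rightarrow> (real^'k) measure) \<Rightarrow> bool" where
  "algorithm_step U tf x0 f L \<alpha> \<beta> \<eta> \<mu> \<mu>next \<longleftrightarrow>
     (if optimality_fun U tf x0 f L \<mu> = 0
      then \<forall>t\<in>{0..tf}. \<mu>next t = \<mu> t
      else \<exists>\<nu>\<in>relaxed_controls U tf.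
             hamiltonian_gap tf x0 f L \<mu> \<nu> \<le> \<eta> * optimality_fun U tf x0 f L \<mu> \<and>
             (\<forall>t\<in>{0..tf}. \<mu>next t =
                mix_control (\<beta> ^ armijo_exponent U tf x0 f L \<alpha> \<beta> \<eta> \<mu> \<nu>) \<mu> \<nu> t))"

end

theory Submission
  imports Defs
begin

text \<open>
  The proof is a descent argument whose constants do not depend on the current control. Write
  \<open>\<mu> + c (\<nu> - \<mu>)\<close> for \<open>mix_control c \<mu> \<nu>\<close>. The heart is the one-sided first-order expansion
  (\<open>cost_expansion\<close>): for all relaxed controls \<open>\<mu>\<close>, \<open>\<nu>\<close> and all \<open>c\<close> in \<open>[0,1]\<close>,

    \<open>J (\<mu> + c (\<nu> - \<mu>)) - J \<mu> \<le> c * gap \<mu> \<nu> + C * c\<^sup>2\<close>,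

  where \<open>gap \<mu> \<nu>\<close> is the integral of \<open>H(x, \<nu>, p) - H(x, \<mu>, p)\<close> along the state and costate of
  \<open>\<mu>\<close>, and \<open>C\<close> is uniform. Let \<open>y\<close> be the state of the mixture. Since \<open>p\<close> vanishes at the final
  time and \<open>y - x\<close> at the initial time, the derivative of \<open>p \<bullet> (y - x)\<close> integrates to \<open>0\<close> and may be
  added to the cost difference. What remains beyond the gap is pointwise the linearization error of
  \<open>p \<bullet> f + L\<close> in the state, of order \<open>\<bar>y - x\<bar>\<^sup>2\<close>, and \<open>c\<close> times a Lipschitz difference, of order
  \<open>c * \<bar>y - x\<bar>\<close>; by Gronwall's inequality \<open>\<bar>y - x\<bar>\<close> is of order \<open>c\<close>. Uniformity comes from linear
  growth: all states stay in one ball, on which \<open>f\<close>, \<open>L\<close> and their derivatives are bounded and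
  Lipschitz, and then all costates stay in one ball too.

  With this expansion the step-size rule accepts every step below a fixed multiple of
  \<open>- \<theta> \<mu>\<close>, so one iteration lowers the cost by at least \<open>a * s * min 1 (b * s)\<close> with
  \<open>s = - \<theta> \<mu>\<close> and constants \<open>a, b > 0\<close> (\<open>armijo_step_descent\<close>). The cost is bounded below, hence these
  amounts tend to \<open>0\<close>, and with them \<open>\<theta>\<close> (\<open>sufficient_descent_tendsto_zero\<close>).

  Three facts make the objects in this argument meaningful. States and costates exist
  (\<open>caratheodory_existence\<close>): the equations have only measurable time dependence, so Picard iteration
  solves their integral form, and the Lebesgue differentiation theorem recovers the derivative almost
  everywhere. Conversely the fundamental theorem of calculus for absolutely continuous functions turns
  any solution back into its integral form, so the estimates hold for whichever solution is selected
  as the trajectory. Finally the minimum defining \<open>\<theta>\<close> is attained, by Dirac controls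
  at a measurably chosen pointwise minimizer of the Hamiltonian (\<open>measurable_argmin_selection\<close>); comparing
  with \<open>\<mu>\<close> itself gives \<open>\<theta> \<mu> \<le> 0\<close>.
\<close>

section \<open>Absolutely continuous functions and indefinite integrals\<close>

lemma abs_continuous_on_lipschitz:
  fixes g :: "real \<Rightarrow> 'a::real_normed_vector"
  assumes lip: "\<And>s t. s \<in> {a..b} \<Longrightarrow> t \<in> {a..b} \<Longrightarrow> norm (g t - g s) \<le> B * \<bar>t - s\<bar>"
  shows "abs_continuous_on {a..b} g"
  unfolding abs_continuous_on_def
proof (intro allI impI)
  fix \<epsilon> :: real
  assume "\<epsilon> > 0"
  define C where "C = \<bar>B\<bar> + 1"
  have "C > 0" by (simp add: C_def)
  show "\<exists>\<delta>>0. \<forall>d T. d division_of T \<and> T \<subseteq> {a..b} \<and> (\<Sum>k\<in>d. Sup k - Inf k) < \<delta> \<longrightarrow>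
          (\<Sum>k\<in>d. norm (g (Sup k) - g (Inf k))) < \<epsilon>"
  proof (intro exI[of _ "\<epsilon> / C"] conjI allI impI)
    fix d T
    assume d: "d division_of T \<and> T \<subseteq> {a..b} \<and> (\<Sum>k\<in>d. Sup k - Inf k) < \<epsilon> / C"
    have "norm (g (Sup k) - g (Inf k)) \<le> C * (Sup k - Inf k)" if "k \<in> d" for k
    proof -
      obtain u v where k: "k = cbox u v" "k \<noteq> {}" "k \<subseteq> T"
        using d division_ofD(2,3,4)[of d T k] \<open>k \<in> d\<close> by metis
      then have uv: "u \<le> v" "Sup k = v" "Inf k = u" by auto
      have "{u..v} \<subseteq> {a..b}" using k(1,3) d by (metis cbox_interval order_trans)
      then have "u \<in> {a..b}" "v \<in> {a..b}" using uv(1) by auto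
      then have "norm (g v - g u) \<le> B * \<bar>v - u\<bar>" by (rule lip)
      also have "\<dots> \<le> C * (v - u)"
        using uv(1) by (auto simp: C_def intro!: mult_right_mono)
      finally show ?thesis using uv by simp
    qed
    then have "(\<Sum>k\<in>d. norm (g (Sup k) - g (Inf k))) \<le> (\<Sum>k\<in>d. C * (Sup k - Inf k))"
      by (rule sum_mono)
    also have "\<dots> = C * (\<Sum>k\<in>d. Sup k - Inf k)" by (simp add: sum_distrib_left)
    also have "\<dots> < C * (\<epsilon> / C)"
      using d \<open>C > 0\<close> by (intro mult_strict_left_mono) auto
    finally show "(\<Sum>k\<in>d. norm (g (Sup k) - g (Inf k))) < \<epsilon>"
      using \<open>C > 0\<close> by simp
  qed (use \<open>\<epsilon> > 0\<close> \<open>C > 0\<close> in auto)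
qed

lemma negligible_open_superset:
  fixes N :: "real set"
  assumes "negligible N" "e > 0"
  obtains T where "open T" "N \<subseteq> T" "T \<in> lmeasurable" "measure lebesgue T < e"
proof -
  obtain T where T: "open T" "N \<subseteq> T" "T - N \<in> lmeasurable" "emeasure lebesgue (T - N) < ennreal e"
    using sets_lebesgue_outer_open[of N e] assms negligible_imp_sets by metis
  have eq: "T = (T - N) \<union> N" using T(2) by auto
  have N: "N \<in> lmeasurable" "measure lebesgue N = 0"
    using assms(1) by (auto simp: negligible_imp_measurable negligible_imp_measure0)
  have Tm: "T \<in> lmeasurable"
    by (subst eq) (intro fmeasurable.Un T(3) N(1))
  have "measure lebesgue T \<le> measure lebesgue (T - N) + measure lebesgue N"
    by (subst eq, rule measure_Un_le) (use T(3) N(1) in \<open>auto dest: fmeasurableD\<close>)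
  moreover have "measure lebesgue (T - N) < e"
    using T(3,4) assms(2) by (metis emeasure_eq_measure2 ennreal_less_iff measure_nonneg)
  ultimately show ?thesis
    using that[OF T(1,2) Tm] N(2) by simp
qed

text \<open>
  The gauge integral allows a direct proof. At tags off \<open>N\<close> the gauge comes from differentiability, as
  in the classical fundamental theorem. At tags in \<open>N\<close> it is an open superset of \<open>N\<close> of small
  measure: the intervals tagged there have small total length, so absolute continuity bounds their
  contribution to the increment of \<open>g\<close>, while they contribute nothing to the Riemann sum once the
  integrand is set to \<open>0\<close> on \<open>N\<close>.
\<close>

lemma abs_continuous_on_has_integral:
  fixes g :: "real \<Rightarrow> 'a::banach"
  assumes ac: "abs_continuous_on {a..b} g" and "a \<le> b" and N: "negligible N"
    and deriv: "\<And>t. t \<in> {a..b} - N \<Longrightarrow> (g has_vector_derivative h t) (at t within {a..b})"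
  shows "(h has_integral g b - g a) {a..b}"
proof -
  define h' where "h' t = (if t \<in> N then 0 else h t)" for t
  have "(h' has_integral (g b - g a)) (cbox a b)"
    unfolding has_integral
  proof (intro allI impI)
    fix e :: real
    assume "e > 0"
    define e1 where "e1 = e / (2 * (b - a + 1))"
    have "e1 > 0" using \<open>e > 0\<close> \<open>a \<le> b\<close> by (simp add: e1_def)
    from ac \<open>e > 0\<close> obtain \<delta> where \<delta>: "\<delta> > 0"
      "\<And>d T. d division_of T \<and> T \<subseteq> {a..b} \<and> (\<Sum>k\<in>d. Sup k - Inf k) < \<delta> \<Longrightarrow>
          (\<Sum>k\<in>d. norm (g (Sup k) - g (Inf k))) < e/2"
      unfolding abs_continuous_on_def by (meson half_gt_zero)
    obtain T where T: "open T" "N \<subseteq> T" "T \<in> lmeasurable" "measure lebesgue T < \<delta>"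
      using negligible_open_superset[OF N \<delta>(1)] by metis
    have "\<forall>x. \<exists>d>0. x \<in> {a..b} - N \<longrightarrow>
         (\<forall>y\<in>{a..b}. norm (y-x) < d \<longrightarrow> norm (g y - g x - (y-x) *\<^sub>R h x) \<le> e1 * norm (y-x))"
    proof
      fix x
      show "\<exists>d>0. x \<in> {a..b} - N \<longrightarrow>
         (\<forall>y\<in>{a..b}. norm (y-x) < d \<longrightarrow> norm (g y - g x - (y-x) *\<^sub>R h x) \<le> e1 * norm (y-x))"
      proof (cases "x \<in> {a..b} - N")
        case True
        from deriv[OF this] \<open>e1 > 0\<close> show ?thesis
          unfolding has_vector_derivative_def has_derivative_within_alt by auto
      qed (auto intro: exI[of _ 1])
    qed
    then obtain d where d: "\<And>x. 0 < d x"
      "\<And>x y. \<lbrakk>x \<in> {a..b} - N; y \<in> {a..b}; norm (y-x) < d x\<rbrakk>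
                \<Longrightarrow> norm (g y - g x - (y-x) *\<^sub>R h x) \<le> e1 * norm (y-x)"
      by metis
    define \<gamma> where "\<gamma> x = (if x \<in> N then T else ball x (d x))" for x
    have "gauge \<gamma>"
      using d(1) T(1,2) by (auto simp: gauge_def \<gamma>_def)
    moreover have "norm ((\<Sum>(x, K)\<in>p. measure lborel K *\<^sub>R h' x) - (g b - g a)) < e"
      if p: "p tagged_division_of cbox a b" "\<gamma> fine p" for p
    proof -
      define G where "G = {(x, K) \<in> p. x \<notin> N}"
      define B where "B = {(x, K) \<in> p. x \<in> N}"
      \<comment> \<open>Degenerate intervals are dropped, because \<open>snd\<close> need not be injective on them.\<close>
      define B' where "B' = {(x, K) \<in> p. x \<in> N \<and> interior K \<noteq> {}}"
      have fin: "finite p" using p(1) by blast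
      have split: "p = G \<union> B" "G \<inter> B = {}" "finite G" "finite B"
        using fin by (auto simp: G_def B_def intro: finite_subset[OF _ fin])
      have ba: "b - a = (\<Sum>(x,K)\<in>p. Sup K - Inf K)" "g b - g a = (\<Sum>(x,K)\<in>p. g (Sup K) - g (Inf K))"
        using additive_tagged_division_1[where f= "\<lambda>x. x"] additive_tagged_division_1[where f= g]
            \<open>a \<le> b\<close> p(1) by auto
      have interval: "\<exists>u v. K = {u..v} \<and> u \<le> v \<and> x \<in> K \<and> K \<subseteq> {a..b} \<and> Sup K = v \<and> Inf K = u \<and> measure lborel K = v - u"
        if xKp: "(x, K) \<in> p" for x K
      proof -
        obtain u v where "K = cbox u v" "x \<in> K" "K \<subseteq> cbox a b"
          using tagged_division_ofD(2-4)[OF p(1) xKp] by blast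
        moreover then have "u \<le> v" by auto
        ultimately show ?thesis by auto
      qed
      have good: "norm (measure lborel K *\<^sub>R h' x - (g (Sup K) - g (Inf K))) \<le> e1 * (Sup K - Inf K)"
        if xK: "(x, K) \<in> G" for x K
      proof -
        have xp: "(x, K) \<in> p" "x \<notin> N" using xK by (auto simp: G_def)
        then obtain u v where K: "K = {u..v}" "u \<le> v" "x \<in> K" "K \<subseteq> {a..b}"
          "Sup K = v" "Inf K = u" "measure lborel K = v - u" using interval by metis
        have sub: "K \<subseteq> ball x (d x)"
          using fineD[OF p(2) xp(1)] xp(2) by (simp add: \<gamma>_def)
        have "u \<in> K" "v \<in> K" using K by auto
        have "norm ((v - u) *\<^sub>R h x - (g v - g u))
            = norm (g u - g x - (u - x) *\<^sub>R h x - (g v - g x - (v - x) *\<^sub>R h x))"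
          by (auto simp: algebra_simps)
        also have "\<dots> \<le> norm (g u - g x - (u - x) *\<^sub>R h x) + norm (g v - g x - (v - x) *\<^sub>R h x)"
          by (rule norm_triangle_ineq4)
        also have "\<dots> \<le> e1 * norm (u - x) + e1 * norm (v - x)"
        proof (intro add_mono d(2))
          show "norm (u - x) < d x" "norm (v - x) < d x"
            using \<open>u \<in> K\<close> \<open>v \<in> K\<close> sub by (auto simp: dist_real_def)
        qed (use K xp \<open>u \<in> K\<close> \<open>v \<in> K\<close> in auto)
        also have "\<dots> = e1 * (v - u)"
          using K by (auto simp: field_simps)
        finally show ?thesis using K xp by (simp add: h'_def)
      qed
      have "norm (\<Sum>(x, K)\<in>G. measure lborel K *\<^sub>R h' x - (g (Sup K) - g (Inf K))) \<le> (\<Sum>(x, K)\<in>G. e1 * (Sup K - Inf K))"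
        by (rule sum_norm_le) (use good in auto)
      also have "\<dots> \<le> (\<Sum>(x, K)\<in>p. e1 * (Sup K - Inf K))"
      proof (rule sum_mono2[OF fin])
        show "G \<subseteq> p" using split(1) by blast
        fix i assume "i \<in> p - G"
        then obtain x K where i: "i = (x, K)" "(x, K) \<in> p" by (cases i) auto
        then have "Inf K \<le> Sup K" using interval[OF i(2)] by auto
        then show "0 \<le> (case i of (x, K) \<Rightarrow> e1 * (Sup K - Inf K))"
          using i(1) \<open>e1 > 0\<close> by simp
      qed
      also have "\<dots> = e1 * (b - a)"
        unfolding ba by (simp add: sum_distrib_left split_def)
      also have "\<dots> < e / 2"
        using \<open>e > 0\<close> \<open>a \<le> b\<close> by (simp add: e1_def field_simps)
      finally have 1: "norm (\<Sum>(x, K)\<in>G. measure lborel K *\<^sub>R h' x - (g (Sup K) - g (Inf K))) < e / 2" .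
      have B'B: "B' \<subseteq> B" by (auto simp: B_def B'_def)
      have "norm (\<Sum>(x, K)\<in>B. measure lborel K *\<^sub>R h' x - (g (Sup K) - g (Inf K)))
          \<le> (\<Sum>(x, K)\<in>B. norm (g (Sup K) - g (Inf K)))"
        by (rule sum_norm_le) (auto simp: B_def h'_def norm_minus_commute)
      also have "\<dots> = (\<Sum>(x, K)\<in>B'. norm (g (Sup K) - g (Inf K)))"
      proof (rule sum.mono_neutral_right[OF split(4) B'B], safe)
        fix x K
        assume "(x, K) \<in> B" "(x, K) \<notin> B'"
        then have xK: "(x, K) \<in> p" "interior K = {}" by (auto simp: B_def B'_def)
        then obtain u v where "K = {u..v}" "u \<le> v" "Sup K = v" "Inf K = u"
          using interval by metis
        then show "norm (g (Sup K) - g (Inf K)) = 0"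
          using xK(2) by (cases "u = v") auto
      qed
      also have "\<dots> < e / 2"
      proof -
        have pp: "p tagged_partial_division_of cbox a b" using p(1) by (simp add: tagged_division_of_def)
        have B'p: "B' \<subseteq> p" by (auto simp: B'_def)
        have tp: "B' tagged_partial_division_of cbox a b"
          using tagged_partial_division_subset[OF pp B'p] .
        have dv: "snd ` B' division_of \<Union>(snd ` B')"
          using partial_division_of_tagged_division[OF tp] .
        have inj: "inj_on snd B'"
        proof (rule inj_onI, clarsimp)
          fix x y K
          assume xy: "(x, K) \<in> B'" "(y, K) \<in> B'"
          show "x = y"
          proof (rule ccontr)
            assume "x \<noteq> y"
            then have "interior K \<inter> interior K = {}"
              using tagged_partial_division_ofD(5)[OF tp xy] by blast
            then show False using xy(1) by (auto simp: B'_def)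
          qed
        qed
        have lens: "Sup K - Inf K = measure lebesgue K" if KB: "K \<in> snd ` B'" for K
        proof -
          obtain x where "(x, K) \<in> p" using KB B'p by auto
          from interval[OF this] obtain u v where "K = {u..v}" "u \<le> v" by auto
          then show ?thesis by simp
        qed
        have sub: "\<Union>(snd ` B') \<subseteq> T"
        proof (rule Union_least)
          fix K assume "K \<in> snd ` B'"
          then obtain x where "(x, K) \<in> p" "x \<in> N" by (auto simp: B'_def)
          then show "K \<subseteq> T" using fineD[OF p(2)] by (metis \<gamma>_def)
        qed
        have "(\<Sum>K\<in>snd ` B'. Sup K - Inf K) = (\<Sum>K\<in>snd ` B'. measure lebesgue K)"
          using lens by (intro sum.cong) auto
        also have "\<dots> = measure lebesgue (\<Union>(snd ` B'))"
          by (rule content_division[OF dv])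
        also have "\<dots> \<le> measure lebesgue T"
          by (rule measure_mono_fmeasurable[OF sub _ T(3)]) (use lmeasurable_division[OF dv] in auto)
        also have "\<dots> < \<delta>" by (rule T(4))
        finally have lt: "(\<Sum>K\<in>snd ` B'. Sup K - Inf K) < \<delta>" .
        have sab: "\<Union>(snd ` B') \<subseteq> {a..b}"
        proof (rule Union_least)
          fix K assume "K \<in> snd ` B'"
          then obtain x where "(x, K) \<in> B'" by auto
          then show "K \<subseteq> {a..b}" using tagged_partial_division_ofD(3)[OF tp] by simp
        qed
        have "(\<Sum>K\<in>snd ` B'. norm (g (Sup K) - g (Inf K))) < e / 2"
          by (rule \<delta>(2)) (use dv sab lt in auto)
        then show ?thesis
          by (simp add: sum.reindex[OF inj] split_def)
      qed
      finally have 2: "norm (\<Sum>(x, K)\<in>B. measure lborel K *\<^sub>R h' x - (g (Sup K) - g (Inf K))) < e / 2" .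
      have "(\<Sum>(x, K)\<in>p. measure lborel K *\<^sub>R h' x) - (g b - g a)
          = (\<Sum>(x, K)\<in>p. measure lborel K *\<^sub>R h' x - (g (Sup K) - g (Inf K)))"
        unfolding ba by (simp add: split_def sum_subtractf)
      also have "\<dots> = (\<Sum>(x, K)\<in>G. measure lborel K *\<^sub>R h' x - (g (Sup K) - g (Inf K)))
          + (\<Sum>(x, K)\<in>B. measure lborel K *\<^sub>R h' x - (g (Sup K) - g (Inf K)))"
        by (subst split(1), rule sum.union_disjoint) (use split in auto)
      also have "norm \<dots> < e"
        using 1 2 by (smt (verit) field_sum_of_halves norm_triangle_ineq)
      finally show ?thesis .
    qed
    ultimately show "\<exists>\<gamma>. gauge \<gamma> \<and> (\<forall>\<D>. \<D> tagged_division_of cbox a b \<and> \<gamma> fine \<D> \<longrightarrow>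
        norm ((\<Sum>(x, K)\<in>\<D>. measure lborel K *\<^sub>R h' x) - (g b - g a)) < e)"
      by (intro exI[of _ \<gamma>] conjI allI impI) auto
  qed
  then have "(h' has_integral (g b - g a)) {a..b}" by simp
  then show ?thesis
    by (rule has_integral_spike[OF N, rotated]) (auto simp: h'_def)
qed

text \<open>
  Lebesgue's differentiation theorem on the line. On the set where the difference quotient keeps
  deviating by more than \<open>e\<close>, arbitrarily short intervals with endpoint \<open>t\<close> have
  \<open>\<bar>G(I) - f(t) \<bar>I\<bar>\<bar> > e \<bar>I\<bar>\<close>. The Vitali lemma extracts disjoint ones whose five-fold
  enlargements still cover the set, and Henstock's lemma makes the sum of the deviations, hence the
  total length, as small as desired.
\<close>

lemma indefinite_integral_has_vector_derivative_ae:
  fixes f :: "real \<Rightarrow> 'a::euclidean_space"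
  assumes f: "f integrable_on {a..b}"
  obtains N where "negligible N"
    "\<And>t. t \<in> {a..b} - N \<Longrightarrow>
        ((\<lambda>t. integral {a..t} f) has_vector_derivative f t) (at t within {a..b})"
proof -
  define G where "G t = integral {a..t} f" for t
  define D where "D t s = norm (G s - G t - (s - t) *\<^sub>R f t)" for t s
  define S where "S e = {t \<in> {a..b}. \<forall>d>0. \<exists>s\<in>{a..b}. \<bar>s - t\<bar> < d \<and> D t s > e * \<bar>s - t\<bar>}" for e
  have inc: "integral {min t s..max t s} f = sgn (s - t) *\<^sub>R (G s - G t)"
    if "t \<in> {a..b}" "s \<in> {a..b}" for t s
  proof -
    have "integral {u..v} f = G v - G u" if "u \<in> {a..b}" "v \<in> {a..b}" "u \<le> v" for u v
    proof -
      have "f integrable_on {a..v}"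
        by (rule integrable_on_subinterval[OF f]) (use that in auto)
      then have "G u + integral {u..v} f = G v"
        unfolding G_def by (intro Henstock_Kurzweil_Integration.integral_combine) (use that in auto)
      then show ?thesis by (simp add: algebra_simps)
    qed
    note * = this
    show ?thesis
      using *[of t s] *[of s t] that by (cases t s rule: linorder_cases) (auto simp: min_def max_def)
  qed
  have neg: "negligible (S e)" if "e > 0" for e
    unfolding negligible_outer_le
  proof (intro allI impI)
    fix \<epsilon> :: real
    assume "\<epsilon> > 0"
    \<comment> \<open>The factor \<open>5\<close> is the enlargement factor of the Vitali lemma.\<close>
    define \<eta> where "\<eta> = e * \<epsilon> / 5"
    have "\<eta> > 0" using \<open>\<epsilon> > 0\<close> \<open>e > 0\<close> by (simp add: \<eta>_def)
    obtain \<gamma> where \<gamma>: "gauge \<gamma>"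
      "\<And>p. \<lbrakk>p tagged_partial_division_of (cbox a b); \<gamma> fine p\<rbrakk> \<Longrightarrow>
             sum (\<lambda>(x,k). norm(measure lborel k *\<^sub>R f x - integral k f)) p < \<eta>"
      using Henstock_lemma[of f a b \<eta>] f \<open>\<eta> > 0\<close> by auto
    define I where "I = (\<lambda>(t, s::real). {min t s..max t s})"
    define c where "c = (\<lambda>(t, s::real). (t + s) / 2)"
    define r where "r = (\<lambda>(t, s::real). \<bar>s - t\<bar> / 2)"
    have I: "I i = cball (c i) (r i)" for i
      by (cases i) (auto simp: I_def c_def r_def cball_eq_atLeastAtMost min_def max_def field_simps)
    define K where "K = {(t, s). t \<in> {a..b} \<and> s \<in> {a..b} \<and> s \<noteq> t \<and> I (t, s) \<subseteq> \<gamma> t \<and> D t s > e * \<bar>s - t\<bar>}"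
    have cov: "S e \<subseteq> (\<Union>i\<in>K. cball (c i) (r i))"
    proof
      fix t
      assume t: "t \<in> S e"
      obtain d where d: "d > 0" "ball t d \<subseteq> \<gamma> t"
        using \<gamma>(1) unfolding gauge_def by (meson open_contains_ball)
      obtain s where s: "s \<in> {a..b}" "\<bar>s - t\<bar> < d" "D t s > e * \<bar>s - t\<bar>"
        using t d(1) unfolding S_def by blast
      have "s \<noteq> t" using s(3) by (auto simp: D_def)
      moreover have "I (t, s) \<subseteq> ball t d"
        using s(2) by (auto simp: I_def dist_real_def)
      ultimately have "(t, s) \<in> K" using t s d by (auto simp: K_def S_def)
      moreover have "t \<in> I (t, s)" by (auto simp: I_def)
      ultimately show "t \<in> (\<Union>i\<in>K. cball (c i) (r i))" unfolding I by blast
    qed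
    have rb: "0 < r i \<and> r i \<le> b - a" if "i \<in> K" for i
      using that by (auto simp: K_def r_def)
    obtain C where C: "countable C" "C \<subseteq> K"
      "pairwise (\<lambda>i j. disjnt (cball (c i) (r i)) (cball (c j) (r j))) C"
      "S e \<subseteq> (\<Union>i\<in>C. cball (c i) (5 * r i))"
      by (rule Vitali_covering_lemma_cballs[OF cov rb])
    have bound: "measure lebesgue (\<Union>i\<in>C'. cball (c i) (5 * r i)) \<le> \<epsilon>"
      if C': "C' \<subseteq> C" "finite C'" for C'
    proof -
      define \<phi> where "\<phi> = (\<lambda>i. (fst i, I i))"
      have ne: "fst i \<in> I i" for i by (cases i) (auto simp: I_def)
      have disj: "I i \<inter> I j = {}" if "i \<in> C'" "j \<in> C'" "i \<noteq> j" for i j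
        using C(3) C'(1) that unfolding pairwise_def disjnt_def I by blast
      have inj: "inj_on \<phi> C'"
      proof (rule inj_onI)
        fix i j assume ij: "i \<in> C'" "j \<in> C'" "\<phi> i = \<phi> j"
        then have "I i \<inter> I j = I i" by (simp add: \<phi>_def)
        then show "i = j" using disj[OF ij(1,2)] ne[of i] by auto
      qed
      have "\<phi> ` C' tagged_partial_division_of cbox a b"
        unfolding tagged_partial_division_of_def
      proof (intro conjI allI impI)
        show "finite (\<phi> ` C')" using C'(2) by simp
      next
        fix x k
        assume "(x, k) \<in> \<phi> ` C'"
        then obtain i where i: "i \<in> C'" "x = fst i" "k = I i" by (auto simp: \<phi>_def)
        then have "i \<in> K" using C' C(2) by auto
        show "x \<in> k" using i ne by simp
        show "k \<subseteq> cbox a b"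
          using i \<open>i \<in> K\<close> by (cases i) (simp add: K_def I_def)
        show "\<exists>u v. k = cbox u v" using i by (cases i) (auto simp: I_def)
      next
        fix x1 k1 x2 k2
        assume "(x1, k1) \<in> \<phi> ` C' \<and> (x2, k2) \<in> \<phi> ` C' \<and> (x1, k1) \<noteq> (x2, k2)"
        then obtain i j where "i \<in> C'" "j \<in> C'" "i \<noteq> j" "k1 = I i" "k2 = I j"
          by (auto simp: \<phi>_def)
        then show "interior k1 \<inter> interior k2 = {}"
          using disj interior_subset by blast
      qed
      moreover have "\<gamma> fine \<phi> ` C'"
      proof -
        have "k \<subseteq> \<gamma> x" if xk: "(x, k) \<in> \<phi> ` C'" for x k
        proof -
          obtain i where i: "i \<in> K" "x = fst i" "k = I i"
            using xk C' C(2) by (auto simp: \<phi>_def)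
          then show ?thesis by (cases i) (auto simp: K_def)
        qed
        then show ?thesis unfolding fine_def by blast
      qed
      ultimately have "(\<Sum>(x,k)\<in>\<phi> ` C'. norm(measure lborel k *\<^sub>R f x - integral k f)) < \<eta>"
        by (rule \<gamma>(2))
      then have hen: "(\<Sum>i\<in>C'. norm(measure lborel (I i) *\<^sub>R f (fst i) - integral (I i) f)) < \<eta>"
        unfolding sum.reindex[OF inj] by (simp add: \<phi>_def)
      have "2 * e * r i \<le> norm(measure lborel (I i) *\<^sub>R f (fst i) - integral (I i) f)" if i: "i \<in> C'" for i
      proof -
        obtain t s where ts: "i = (t, s)" by (cases i)
        have iK: "t \<in> {a..b}" "s \<in> {a..b}" "s \<noteq> t" "D t s > e * \<bar>s - t\<bar>"
          using i C' C(2) ts by (auto simp: K_def)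
        have "measure lborel (I i) *\<^sub>R f (fst i) - integral (I i) f
            = sgn (s - t) *\<^sub>R ((s - t) *\<^sub>R f t - (G s - G t))"
          using iK(3) unfolding ts I_def by (simp add: inc[OF iK(1,2)]) (simp add: max_def min_def algebra_simps sgn_if)
        also have "norm \<dots> = D t s"
          using iK(3) by (simp add: D_def norm_minus_commute abs_sgn_eq)
        finally show ?thesis using iK(4) by (simp add: ts r_def)
      qed
      then have "(\<Sum>i\<in>C'. 2 * e * r i) \<le> (\<Sum>i\<in>C'. norm(measure lborel (I i) *\<^sub>R f (fst i) - integral (I i) f))"
        by (rule sum_mono)
      with hen have "(\<Sum>i\<in>C'. 2 * e * r i) < \<eta>" by simp
      then have small: "(2 * e) * (\<Sum>i\<in>C'. r i) < \<eta>" by (simp add: sum_distrib_left)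
      have "measure lebesgue (\<Union>i\<in>C'. cball (c i) (5 * r i)) \<le> (\<Sum>i\<in>C'. measure lebesgue (cball (c i) (5 * r i)))"
        by (rule measure_UNION_le[OF C'(2)]) auto
      also have "\<dots> = (\<Sum>i\<in>C'. 10 * r i)"
      proof (rule sum.cong)
        fix i assume "i \<in> C'"
        then have "r i > 0" using rb[of i] C'(1) C(2) by blast
        then show "measure lebesgue (cball (c i) (5 * r i)) = 10 * r i"
          by (simp add: cball_eq_atLeastAtMost)
      qed simp
      also have "\<dots> = 10 * (\<Sum>i\<in>C'. r i)" by (simp add: sum_distrib_left)
      also have "\<dots> \<le> \<epsilon>"
        using small \<open>e > 0\<close> by (simp add: \<eta>_def field_simps)
      finally show ?thesis .
    qed
    have lm: "cball (c i) (5 * r i) \<in> lmeasurable" for i by simp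
    show "\<exists>T. S e \<subseteq> T \<and> T \<in> lmeasurable \<and> measure lebesgue T \<le> \<epsilon>"
      using fmeasurable_UN_bound[OF C(1) lm bound] measure_UN_bound[OF C(1) lm bound] C(4)
      by blast
  qed
  define N where "N = (\<Union>n::nat. S (inverse (Suc n)))"
  have "negligible N"
    unfolding N_def by (rule negligible_countable_Union) (auto intro!: neg)
  moreover have "(G has_vector_derivative f t) (at t within {a..b})" if t: "t \<in> {a..b} - N" for t
    unfolding has_vector_derivative_def has_derivative_within_alt
  proof (intro conjI allI impI)
    show "bounded_linear (\<lambda>x. x *\<^sub>R f t)" by (rule bounded_linear_scaleR_left)
  next
    fix e :: real
    assume "e > 0"
    then obtain n where n: "inverse (real (Suc n)) < e" using reals_Archimedean by blast
    have "t \<notin> S (inverse (Suc n))" using t by (auto simp: N_def)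
    then obtain d where d: "d > 0"
      "\<And>s. s \<in> {a..b} \<Longrightarrow> \<bar>s - t\<bar> < d \<Longrightarrow> D t s \<le> inverse (Suc n) * \<bar>s - t\<bar>"
      using t unfolding S_def by (force simp: not_less)
    show "\<exists>d>0. \<forall>y\<in>{a..b}. norm (y - t) < d \<longrightarrow>
        norm (G y - G t - (y - t) *\<^sub>R f t) \<le> e * norm (y - t)"
    proof (intro exI[of _ d] conjI ballI impI)
      fix y assume "y \<in> {a..b}" "norm (y - t) < d"
      then have "D t y \<le> inverse (Suc n) * \<bar>y - t\<bar>" using d(2) by simp
      also have "\<dots> \<le> e * \<bar>y - t\<bar>" using n by (intro mult_right_mono) auto
      finally show "norm (G y - G t - (y - t) *\<^sub>R f t) \<le> e * norm (y - t)"
        by (simp add: D_def)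
    qed (use d in auto)
  qed
  ultimately show ?thesis
    using that unfolding G_def by blast
qed

lemma abs_continuous_on_has_integral_initial:
  fixes g :: "real \<Rightarrow> 'a::euclidean_space"
  assumes ac: "abs_continuous_on {a..b} g" and t: "t \<in> {a..b}"
    and deriv: "AE t in lebesgue_on {a..b}. (g has_vector_derivative h t) (at t within {a..b})"
  shows "(h has_integral g t - g a) {a..t}"
proof -
  have "AE s in lebesgue. s \<in> {a..b} \<longrightarrow> (g has_vector_derivative h s) (at s within {a..b})"
    using deriv by (simp add: AE_restrict_space_iff)
  then obtain N where N: "N \<in> null_sets lebesgue"
    "{s. \<not> (s \<in> {a..b} \<longrightarrow> (g has_vector_derivative h s) (at s within {a..b}))} \<subseteq> N"
    unfolding eventually_ae_filter by auto
  show ?thesis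
  proof (rule abs_continuous_on_has_integral)
    show "negligible N" using N(1) by (simp add: negligible_iff_null_sets)
    show "a \<le> t" using t by simp
    have "{a..t} \<subseteq> {a..b}" using t by auto
    then show "abs_continuous_on {a..t} g"
      using ac unfolding abs_continuous_on_def by (meson order_trans)
    show "(g has_vector_derivative h s) (at s within {a..t})" if "s \<in> {a..t} - N" for s
    proof (rule has_vector_derivative_within_subset)
      show "(g has_vector_derivative h s) (at s within {a..b})" using N(2) that t by auto
    qed (use t in auto)
  qed
qed

lemma AE_lebesgue_on_negligible:
  assumes "negligible N" "S \<in> sets lebesgue" "\<And>t. t \<in> S - N \<Longrightarrow> P t"
  shows "AE t in lebesgue_on S. P t"
proof -
  have "AE s in lebesgue. s \<in> S \<longrightarrow> P s"
    by (rule AE_I'[of N]) (use assms in \<open>auto simp: negligible_iff_null_sets\<close>)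
  then show ?thesis using assms(2) by (simp add: AE_restrict_space_iff)
qed

text \<open>
  Solutions of an integral equation with bounded right-hand side solve the differential equation in
  the sense in which states and costates are defined.
\<close>

lemma indefinite_integral_bounded_abs_continuous:
  fixes f :: "real \<Rightarrow> 'a::euclidean_space"
  assumes f: "f integrable_on {a..b}" and B: "\<And>t. t \<in> {a..b} \<Longrightarrow> norm (f t) \<le> B"
    and y: "\<And>t. t \<in> {a..b} \<Longrightarrow> y t = c + integral {a..t} f"
  shows "abs_continuous_on {a..b} y"
    and "AE t in lebesgue_on {a..b}. (y has_vector_derivative f t) (at t within {a..b})"
proof -
  have *: "norm (y t - y s) \<le> B * \<bar>t - s\<bar>" if "s \<in> {a..b}" "t \<in> {a..b}" "s \<le> t" for s t
  proof -
    have ft: "f integrable_on {a..t}"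
      by (rule integrable_on_subinterval[OF f]) (use that in auto)
    then have st: "f integrable_on {s..t}"
      by (rule integrable_on_subinterval) (use that in auto)
    have "integral {a..s} f + integral {s..t} f = integral {a..t} f"
      by (intro Henstock_Kurzweil_Integration.integral_combine ft) (use that in auto)
    then have "y t - y s = integral {s..t} f"
      using y that by (simp add: algebra_simps)
    also have "norm \<dots> \<le> B * measure lborel {s..t}"
      by (rule has_integral_bound_real[OF _ finite.emptyI integrable_integral[OF st]])
        (use that B order_trans[OF norm_ge_zero B[OF that(1)]] in auto)
    finally show ?thesis using that by simp
  qed
  show "abs_continuous_on {a..b} y"
  proof (rule abs_continuous_on_lipschitz)
    fix s t assume "s \<in> {a..b}" "t \<in> {a..b}"
    then show "norm (y t - y s) \<le> B * \<bar>t - s\<bar>"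
      using *[of s t] *[of t s] by (cases "s \<le> t") (auto simp: norm_minus_commute abs_minus_commute)
  qed
  obtain N where N: "negligible N" "\<And>t. t \<in> {a..b} - N \<Longrightarrow>
        ((\<lambda>t. integral {a..t} f) has_vector_derivative f t) (at t within {a..b})"
    using indefinite_integral_has_vector_derivative_ae[OF f] by blast
  show "AE t in lebesgue_on {a..b}. (y has_vector_derivative f t) (at t within {a..b})"
  proof (rule AE_lebesgue_on_negligible[OF N(1)])
    fix t assume t: "t \<in> {a..b} - N"
    have "((\<lambda>t. c + integral {a..t} f) has_vector_derivative f t) (at t within {a..b})"
      using has_vector_derivative_add[OF has_vector_derivative_const N(2)[OF t]] by simp
    then show "(y has_vector_derivative f t) (at t within {a..b})"
      by (rule has_vector_derivative_transform[rotated -1]) (use t y in auto)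
  qed auto
qed

lemma abs_continuous_on_imp_continuous_on:
  fixes g :: "real \<Rightarrow> 'a::real_normed_vector"
  assumes ac: "abs_continuous_on {a..b} g"
  shows "continuous_on {a..b} g"
  unfolding continuous_on_iff
proof (intro ballI allI impI)
  fix s e :: real assume s: "s \<in> {a..b}" and "e > 0"
  then obtain \<delta> where \<delta>: "\<delta> > 0"
    "\<And>d T. d division_of T \<and> T \<subseteq> {a..b} \<and> (\<Sum>k\<in>d. Sup k - Inf k) < \<delta> \<Longrightarrow>
        (\<Sum>k\<in>d. norm (g (Sup k) - g (Inf k))) < e"
    using ac unfolding abs_continuous_on_def by meson
  have *: "norm (g v - g u) < e" if "u \<in> {a..b}" "v \<in> {a..b}" "u \<le> v" "v - u < \<delta>" for u v
  proof -
    have "{cbox u v} division_of cbox u v" using that by (intro division_of_self) auto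
    moreover have "cbox u v \<subseteq> {a..b}" using that by auto
    ultimately show ?thesis
      using \<delta>(2)[of "{cbox u v}" "cbox u v"] that by simp
  qed
  show "\<exists>d>0. \<forall>t\<in>{a..b}. dist t s < d \<longrightarrow> dist (g t) (g s) < e"
  proof (intro exI[of _ \<delta>] conjI ballI impI)
    fix t assume t: "t \<in> {a..b}" "dist t s < \<delta>"
    show "dist (g t) (g s) < e"
    proof (cases "s \<le> t")
      case True
      then show ?thesis using *[OF s t(1)] t(2) by (simp add: dist_norm)
    next
      case False
      then show ?thesis using *[OF t(1) s] t(2) by (simp add: dist_norm norm_minus_commute)
    qed
  qed (rule \<delta>(1))
qed

lemma abs_continuous_on_inner:
  fixes p y :: "real \<Rightarrow> 'a::real_inner"
  assumes p: "abs_continuous_on {a..b} p" and y: "abs_continuous_on {a..b} y"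
  shows "abs_continuous_on {a..b} (\<lambda>t. p t \<bullet> y t)"
proof -
  have "bounded (p ` {a..b})" "bounded (y ` {a..b})"
    using abs_continuous_on_imp_continuous_on[OF p] abs_continuous_on_imp_continuous_on[OF y]
    by (auto intro!: compact_imp_bounded compact_continuous_image)
  then obtain Bp By where "\<And>t. t \<in> {a..b} \<Longrightarrow> norm (p t) \<le> Bp" "\<And>t. t \<in> {a..b} \<Longrightarrow> norm (y t) \<le> By"
    unfolding bounded_iff by (metis imageI)
  then obtain B where B: "B > 0" "\<And>t. t \<in> {a..b} \<Longrightarrow> norm (p t) \<le> B" "\<And>t. t \<in> {a..b} \<Longrightarrow> norm (y t) \<le> B"
    by (intro that[of "max 1 (max Bp By)"]) (auto simp: max.coboundedI1 max.coboundedI2)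
  show ?thesis
    unfolding abs_continuous_on_def
  proof (intro allI impI)
    fix \<epsilon> :: real assume "\<epsilon> > 0"
    then have e: "\<epsilon> / (2 * B) > 0" using B(1) by simp
    obtain \<delta>1 where \<delta>1: "\<delta>1 > 0"
      "\<And>d T. d division_of T \<and> T \<subseteq> {a..b} \<and> (\<Sum>k\<in>d. Sup k - Inf k) < \<delta>1 \<Longrightarrow>
          (\<Sum>k\<in>d. norm (p (Sup k) - p (Inf k))) < \<epsilon> / (2 * B)"
      using p e unfolding abs_continuous_on_def by meson
    obtain \<delta>2 where \<delta>2: "\<delta>2 > 0"
      "\<And>d T. d division_of T \<and> T \<subseteq> {a..b} \<and> (\<Sum>k\<in>d. Sup k - Inf k) < \<delta>2 \<Longrightarrow>
          (\<Sum>k\<in>d. norm (y (Sup k) - y (Inf k))) < \<epsilon> / (2 * B)"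
      using y e unfolding abs_continuous_on_def by meson
    show "\<exists>\<delta>>0. \<forall>d T. d division_of T \<and> T \<subseteq> {a..b} \<and> (\<Sum>k\<in>d. Sup k - Inf k) < \<delta> \<longrightarrow>
        (\<Sum>k\<in>d. norm (p (Sup k) \<bullet> y (Sup k) - p (Inf k) \<bullet> y (Inf k))) < \<epsilon>"
    proof (intro exI[of _ "min \<delta>1 \<delta>2"] conjI allI impI)
      fix d T assume d: "d division_of T \<and> T \<subseteq> {a..b} \<and> (\<Sum>k\<in>d. Sup k - Inf k) < min \<delta>1 \<delta>2"
      have k: "norm (p (Sup k) \<bullet> y (Sup k) - p (Inf k) \<bullet> y (Inf k))
          \<le> B * norm (y (Sup k) - y (Inf k)) + B * norm (p (Sup k) - p (Inf k))" if "k \<in> d" for k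
      proof -
        obtain u v where k: "k = cbox u v" "k \<noteq> {}" "k \<subseteq> T"
          using d division_ofD(2,3,4)[of d T k] \<open>k \<in> d\<close> by metis
        then have uv: "u \<le> v" "Sup k = v" "Inf k = u" by auto
        have "{u..v} \<subseteq> {a..b}" using k(1,3) d by (metis cbox_interval order_trans)
        then have ab: "u \<in> {a..b}" "v \<in> {a..b}" using uv(1) by auto
        have "p v \<bullet> y v - p u \<bullet> y u = p v \<bullet> (y v - y u) + (p v - p u) \<bullet> y u"
          by (simp add: inner_diff_left inner_diff_right)
        also have "norm \<dots> \<le> norm (p v) * norm (y v - y u) + norm (p v - p u) * norm (y u)"
          by (intro norm_triangle_le add_mono) (auto simp: Cauchy_Schwarz_ineq2)
        also have "\<dots> \<le> B * norm (y v - y u) + norm (p v - p u) * B"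
          using B ab by (intro add_mono mult_right_mono mult_left_mono) auto
        finally show ?thesis using uv by (simp add: mult.commute)
      qed
      have "(\<Sum>k\<in>d. norm (p (Sup k) \<bullet> y (Sup k) - p (Inf k) \<bullet> y (Inf k)))
          \<le> B * (\<Sum>k\<in>d. norm (y (Sup k) - y (Inf k))) + B * (\<Sum>k\<in>d. norm (p (Sup k) - p (Inf k)))"
        using sum_mono[OF k] by (simp add: sum.distrib sum_distrib_left)
      also have "\<dots> < B * (\<epsilon> / (2 * B)) + B * (\<epsilon> / (2 * B))"
        using \<delta>1(2)[of d T] \<delta>2(2)[of d T] d B(1)
        by (intro add_strict_mono mult_strict_left_mono) auto
      also have "\<dots> = \<epsilon>" using B(1) by (simp add: field_simps)
      finally show "(\<Sum>k\<in>d. norm (p (Sup k) \<bullet> y (Sup k) - p (Inf k) \<bullet> y (Inf k))) < \<epsilon>" .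
    qed (use \<delta>1 \<delta>2 in auto)
  qed
qed

text \<open>
  This is where the costate equation enters the expansion of the cost: applied to the costate and two
  states with the same initial value, the boundary terms cancel.
\<close>

lemma has_integral_by_parts_inner:
  fixes p y :: "real \<Rightarrow> 'a::euclidean_space"
  assumes "a \<le> b"
    and p: "abs_continuous_on {a..b} p"
      "AE t in lebesgue_on {a..b}. (p has_vector_derivative p' t) (at t within {a..b})"
    and y: "abs_continuous_on {a..b} y"
      "AE t in lebesgue_on {a..b}. (y has_vector_derivative y' t) (at t within {a..b})"
  shows "((\<lambda>t. p t \<bullet> y' t + p' t \<bullet> y t) has_integral p b \<bullet> y b - p a \<bullet> y a) {a..b}"
proof (rule abs_continuous_on_has_integral_initial)
  show "abs_continuous_on {a..b} (\<lambda>t. p t \<bullet> y t)" by (rule abs_continuous_on_inner[OF p(1) y(1)])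
  show "AE t in lebesgue_on {a..b}.
     ((\<lambda>t. p t \<bullet> y t) has_vector_derivative p t \<bullet> y' t + p' t \<bullet> y t) (at t within {a..b})"
    using p(2) y(2)
  proof eventually_elim
    case (elim t)
    show ?case
      using bounded_bilinear.has_vector_derivative[OF bounded_bilinear_inner elim]
      by simp
  qed
qed (use \<open>a \<le> b\<close> in auto)

lemma borel_measurable_bounded_integrable_lebesgue_on:
  fixes g :: "real \<Rightarrow> 'a::euclidean_space"
  assumes "g \<in> borel_measurable (lebesgue_on {a..b})" "\<And>t. t \<in> {a..b} \<Longrightarrow> norm (g t) \<le> B"
  shows "integrable (lebesgue_on {a..b}) g"
proof -
  interpret finite_measure "lebesgue_on {a..b}" by (rule finite_measure_lebesgue_on) simp
  show ?thesis by (rule integrable_const_bound[of _ B]) (use assms in auto)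
qed

section \<open>Gronwall inequalities and Caratheodory differential equations\<close>

lemma gronwall:
  fixes v :: "real \<Rightarrow> real"
  assumes v: "continuous_on {0..T} v" and "K \<ge> 0"
    and le: "\<And>t. t \<in> {0..T} \<Longrightarrow> v t \<le> a + K * integral {0..t} v"
    and t: "t \<in> {0..T}"
  shows "v t \<le> a * exp (K * t)"
proof -
  define G where "G t = a + K * integral {0..t} v" for t
  have dG: "(G has_real_derivative K * v s) (at s within {0..T})" if "s \<in> {0..T}" for s
    unfolding G_def
    using integral_has_real_derivative[OF v that] by (auto intro!: derivative_eq_intros)
  define \<Phi> where "\<Phi> s = G s * exp (- K * s)" for s
  have d\<Phi>: "(\<Phi> has_real_derivative K * (v s - G s) * exp (- K * s)) (at s within {0..T})"
    if "s \<in> {0..T}" for s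
    unfolding \<Phi>_def by (rule derivative_eq_intros dG that refl | simp add: algebra_simps)+
  have "\<Phi> t \<le> \<Phi> 0"
  proof (rule DERIV_nonpos_imp_decreasing_open[of 0 t])
    show "0 \<le> t" using t by simp
    show "continuous_on {0..t} \<Phi>"
      using d\<Phi> t by (intro continuous_on_subset[of "{0..T}" \<Phi> "{0..t}"] DERIV_continuous_on) auto
    fix s assume s: "0 < s" "s < t"
    have "(\<Phi> has_real_derivative K * (v s - G s) * exp (- K * s)) (at s)"
      using d\<Phi>[of s] s t by (simp add: at_within_Icc_at)
    moreover have "K * (v s - G s) * exp (- K * s) \<le> 0"
      using le[of s] s t \<open>K \<ge> 0\<close> by (intro mult_nonpos_nonneg mult_nonneg_nonpos) (auto simp: G_def)
    ultimately show "\<exists>y. (\<Phi> has_real_derivative y) (at s) \<and> y \<le> 0" by blast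
  qed
  then have "G t \<le> a * exp (K * t)"
    by (simp add: \<Phi>_def G_def exp_minus field_simps)
  then show ?thesis using le[OF t] by (simp add: G_def)
qed

text \<open>
  Time reversal turns the costate equation, which has a terminal condition, into an initial value
  problem.
\<close>

lemma has_integral_reflect_around:
  fixes f :: "real \<Rightarrow> 'a::euclidean_space"
  assumes "(f has_integral i) {a..b}"
  shows "((\<lambda>s. f (T - s)) has_integral i) {T - b..T - a}"
proof -
  have "(\<lambda>x. T - x) ` {a..b} = {T - b..T - a}"
  proof safe
    fix x assume "x \<in> {T - b..T - a}"
    then show "x \<in> (\<lambda>x. T - x) ` {a..b}" by (intro image_eqI[of _ _ "T - x"]) auto
  qed auto
  then show ?thesis
    using has_integral_affinity[of f i a b "-1" T] assms by simp
qed

lemma gronwall_backward: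
  fixes v :: "real \<Rightarrow> real"
  assumes v: "continuous_on {0..T} v" and "K \<ge> 0"
    and le: "\<And>t. t \<in> {0..T} \<Longrightarrow> v t \<le> a + K * integral {t..T} v"
    and t: "t \<in> {0..T}"
  shows "v t \<le> a * exp (K * (T - t))"
proof -
  define w where "w s = v (T - s)" for s
  have w: "continuous_on {0..T} w"
    unfolding w_def by (rule continuous_on_compose2[OF v]) (auto intro!: continuous_intros)
  have "w s \<le> a + K * integral {0..s} w" if s: "s \<in> {0..T}" for s
  proof -
    have "v integrable_on {T - s..T}"
      by (rule integrable_continuous_interval, rule continuous_on_subset[OF v]) (use s in auto)
    from has_integral_reflect_around[OF integrable_integral[OF this], of T]
    have "integral {0..s} w = integral {T - s..T} v" by (simp add: w_def[abs_def] integral_unique)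
    then show ?thesis using le[of "T - s"] s by (simp add: w_def)
  qed
  from gronwall[OF w \<open>K \<ge> 0\<close> this, of "T - t"] t show ?thesis by (simp add: w_def)
qed

text \<open>
  Picard iteration for a right-hand side that is Lipschitz in the state and only integrable in time.
  Measuring successive differences against the weight \<open>exp (2 * K * t)\<close> makes the iteration a
  contraction on the whole interval at once.
\<close>

lemma caratheodory_existence:
  fixes F :: "real \<Rightarrow> 'a::euclidean_space \<Rightarrow> 'a"
  assumes "K > 0"
    and int: "\<And>y. continuous_on {0..T} y \<Longrightarrow> (\<lambda>s. F s (y s)) integrable_on {0..T}"
    and lip: "\<And>t x y. t \<in> {0..T} \<Longrightarrow> norm (F t x - F t y) \<le> K * norm (x - y)"
  obtains y where "continuous_on {0..T} y"
    "\<And>t. t \<in> {0..T} \<Longrightarrow> y t = y0 + integral {0..t} (\<lambda>s. F s (y s))"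
proof -
  define \<Psi> where "\<Psi> y t = y0 + integral {0..t} (\<lambda>s. F s (y s))" for y t
  define Y where "Y n = (\<Psi> ^^ n) (\<lambda>_. y0)" for n
  have Y: "Y 0 = (\<lambda>_. y0)" "Y (Suc n) = \<Psi> (Y n)" for n by (simp_all add: Y_def)
  have cont\<Psi>: "continuous_on {0..T} (\<Psi> y)" if "continuous_on {0..T} y" for y
    unfolding \<Psi>_def
    by (intro continuous_intros indefinite_integral_continuous_1 int that)
  have contY: "continuous_on {0..T} (Y n)" for n
    by (induction n) (auto simp: Y intro: cont\<Psi>)
  have int_t: "(\<lambda>s. F s (y s)) integrable_on {0..t}"
    if "continuous_on {0..T} y" "t \<in> {0..T}" for y t
    by (rule integrable_on_subinterval[OF int[OF that(1)]]) (use that in auto)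
  have diff: "norm (\<Psi> x t - \<Psi> y t) \<le> integral {0..t} b"
    if x: "continuous_on {0..T} x" and y: "continuous_on {0..T} y" and t: "t \<in> {0..T}"
      and b: "b integrable_on {0..t}" "\<And>s. s \<in> {0..t} \<Longrightarrow> K * norm (x s - y s) \<le> b s" for x y t b
  proof -
    have "\<Psi> x t - \<Psi> y t = integral {0..t} (\<lambda>s. F s (x s) - F s (y s))"
      using int_t[OF x t] int_t[OF y t] by (simp add: \<Psi>_def integral_diff)
    also have "norm \<dots> \<le> integral {0..t} b"
    proof (rule integral_norm_bound_integral[OF _ b(1)])
      show "(\<lambda>s. F s (x s) - F s (y s)) integrable_on {0..t}"
        by (intro integrable_diff int_t x y t)
      show "norm (F s (x s) - F s (y s)) \<le> b s" if "s \<in> {0..t}" for s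
        using lip[of s "x s" "y s"] b(2)[OF that] that t by auto
    qed
    finally show ?thesis .
  qed
  have "compact ((\<lambda>t. norm (Y 1 t - Y 0 t)) ` {0..T})"
    by (intro compact_continuous_image continuous_intros contY) auto
  from compact_imp_bounded[OF this] obtain C
    where C': "\<And>x. x \<in> (\<lambda>t. norm (Y 1 t - Y 0 t)) ` {0..T} \<Longrightarrow> norm x \<le> C"
    unfolding bounded_iff by blast
  have C: "norm (Y 1 t - Y 0 t) \<le> C" if "t \<in> {0..T}" for t
    using C'[OF imageI[OF that]] by simp
  have step: "norm (Y (Suc n) t - Y n t) \<le> C * (1/2) ^ n * exp (2 * K * t)" if "t \<in> {0..T}" for n t
    using that
  proof (induction n arbitrary: t)
    case 0
    have "norm (Y 1 t - Y 0 t) \<le> C" by (rule C[OF 0])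
    moreover from this have "C \<ge> 0" using norm_ge_zero order_trans by blast
    moreover have "1 \<le> exp (2 * K * t)" using 0 \<open>K > 0\<close> by auto
    ultimately have "norm (Y 1 t - Y 0 t) \<le> C * exp (2 * K * t)"
      by (metis mult.right_neutral mult_left_mono order_trans)
    then show ?case by simp
  next
    case (Suc n)
    have I: "((\<lambda>s. K * (C * (1/2) ^ n * exp (2 * K * s))) has_integral
        C * (1/2) ^ Suc n * exp (2 * K * t) - C * (1/2) ^ Suc n * exp (2 * K * 0)) {0..t}"
      by (rule fundamental_theorem_of_calculus)
        (use Suc.prems in \<open>auto intro!: derivative_eq_intros
           simp: has_real_derivative_iff_has_vector_derivative[symmetric]\<close>)
    have "norm (Y (Suc (Suc n)) t - Y (Suc n) t)
        \<le> integral {0..t} (\<lambda>s. K * (C * (1/2) ^ n * exp (2 * K * s)))"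
      unfolding Y(2)[of "Suc n"] Y(2)[of n]
    proof (rule diff)
      show "continuous_on {0..T} (\<Psi> (Y n))" "continuous_on {0..T} (Y n)"
        by (auto intro: cont\<Psi> contY)
      show "K * norm (\<Psi> (Y n) s - Y n s) \<le> K * (C * (1/2) ^ n * exp (2 * K * s))"
        if "s \<in> {0..t}" for s
        using Suc.IH[of s] that Suc.prems \<open>K > 0\<close> by (intro mult_left_mono) (auto simp: Y)
    qed (use Suc.prems I in auto)
    also have "\<dots> = C * (1/2) ^ Suc n * exp (2 * K * t) - C * (1/2) ^ Suc n * exp (2 * K * 0)"
      using I by (rule integral_unique)
    also have "\<dots> \<le> C * (1/2) ^ Suc n * exp (2 * K * t)"
    proof -
      have "C \<ge> 0" using C[OF Suc.prems] norm_ge_zero order_trans by blast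
      then show ?thesis by simp
    qed
    finally show ?case .
  qed
  have "uniform_limit {0..T} (\<lambda>n t. \<Sum>i<n. Y (Suc i) t - Y i t) (\<lambda>t. \<Sum>i. Y (Suc i) t - Y i t) sequentially"
  proof (rule Weierstrass_m_test)
    fix n t assume t: "t \<in> {0..T}"
    have "C \<ge> 0" using C[OF t] norm_ge_zero order_trans by blast
    have "norm (Y (Suc n) t - Y n t) \<le> C * (1/2) ^ n * exp (2 * K * t)"
      by (rule step[OF t])
    also have "\<dots> \<le> C * (1/2) ^ n * exp (2 * K * T)"
      using t \<open>K > 0\<close> \<open>C \<ge> 0\<close> by (intro mult_left_mono) auto
    finally show "norm (Y (Suc n) t - Y n t) \<le> (C * exp (2 * K * T)) * (1/2) ^ n"
      by (simp add: ac_simps)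
  qed (auto intro!: summable_mult summable_geometric)
  then have "uniform_limit {0..T} (\<lambda>n t. y0 + (\<Sum>i<n. Y (Suc i) t - Y i t))
      (\<lambda>t. y0 + (\<Sum>i. Y (Suc i) t - Y i t)) sequentially"
    by (intro uniform_limit_intros)
  moreover have "y0 + (\<Sum>i<n. Y (Suc i) t - Y i t) = Y n t" for n t
    using sum_lessThan_telescope[of "\<lambda>i. Y i t" n] by (simp add: Y(1))
  ultimately obtain y where y: "uniform_limit {0..T} Y y sequentially" by auto
  have conty: "continuous_on {0..T} y"
    by (rule uniform_limit_theorem[OF _ y]) (auto simp: contY)
  have "y t = \<Psi> y t" if t: "t \<in> {0..T}" for t
  proof -
    have "(\<lambda>n. Y (Suc n) t) \<longlonglongrightarrow> \<Psi> y t"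
    proof (rule tendstoI)
      fix e :: real assume "e > 0"
      define e' where "e' = e / (2 * K * (t + 1))"
      have "e' > 0" using \<open>e > 0\<close> \<open>K > 0\<close> t by (simp add: e'_def)
      from uniform_limitD[OF y this]
      show "\<forall>\<^sub>F n in sequentially. dist (Y (Suc n) t) (\<Psi> y t) < e"
      proof eventually_elim
        case (elim n)
        have "norm (\<Psi> (Y n) t - \<Psi> y t) \<le> integral {0..t} (\<lambda>s. K * e')"
        proof (rule diff[OF contY conty t])
          show "K * norm (Y n s - y s) \<le> K * e'" if "s \<in> {0..t}" for s
            using elim that t \<open>K > 0\<close> by (intro mult_left_mono) (auto simp: dist_norm less_imp_le)
        qed auto
        also have "\<dots> = t * (K * e')" using t by simp
        also have "\<dots> = e / 2 * (t / (t + 1))"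
          using \<open>K > 0\<close> by (simp add: e'_def)
        also have "\<dots> \<le> e / 2 * 1"
          using \<open>e > 0\<close> t by (intro mult_left_mono) auto
        also have "\<dots> < e" using \<open>e > 0\<close> by simp
        finally show ?case by (simp add: Y dist_norm)
      qed
    qed
    moreover have "(\<lambda>n. Y (Suc n) t) \<longlonglongrightarrow> y t"
      using tendsto_uniform_limitI[OF y t] by (rule LIMSEQ_Suc)
    ultimately show ?thesis using LIMSEQ_unique by blast
  qed
  then show ?thesis using that[OF conty] by (simp add: \<Psi>_def)
qed

section \<open>Locally Lipschitz functions\<close>

lemma locally_lipschitz_on_imp_continuous_on:
  assumes "locally_lipschitz_on S g"
  shows "continuous_on S g"
  unfolding continuous_on_eq_continuous_within
proof
  fix z assume "z \<in> S"
  then obtain r C where rC: "r > 0" "C-lipschitz_on (cball z r \<inter> S) g"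
    using assms unfolding locally_lipschitz_on_def by blast
  have "continuous (at z within (cball z r \<inter> S)) g"
    using lipschitz_on_continuous_within[OF rC(2)] \<open>z \<in> S\<close> rC(1) by auto
  then have "continuous (at z within (S \<inter> cball z r)) g"
    by (simp add: Int_commute)
  moreover have "at z within (S \<inter> cball z r) = at z within S"
    using rC(1) by (intro at_within_nhd[of z "ball z r"]) auto
  ultimately show "continuous (at z within S) g" by simp
qed

lemma continuous_on_snd_section:
  assumes "continuous_on (X \<times> U) (\<lambda>(x, u). g x u)" "x \<in> X"
  shows "continuous_on U (g x)"
proof -
  have "continuous_on U (\<lambda>u. case (x, u) of (x, u) \<Rightarrow> g x u)"
    by (rule continuous_on_compose2[OF assms(1) continuous_on_Pair[OF continuous_on_const continuous_on_id]])
      (use assms(2) in auto)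
  then show ?thesis by simp
qed

text \<open>
  Joint local Lipschitz continuity on a compact set of controls gives one Lipschitz constant in the
  state for all controls; this is the source of the uniform constants of the descent argument.
\<close>

lemma locally_lipschitz_on_uniform_fst:
  assumes lip: "locally_lipschitz_on (UNIV \<times> U) (\<lambda>(x, u). g x u)"
    and "compact U" "compact X"
  obtains \<Lambda> where "\<And>u. u \<in> U \<Longrightarrow> \<Lambda>-lipschitz_on X (\<lambda>x. g x u)"
proof -
  have "local_lipschitz U X (\<lambda>u x. g x u)"
  proof (rule local_lipschitzI)
    fix u x assume u: "u \<in> U" and "x \<in> X"
    then obtain r C where rC: "r > 0" "C-lipschitz_on (cball (x, u) r \<inter> (UNIV \<times> U)) (\<lambda>(x, u). g x u)"
      using lip unfolding locally_lipschitz_on_def by blast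
    have "C-lipschitz_on (cball x (r/2) \<inter> X) (\<lambda>x. g x v)" if "v \<in> cball u (r/2) \<inter> U" for v
    proof (rule lipschitz_onI)
      fix y z assume yz: "y \<in> cball x (r/2) \<inter> X" "z \<in> cball x (r/2) \<inter> X"
      have "(w, v) \<in> cball (x, u) r \<inter> (UNIV \<times> U)" if "w \<in> cball x (r/2)" for w
      proof -
        have "dist (x, u) (w, v) \<le> dist x w + dist u v"
          unfolding dist_Pair_Pair by (rule sqrt_sum_squares_le_sum) auto
        then show ?thesis using that \<open>v \<in> cball u (r/2) \<inter> U\<close> by auto
      qed
      then have "(y, v) \<in> cball (x, u) r \<inter> (UNIV \<times> U)" "(z, v) \<in> cball (x, u) r \<inter> (UNIV \<times> U)"
        using yz by blast+
      from lipschitz_onD[OF rC(2) this]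
      have "dist (g y v) (g z v) \<le> C * dist (y, v) (z, v)" by simp
      then show "dist (g y v) (g z v) \<le> C * dist y z" by (simp add: dist_Pair_Pair)
    qed (rule lipschitz_on_nonneg[OF rC(2)])
    then show "\<exists>s>0. \<exists>C. \<forall>v\<in>cball u s \<inter> U. C-lipschitz_on (cball x s \<inter> X) (\<lambda>x. g x v)"
      using rC(1) by (intro exI[of _ "r/2"] conjI exI[of _ C]) auto
  qed
  moreover have "continuous_on U (\<lambda>u. g x u)" for x
    by (rule continuous_on_snd_section[OF locally_lipschitz_on_imp_continuous_on[OF lip]]) simp
  ultimately show ?thesis
    using local_lipschitz_compact_implies_lipschitz[of U X "\<lambda>u x. g x u"] assms(2,3) that by blast
qed

section \<open>Derivatives in the state\<close>

lemma dx_has_derivative: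
  assumes "C1_in_x U g" "u \<in> U"
  shows "((\<lambda>y. g y u) has_derivative blinfun_apply (dx g x u)) (at x)"
proof -
  have d: "((\<lambda>y. g y u) has_derivative frechet_derivative (\<lambda>y. g y u) (at x)) (at x)"
    using assms unfolding C1_in_x_def by (simp add: frechet_derivative_works[symmetric])
  then have "blinfun_apply (dx g x u) = frechet_derivative (\<lambda>y. g y u) (at x)"
    unfolding dx_def by (intro bounded_linear_Blinfun_apply has_derivative_bounded_linear)
  with d show ?thesis by simp
qed

text \<open>
  A Lipschitz first derivative suffices for a quadratic remainder, by the mean value inequality on the
  segment from \<open>x\<close> to \<open>y\<close>.
\<close>

lemma dx_linearization_error:
  fixes g :: "'a::euclidean_space \<Rightarrow> 'b \<Rightarrow> 'c::real_normed_vector"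
  assumes g: "C1_in_x U g" and u: "u \<in> U" and S: "convex S" "x \<in> S" "y \<in> S"
    and lip: "\<Lambda>-lipschitz_on S (\<lambda>x. dx g x u)"
  shows "norm (g y u - g x u - dx g x u (y - x)) \<le> \<Lambda> * (norm (y - x))\<^sup>2"
proof -
  have seg: "closed_segment x y \<subseteq> S" using S by (simp add: closed_segment_subset)
  have "norm (g y u - g x u - blinfun_apply (dx g x u) (y - x)) \<le> norm (y - x) * (\<Lambda> * norm (y - x))"
  proof (rule differentiable_bound_linearization[where S = "closed_segment x y" and ?x0.0 = x
        and f' = "\<lambda>z. blinfun_apply (dx g z u)"])
    show "x + t *\<^sub>R (y - x) \<in> closed_segment x y" if "t \<in> {0..1}" for t
      using that unfolding closed_segment_def
      by (intro CollectI exI[of _ t]) (simp add: algebra_simps)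
    show "((\<lambda>y. g y u) has_derivative blinfun_apply (dx g z u)) (at z within closed_segment x y)" for z
      using dx_has_derivative[OF g u] by (rule has_derivative_at_withinI)
    fix z assume z: "z \<in> closed_segment x y"
    have "onorm (blinfun_apply (dx g z u) - blinfun_apply (dx g x u)) = norm (dx g z u - dx g x u)"
      by (simp add: norm_blinfun.rep_eq minus_blinfun.rep_eq fun_diff_def)
    also have "\<dots> \<le> \<Lambda> * norm (z - x)"
      using lipschitz_on_normD[OF lip, of z x] seg z S(2) by auto
    also have "\<dots> \<le> \<Lambda> * norm (y - x)"
      using segment_bound1[OF z] lipschitz_on_nonneg[OF lip] by (intro mult_left_mono)
    finally show "onorm (blinfun_apply (dx g z u) - blinfun_apply (dx g x u)) \<le> \<Lambda> * norm (y - x)" .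
  qed auto
  then show ?thesis by (simp add: power2_eq_square algebra_simps)
qed

text \<open>The gradient in \<open>x\<close> of \<open>p \<bullet> f x u + L x u\<close>; the costate moves along minus its average over the control.\<close>

definition adjoint_field ::
  "(real^'n \<Rightarrow> real^'k \<Rightarrow> real^'n) \<Rightarrow> (real^'n \<Rightarrow> real^'k \<Rightarrow> real) \<Rightarrow> real^'n \<Rightarrow> real^'k \<Rightarrow> real^'n \<Rightarrow> real^'n" where
  "adjoint_field f L x u p = transpose (matrix (blinfun_apply (dx f x u))) *v p + grad_x L x u"

lemma inner_transpose_matrix:
  "(transpose (matrix (blinfun_apply A)) *v p) \<bullet> h = p \<bullet> blinfun_apply A h"
  for A :: "(real^'n) \<Rightarrow>\<^sub>L (real^'m)"
  unfolding transpose_matrix_vector dot_lmul_matrix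
  using matrix_vector_mul(3)[OF blinfun.bounded_linear_right[of A]] by (metis)

lemma inner_grad_x: "grad_x L x u \<bullet> h = blinfun_apply (dx L x u) h"
proof -
  have "blinfun_apply (dx L x u) h = blinfun_apply (dx L x u) (\<Sum>i\<in>UNIV. (h $ i) *\<^sub>R axis i 1)"
    using basis_expansion[of h] by (simp add: scalar_mult_eq_scaleR)
  also have "\<dots> = (\<Sum>i\<in>UNIV. (h $ i) * blinfun_apply (dx L x u) (axis i 1))"
    by (simp add: blinfun.sum_right blinfun.scaleR_right)
  finally show ?thesis by (simp add: grad_x_def inner_vec_def mult.commute)
qed

lemma inner_adjoint_field:
  "adjoint_field f L x u p \<bullet> h = p \<bullet> blinfun_apply (dx f x u) h + blinfun_apply (dx L x u) h"
  by (simp add: adjoint_field_def inner_add_left inner_transpose_matrix inner_grad_x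
      del: transpose_matrix_vector)

lemma norm_le_of_inner_le:
  fixes v :: "'a::real_inner"
  assumes "c \<ge> 0" "\<And>h. v \<bullet> h \<le> c * norm h"
  shows "norm v \<le> c"
proof (cases "v = 0")
  case False
  have "norm v * norm v \<le> c * norm v"
    using assms(2)[of v] by (simp add: power2_norm_eq_inner[symmetric] power2_eq_square)
  then show ?thesis using False by simp
qed (use assms(1) in simp)

lemma adjoint_field_bounds:
  assumes f: "norm (dx f x u) \<le> M" and L: "norm (dx L x u) \<le> M"
  shows "norm (adjoint_field f L x u p) \<le> M * (norm p + 1)"
    and "norm (adjoint_field f L x u p - adjoint_field f L x u q) \<le> M * norm (p - q)"
proof -
  have M: "M \<ge> 0" using f norm_ge_zero order_trans by blast
  have bf: "r \<bullet> blinfun_apply (dx f x u) h \<le> M * norm r * norm h" for r h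
  proof -
    have "r \<bullet> blinfun_apply (dx f x u) h \<le> norm r * norm (blinfun_apply (dx f x u) h)"
      by (rule norm_cauchy_schwarz)
    also have "\<dots> \<le> norm r * (norm (dx f x u) * norm h)"
      by (intro mult_left_mono norm_blinfun) simp
    also have "\<dots> \<le> norm r * (M * norm h)"
      by (intro mult_left_mono mult_right_mono f) simp_all
    finally show ?thesis by (simp add: ac_simps)
  qed
  have bL: "blinfun_apply (dx L x u) h \<le> M * norm h" for h
  proof -
    have "blinfun_apply (dx L x u) h \<le> norm (blinfun_apply (dx L x u) h)" by simp
    also have "\<dots> \<le> norm (dx L x u) * norm h" by (rule norm_blinfun)
    also have "\<dots> \<le> M * norm h" by (intro mult_right_mono L) simp
    finally show ?thesis .
  qed
  show "norm (adjoint_field f L x u p) \<le> M * (norm p + 1)"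
  proof (rule norm_le_of_inner_le)
    show "adjoint_field f L x u p \<bullet> h \<le> M * (norm p + 1) * norm h" for h
      using bf[of p h] bL[of h] by (simp add: inner_adjoint_field algebra_simps)
  qed (use M in simp)
  show "norm (adjoint_field f L x u p - adjoint_field f L x u q) \<le> M * norm (p - q)"
  proof (rule norm_le_of_inner_le)
    show "(adjoint_field f L x u p - adjoint_field f L x u q) \<bullet> h \<le> M * norm (p - q) * norm h" for h
      using bf[of "p - q" h] by (simp add: inner_diff_left inner_adjoint_field)
  qed (use M in simp)
qed

lemma continuous_on_adjoint_field:
  fixes f :: "real^'n \<Rightarrow> real^'k \<Rightarrow> real^'n" and L :: "real^'n \<Rightarrow> real^'k \<Rightarrow> real"
  assumes f: "continuous_on (UNIV \<times> U) (\<lambda>(x, u). dx f x u)"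
    and L: "continuous_on (UNIV \<times> U) (\<lambda>(x, u). dx L x u)"
  shows "continuous_on (UNIV \<times> U) (\<lambda>(z, u). adjoint_field f L (fst z) u (snd z))"
  unfolding continuous_on_componentwise[of _ "\<lambda>(z, u). adjoint_field f L (fst z) u (snd z)"]
proof
  fix h :: "real^'n"
  have p: "continuous_on (UNIV \<times> U) (\<lambda>w. (fst (fst w), snd w))" by (intro continuous_intros)
  have "continuous_on (UNIV \<times> U) (\<lambda>w. dx f (fst (fst w)) (snd w))"
    using continuous_on_compose2[OF f p] by force
  moreover have "continuous_on (UNIV \<times> U) (\<lambda>w. dx L (fst (fst w)) (snd w))"
    using continuous_on_compose2[OF L p] by force
  ultimately have "continuous_on (UNIV \<times> U) (\<lambda>w. snd (fst w) \<bullet> blinfun_apply (dx f (fst (fst w)) (snd w)) h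
      + blinfun_apply (dx L (fst (fst w)) (snd w)) h)"
    by (intro continuous_intros)
  then show "continuous_on (UNIV \<times> U) (\<lambda>w. (case w of (z, u) \<Rightarrow> adjoint_field f L (fst z) u (snd z)) \<bullet> h)"
    by (simp add: split_def inner_adjoint_field)
qed

lemma is_costate_alt:
  "is_costate tf f L \<mu> x p \<longleftrightarrow> abs_continuous_on {0..tf} p \<and> p tf = 0 \<and>
     (AE t in lebesgue_on {0..tf}.
        (p has_vector_derivative - (\<integral>u. adjoint_field f L (x t) u (p t) \<partial>\<mu> t)) (at t within {0..tf}))"
  by (simp add: is_costate_def adjoint_field_def)

section \<open>Relaxed controls as probability kernels\<close>

lemma integral_kernel_measurable:
  fixes f :: "'a \<Rightarrow> 'b \<Rightarrow> 'c::{banach, second_countable_topology}"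
  assumes f: "(\<lambda>(x, y). f x y) \<in> borel_measurable (M \<Otimes>\<^sub>M N)"
    and L: "L \<in> M \<rightarrow>\<^sub>M subprob_algebra N"
  shows "(\<lambda>x. \<integral>y. f x y \<partial>L x) \<in> borel_measurable M"
proof -
  note [measurable] = f L integral_measurable_subprob_algebra measurable_distr2
  have "(\<lambda>x. \<integral>z. (\<lambda>(x, y). f x y) z \<partial>distr (L x) (M \<Otimes>\<^sub>M N) (\<lambda>y. (x, y))) \<in> borel_measurable M"
    by measurable
  then show ?thesis
  proof (rule measurable_cong[THEN iffD1, rotated])
    fix x assume x: "x \<in> space M"
    then have [measurable_cong]: "sets (L x) = sets N"
      using L by (intro sets_kernel)
    show "(\<integral>z. (\<lambda>(x, y). f x y) z \<partial>distr (L x) (M \<Otimes>\<^sub>M N) (\<lambda>y. (x, y))) = (\<integral>y. f x y \<partial>L x)"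
      using x by (subst integral_distr) (auto intro!: measurable_Pair1')
  qed
qed

lemma borel_probsD:
  assumes "\<nu> \<in> borel_probs U"
  shows "prob_space \<nu>" "sets \<nu> = sets (restrict_space borel U)" "space \<nu> = U"
  using assms sets_eq_imp_space_eq[of \<nu> "restrict_space borel U"]
  by (auto simp: borel_probs_def space_restrict_space)

lemma borel_probs_measurable:
  fixes g :: "'u::topological_space \<Rightarrow> 'c::euclidean_space"
  assumes "\<nu> \<in> borel_probs U" "continuous_on U g"
  shows "g \<in> borel_measurable \<nu>"
  using borel_measurable_continuous_on_restrict[OF assms(2)]
    measurable_cong_sets[OF borel_probsD(2)[OF assms(1)] refl] by blast

lemma borel_probs_integrable:
  fixes g :: "'u::euclidean_space \<Rightarrow> 'c::euclidean_space"
  assumes "compact U" "\<nu> \<in> borel_probs U" "continuous_on U g"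
  shows "integrable \<nu> g"
proof -
  interpret prob_space \<nu> by (rule borel_probsD(1)[OF assms(2)])
  obtain B where "\<And>u. u \<in> U \<Longrightarrow> norm (g u) \<le> B"
    using compact_imp_bounded[OF compact_continuous_image[OF assms(3,1)]]
    unfolding bounded_iff by auto
  then show ?thesis
    using borel_probs_measurable[OF assms(2,3)] borel_probsD(3)[OF assms(2)]
    by (intro integrable_const_bound[of _ B]) auto
qed

lemma borel_probs_norm_integral_le:
  fixes g :: "'u::euclidean_space \<Rightarrow> 'c::euclidean_space"
  assumes "compact U" "\<nu> \<in> borel_probs U" "continuous_on U g"
    and B: "\<And>u. u \<in> U \<Longrightarrow> norm (g u) \<le> B"
  shows "norm (\<integral>u. g u \<partial>\<nu>) \<le> B"
proof -
  interpret prob_space \<nu> by (rule borel_probsD(1)[OF assms(2)])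
  have int: "integrable \<nu> g" by (rule borel_probs_integrable[OF assms(1-3)])
  have "norm (\<integral>u. g u \<partial>\<nu>) \<le> (\<integral>u. norm (g u) \<partial>\<nu>)" by (rule integral_norm_bound)
  also have "\<dots> \<le> (\<integral>u. B \<partial>\<nu>)"
    using B borel_probsD(3)[OF assms(2)] int by (intro integral_mono) auto
  finally show ?thesis by (simp add: prob_space)
qed

text \<open>
  Measurability against continuous test functions upgrades to measurability as a probability kernel:
  the indicator of a closed set is the limit of the continuous functions
  \<open>max 0 (1 - n * infdist u A)\<close>, and closed sets generate the Borel sets and are stable under
  intersection. Integrals of jointly measurable integrands are then measurable in time.
\<close>

lemma relaxed_control_kernel:
  fixes U :: "'u::euclidean_space set"
  assumes U: "compact U" and \<mu>: "\<mu> \<in> relaxed_controls U T"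
  shows "\<mu> \<in> lebesgue_on {0..T} \<rightarrow>\<^sub>M prob_algebra (restrict_space borel U)"
proof (rule measurable_prob_algebra_generated)
  have sub: "U \<in> sigma_sets UNIV (Collect closed)"
    using compact_imp_closed[OF U] by (intro sigma_sets.Basic) simp
  have "sets (restrict_space borel U) = (\<inter>) U ` sigma_sets UNIV (Collect closed)"
    by (simp add: sets_restrict_space borel_eq_closed)
  also have "\<dots> = sigma_sets U ((\<inter>) U ` Collect closed)"
    by (rule sigma_sets_Int[OF sub]) simp
  finally show "sets (restrict_space borel U) = sigma_sets U ((\<inter>) U ` Collect closed)" .
  show "Int_stable ((\<inter>) U ` Collect closed)"
  proof (rule Int_stableI)
    fix A B assume "A \<in> (\<inter>) U ` Collect closed" "B \<in> (\<inter>) U ` Collect closed"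
    then obtain F G where "closed F" "A = U \<inter> F" "closed G" "B = U \<inter> G" by auto
    then show "A \<inter> B \<in> (\<inter>) U ` Collect closed"
      by (intro image_eqI[of _ _ "F \<inter> G"]) auto
  qed
  show "(\<inter>) U ` Collect closed \<subseteq> Pow U" by auto
  fix t assume "t \<in> space (lebesgue_on {0..T})"
  then have t: "\<mu> t \<in> borel_probs U"
    using \<mu> by (auto simp: relaxed_controls_def)
  then show "prob_space (\<mu> t)" "sets (\<mu> t) = sets (restrict_space borel U)"
    using borel_probsD(1,2)[OF t] by simp_all
next
  fix A assume "A \<in> (\<inter>) U ` Collect closed"
  then obtain F where F: "closed F" "A = U \<inter> F" by auto
  have A: "closed A" "A \<subseteq> U" using F compact_imp_closed[OF U] by auto
  show "(\<lambda>t. emeasure (\<mu> t) A) \<in> borel_measurable (lebesgue_on {0..T})"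
  proof (cases "A = {}")
    case False
    define \<phi> where "\<phi> n u = max 0 (1 - real n * infdist u A)" for n u
    have \<phi>cont: "continuous_on U (\<phi> n)" for n
      unfolding \<phi>_def by (intro continuous_intros)
    have \<phi>lim: "(\<lambda>n. \<phi> n u) \<longlonglongrightarrow> indicator A u" for u
    proof (cases "u \<in> A")
      case True then show ?thesis by (simp add: \<phi>_def)
    next
      case False
      then have d: "infdist u A > 0"
        using A(1) \<open>A \<noteq> {}\<close> by (metis in_closed_iff_infdist_zero infdist_nonneg order_le_less)
      obtain m where m: "inverse (infdist u A) < real m" using reals_Archimedean2 by blast
      have "\<phi> n u = 0" if "n \<ge> m" for n
      proof -
        have "inverse (infdist u A) \<le> real n" using m that by simp
        then have "1 \<le> real n * infdist u A" using d by (simp add: field_simps)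
        then show ?thesis by (simp add: \<phi>_def)
      qed
      then have "\<forall>\<^sub>F n in sequentially. \<phi> n u = indicator A u"
        using False unfolding eventually_sequentially by auto
      then show ?thesis by (rule tendsto_eventually)
    qed
    have "(\<lambda>t. measure (\<mu> t) A) \<in> borel_measurable (lebesgue_on {0..T})"
    proof (rule borel_measurable_LIMSEQ_real)
      show "(\<lambda>t. \<integral>u. \<phi> n u \<partial>\<mu> t) \<in> borel_measurable (lebesgue_on {0..T})" for n
        using \<mu> \<phi>cont by (auto simp: relaxed_controls_def)
      fix t assume "t \<in> space (lebesgue_on {0..T})"
      then have t: "\<mu> t \<in> borel_probs U" using \<mu> by (auto simp: relaxed_controls_def)
      interpret prob_space "\<mu> t" by (rule borel_probsD(1)[OF t])
      have As: "A \<in> sets (\<mu> t)"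
        unfolding borel_probsD(2)[OF t] sets_restrict_space using A by auto
      have "(\<lambda>n. \<integral>u. \<phi> n u \<partial>\<mu> t) \<longlonglongrightarrow> (\<integral>u. indicator A u \<partial>\<mu> t)"
      proof (rule integral_dominated_convergence[where w = "\<lambda>_. 1"])
        show "\<phi> n \<in> borel_measurable (\<mu> t)" for n
          by (rule borel_probs_measurable[OF t \<phi>cont])
        show "AE u in \<mu> t. norm (\<phi> n u) \<le> 1" for n
          by (rule AE_I2) (simp add: \<phi>_def infdist_nonneg)
      qed (use As \<phi>lim in auto)
      then show "(\<lambda>n. \<integral>u. \<phi> n u \<partial>\<mu> t) \<longlonglongrightarrow> measure (\<mu> t) A"
        using As by simp
    qed
    then have "(\<lambda>t. ennreal (measure (\<mu> t) A)) \<in> borel_measurable (lebesgue_on {0..T})" by measurable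
    then show ?thesis
    proof (rule measurable_cong[THEN iffD1, rotated])
      fix t assume "t \<in> space (lebesgue_on {0..T})"
      then have t: "\<mu> t \<in> borel_probs U" using \<mu> by (auto simp: relaxed_controls_def)
      interpret prob_space "\<mu> t" by (rule borel_probsD(1)[OF t])
      show "ennreal (measure (\<mu> t) A) = emeasure (\<mu> t) A" by (simp add: emeasure_eq_measure)
    qed
  qed simp
qed

text \<open>
  In applications \<open>z\<close> is the state, or the pair of state and costate; this gives measurability in
  time of every integrand of the problem.
\<close>

lemma relaxed_control_integral_measurable:
  fixes U :: "'u::euclidean_space set" and \<Phi> :: "'z::euclidean_space \<Rightarrow> 'u \<Rightarrow> 'c::euclidean_space"
  assumes U: "compact U" and \<mu>: "\<mu> \<in> relaxed_controls U T"
    and \<Phi>: "continuous_on (UNIV \<times> U) (\<lambda>(z, u). \<Phi> z u)"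
    and z: "z \<in> borel_measurable (lebesgue_on {0..T})"
  shows "(\<lambda>t. \<integral>u. \<Phi> (z t) u \<partial>\<mu> t) \<in> borel_measurable (lebesgue_on {0..T})"
proof (rule integral_kernel_measurable)
  show "\<mu> \<in> lebesgue_on {0..T} \<rightarrow>\<^sub>M subprob_algebra (restrict_space borel U)"
    by (rule measurable_prob_algebraD[OF relaxed_control_kernel[OF U \<mu>]])
  let ?P = "lebesgue_on {0..T} \<Otimes>\<^sub>M restrict_space borel U"
  have "(\<lambda>w. snd w) \<in> ?P \<rightarrow>\<^sub>M restrict_space borel U" by measurable
  then have s: "(\<lambda>w. snd w) \<in> ?P \<rightarrow>\<^sub>M borel" "\<And>w. w \<in> space ?P \<Longrightarrow> snd w \<in> U"
    by (auto simp: measurable_restrict_space2_iff)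
  have "(\<lambda>w. (z (fst w), snd w)) \<in> ?P \<rightarrow>\<^sub>M restrict_space borel (UNIV \<times> U)"
  proof (rule measurable_restrict_space2)
    show "(\<lambda>w. (z (fst w), snd w)) \<in> space ?P \<rightarrow> UNIV \<times> U" using s(2) by auto
    have "(\<lambda>w. (z (fst w), snd w)) \<in> ?P \<rightarrow>\<^sub>M borel \<Otimes>\<^sub>M borel"
      using z s(1) by measurable
    then show "(\<lambda>w. (z (fst w), snd w)) \<in> ?P \<rightarrow>\<^sub>M borel" by (simp add: borel_prod)
  qed
  from measurable_compose[OF this borel_measurable_continuous_on_restrict[OF \<Phi>]]
  show "(\<lambda>(t, u). \<Phi> (z t) u) \<in> borel_measurable ?P"
    by (simp add: split_def)
qed

section \<open>Mixtures of measures and of relaxed controls\<close>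

lemma emeasure_mix_measure:
  assumes sets: "sets N = sets M"
  shows "emeasure (mix_measure c M N) A = ennreal (1 - c) * emeasure M A + ennreal c * emeasure N A"
proof (cases "A \<in> sets M")
  case True
  show ?thesis
    unfolding mix_measure_def
  proof (rule emeasure_measure_of_sigma[OF sets.sigma_algebra_axioms])
    show "positive (sets M) (\<lambda>A. ennreal (1 - c) * emeasure M A + ennreal c * emeasure N A)"
      by (simp add: positive_def)
    show "countably_additive (sets M) (\<lambda>A. ennreal (1 - c) * emeasure M A + ennreal c * emeasure N A)"
    proof (rule countably_additiveI)
      fix F :: "nat \<Rightarrow> 'a set"
      assume F: "range F \<subseteq> sets M" "disjoint_family F" "\<Union> (range F) \<in> sets M"
      then have "(\<Sum>i. emeasure M (F i)) = emeasure M (\<Union> (range F))"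
        "(\<Sum>i. emeasure N (F i)) = emeasure N (\<Union> (range F))"
        using sets by (auto intro!: suminf_emeasure)
      then show "(\<Sum>i. ennreal (1 - c) * emeasure M (F i) + ennreal c * emeasure N (F i))
          = ennreal (1 - c) * emeasure M (\<Union> (range F)) + ennreal c * emeasure N (\<Union> (range F))"
        by (simp add: suminf_add[symmetric])
    qed
  qed (rule True)
next
  case False
  then show ?thesis
    using sets by (simp add: emeasure_notin_sets mix_measure_def)
qed

lemma sets_mix_measure [simp]: "sets (mix_measure c M N) = sets M"
  and space_mix_measure [simp]: "space (mix_measure c M N) = space M"
  by (simp_all add: mix_measure_def)

lemma nn_integral_mix_measure:
  assumes sets: "sets N = sets M" and g: "g \<in> borel_measurable M"
  shows "(\<integral>\<^sup>+x. g x \<partial>mix_measure c M N)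
    = ennreal (1 - c) * (\<integral>\<^sup>+x. g x \<partial>M) + ennreal c * (\<integral>\<^sup>+x. g x \<partial>N)"
proof -
  have mN: "borel_measurable N = borel_measurable M"
    and mM: "borel_measurable (mix_measure c M N) = borel_measurable M"
    using measurable_cong_sets[OF sets refl] measurable_cong_sets[OF sets_mix_measure refl] by blast+
  have sp: "space N = space M" using sets by (rule sets_eq_imp_space_eq)
  show ?thesis
    using g
  proof induction
    case (cong f g)
    then show ?case
      using sp by (metis (no_types, lifting) nn_integral_cong space_mix_measure)
  next
    case (set A)
    then show ?case using sets by (simp add: emeasure_mix_measure)
  next
    case (mult u r)
    then show ?case
      by (simp add: nn_integral_cmult mN mM distrib_left mult.left_commute)
  next
    case (add u v)
    then show ?case
      by (simp add: nn_integral_add mN mM algebra_simps)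
  next
    case (seq F)
    have inc: "incseq (\<lambda>i. \<integral>\<^sup>+x. F i x \<partial>M)" "incseq (\<lambda>i. \<integral>\<^sup>+x. F i x \<partial>N)"
      using seq(3) by (auto simp: incseq_def le_fun_def intro!: nn_integral_mono)
    have eq: "(SUP i. F i) = (\<lambda>x. SUP i. F i x)" by (auto simp: fun_eq_iff image_comp)
    have "(\<integral>\<^sup>+x. (SUP i. F i x) \<partial>mix_measure c M N) = (SUP i. \<integral>\<^sup>+x. F i x \<partial>mix_measure c M N)"
      by (rule nn_integral_monotone_convergence_SUP) (use seq mM in auto)
    also have "\<dots> = (SUP i. ennreal (1 - c) * (\<integral>\<^sup>+x. F i x \<partial>M) + ennreal c * (\<integral>\<^sup>+x. F i x \<partial>N))"
      using seq by simp
    also have "\<dots> = (SUP i. ennreal (1 - c) * (\<integral>\<^sup>+x. F i x \<partial>M)) + (SUP i. ennreal c * (\<integral>\<^sup>+x. F i x \<partial>N))"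
      by (rule ennreal_SUP_add)
        (use inc in \<open>auto simp: incseq_def intro!: mult_left_mono\<close>)
    also have "\<dots> = ennreal (1 - c) * (SUP i. \<integral>\<^sup>+x. F i x \<partial>M) + ennreal c * (SUP i. \<integral>\<^sup>+x. F i x \<partial>N)"
      by (simp add: SUP_mult_left_ennreal)
    also have "(SUP i. \<integral>\<^sup>+x. F i x \<partial>M) = (\<integral>\<^sup>+x. (SUP i. F i x) \<partial>M)"
      by (rule nn_integral_monotone_convergence_SUP[symmetric]) (use seq in auto)
    also have "(SUP i. \<integral>\<^sup>+x. F i x \<partial>N) = (\<integral>\<^sup>+x. (SUP i. F i x) \<partial>N)"
      by (rule nn_integral_monotone_convergence_SUP[symmetric]) (use seq mN in auto)
    finally show ?case unfolding eq .
  qed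
qed

lemma mix_measure_in_borel_probs:
  assumes "\<mu> \<in> borel_probs U" "\<nu> \<in> borel_probs U" "0 \<le> c" "c \<le> 1"
  shows "mix_measure c \<mu> \<nu> \<in> borel_probs U"
proof -
  have s: "sets \<nu> = sets \<mu>" using borel_probsD(2) assms(1,2) by metis
  have "emeasure \<mu> U = 1" "emeasure \<nu> U = 1"
    using prob_space.emeasure_space_1[OF borel_probsD(1)[OF assms(1)]]
      prob_space.emeasure_space_1[OF borel_probsD(1)[OF assms(2)]] borel_probsD(3) assms(1,2) by auto
  then have "emeasure (mix_measure c \<mu> \<nu>) U = ennreal (1 - c) + ennreal c"
    by (simp add: emeasure_mix_measure[OF s])
  also have "\<dots> = 1" using assms(3,4) by (simp add: ennreal_plus[symmetric] del: ennreal_plus)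
  finally have "prob_space (mix_measure c \<mu> \<nu>)"
    by (intro prob_spaceI) (simp add: borel_probsD(3)[OF assms(1)])
  then show ?thesis using borel_probsD(2)[OF assms(1)] by (simp add: borel_probs_def)
qed

lemma integral_mix_measure_real:
  fixes g :: "'u::euclidean_space \<Rightarrow> real"
  assumes U: "compact U" and \<mu>: "\<mu> \<in> borel_probs U" and \<nu>: "\<nu> \<in> borel_probs U"
    and c: "0 \<le> c" "c \<le> 1" and g: "continuous_on U g"
  shows "(\<integral>u. g u \<partial>mix_measure c \<mu> \<nu>) = (1 - c) * (\<integral>u. g u \<partial>\<mu>) + c * (\<integral>u. g u \<partial>\<nu>)"
proof -
  have s: "sets \<nu> = sets \<mu>" using borel_probsD(2) \<mu> \<nu> by metis
  have mix: "mix_measure c \<mu> \<nu> \<in> borel_probs U" by (rule mix_measure_in_borel_probs[OF \<mu> \<nu> c])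
  have fin: "(\<integral>\<^sup>+u. ennreal (h u) \<partial>\<kappa>) < \<infinity>" if "\<kappa> \<in> borel_probs U" "continuous_on U h" for \<kappa> and h :: "'u \<Rightarrow> real"
    using integrableD(2)[OF borel_probs_integrable[OF U that]] by (simp add: top.not_eq_extremum)
  have e: "enn2real (\<integral>\<^sup>+u. ennreal (h u) \<partial>mix_measure c \<mu> \<nu>)
     = (1 - c) * enn2real (\<integral>\<^sup>+u. ennreal (h u) \<partial>\<mu>) + c * enn2real (\<integral>\<^sup>+u. ennreal (h u) \<partial>\<nu>)"
    if h: "continuous_on U h" for h :: "'u \<Rightarrow> real"
  proof -
    have hm: "h \<in> borel_measurable \<mu>" by (rule borel_probs_measurable[OF \<mu> h])
    have "(\<integral>\<^sup>+u. ennreal (h u) \<partial>mix_measure c \<mu> \<nu>)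
        = ennreal (1 - c) * (\<integral>\<^sup>+u. ennreal (h u) \<partial>\<mu>) + ennreal c * (\<integral>\<^sup>+u. ennreal (h u) \<partial>\<nu>)"
      by (rule nn_integral_mix_measure[OF s]) (use hm in measurable)
    then show ?thesis
      using fin[OF \<mu> h] fin[OF \<nu> h] c
      by (simp add: enn2real_plus enn2real_mult ennreal_mult_less_top)
  qed
  have m: "continuous_on U (\<lambda>u. - g u)" using g by (intro continuous_intros)
  show ?thesis
    using borel_probs_integrable[OF U mix g] borel_probs_integrable[OF U \<mu> g]
      borel_probs_integrable[OF U \<nu> g]
    by (simp add: real_lebesgue_integral_def e[OF g] e[OF m] algebra_simps)
qed

lemma integral_mix_measure:
  fixes g :: "'u::euclidean_space \<Rightarrow> 'c::euclidean_space"
  assumes U: "compact U" and \<mu>: "\<mu> \<in> borel_probs U" and \<nu>: "\<nu> \<in> borel_probs U"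
    and c: "0 \<le> c" "c \<le> 1" and g: "continuous_on U g"
  shows "(\<integral>u. g u \<partial>mix_measure c \<mu> \<nu>) = (1 - c) *\<^sub>R (\<integral>u. g u \<partial>\<mu>) + c *\<^sub>R (\<integral>u. g u \<partial>\<nu>)"
proof (rule euclidean_eqI)
  fix b :: 'c assume "b \<in> Basis"
  have gb: "continuous_on U (\<lambda>u. g u \<bullet> b)" using g by (intro continuous_intros)
  have i: "(\<integral>u. g u \<partial>\<kappa>) \<bullet> b = (\<integral>u. g u \<bullet> b \<partial>\<kappa>)" if "\<kappa> \<in> borel_probs U" for \<kappa>
    using borel_probs_integrable[OF U that g] by simp
  show "(\<integral>u. g u \<partial>mix_measure c \<mu> \<nu>) \<bullet> b = ((1 - c) *\<^sub>R (\<integral>u. g u \<partial>\<mu>) + c *\<^sub>R (\<integral>u. g u \<partial>\<nu>)) \<bullet> b"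
    unfolding inner_add_left inner_scaleR_left i[OF \<mu>] i[OF \<nu>] i[OF mix_measure_in_borel_probs[OF \<mu> \<nu> c]]
    by (rule integral_mix_measure_real[OF U \<mu> \<nu> c gb])
qed

lemma mix_control_in_relaxed_controls:
  fixes U :: "'u::euclidean_space set"
  assumes U: "compact U" and \<mu>: "\<mu> \<in> relaxed_controls U T" and \<nu>: "\<nu> \<in> relaxed_controls U T"
    and c: "0 \<le> c" "c \<le> 1"
  shows "mix_control c \<mu> \<nu> \<in> relaxed_controls U T"
  unfolding relaxed_controls_def mix_control_def
proof (intro CollectI conjI ballI allI impI)
  fix t assume "t \<in> {0..T}"
  then show "mix_measure c (\<mu> t) (\<nu> t) \<in> borel_probs U"
    using \<mu> \<nu> c by (intro mix_measure_in_borel_probs) (auto simp: relaxed_controls_def)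
next
  fix \<phi> :: "'u \<Rightarrow> real" assume \<phi>: "continuous_on U \<phi>"
  have "(\<lambda>t. (1 - c) * (\<integral>u. \<phi> u \<partial>\<mu> t) + c * (\<integral>u. \<phi> u \<partial>\<nu> t)) \<in> borel_measurable (lebesgue_on {0..T})"
    using \<mu> \<nu> \<phi> unfolding relaxed_controls_def by (intro borel_measurable_add borel_measurable_times) auto
  then show "(\<lambda>t. \<integral>u. \<phi> u \<partial>mix_measure c (\<mu> t) (\<nu> t)) \<in> borel_measurable (lebesgue_on {0..T})"
  proof (rule measurable_cong[THEN iffD1, rotated])
    fix t assume "t \<in> space (lebesgue_on {0..T})"
    then show "(1 - c) * (\<integral>u. \<phi> u \<partial>\<mu> t) + c * (\<integral>u. \<phi> u \<partial>\<nu> t) = (\<integral>u. \<phi> u \<partial>mix_measure c (\<mu> t) (\<nu> t))"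
      using \<mu> \<nu> c \<phi> U by (subst integral_mix_measure_real[OF U]) (auto simp: relaxed_controls_def)
  qed
qed

section \<open>Measurable selection of minimizers\<close>

lemma compact_attains_min_inner:
  fixes S :: "'u::euclidean_space set"
  assumes "compact S" "S \<noteq> {}"
  shows "\<exists>u\<in>S. \<forall>v\<in>S. u \<bullet> b \<le> v \<bullet> b"
  by (rule continuous_attains_inf[OF assms]) (intro continuous_intros)

text \<open>
  Measurability of a compact-valued map is meant as measurability of the set of \<open>t\<close> where the value
  meets a given closed set. Passing to the minimizers of a linear functional preserves it: they meet
  \<open>F\<close> iff for every rational \<open>r\<close> such that the value meets the half-space below \<open>r\<close>, it also meets
  the part of \<open>F\<close> below \<open>r\<close>. Compactness allows \<open>r\<close> to tend to the minimum.
\<close>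

lemma measurable_argmin_along:
  fixes A :: "'t \<Rightarrow> 'u::euclidean_space set" and b :: 'u
  assumes A: "\<And>t. t \<in> space M \<Longrightarrow> compact (A t) \<and> A t \<noteq> {}"
    and meas: "\<And>F. closed F \<Longrightarrow> {t \<in> space M. A t \<inter> F \<noteq> {}} \<in> sets M"
  defines "A' \<equiv> \<lambda>t. {u \<in> A t. \<forall>v\<in>A t. u \<bullet> b \<le> v \<bullet> b}"
  shows "\<And>t. t \<in> space M \<Longrightarrow> compact (A' t) \<and> A' t \<noteq> {}"
    and "\<And>F. closed F \<Longrightarrow> {t \<in> space M. A' t \<inter> F \<noteq> {}} \<in> sets M"
proof -
  have half: "closed {u. u \<bullet> b \<le> r}" for r
    by (rule closed_Collect_le) (intro continuous_intros)+
  have eq: "A' t = A t \<inter> (\<Inter>v\<in>A t. {u. u \<bullet> b \<le> v \<bullet> b})" for t by (auto simp: A'_def)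
  show "compact (A' t) \<and> A' t \<noteq> {}" if tM: "t \<in> space M" for t
  proof (intro conjI)
    show "compact (A' t)" unfolding eq
      using A[OF tM] by (intro compact_Int_closed closed_INT half ballI) auto
    obtain u where "u \<in> A t" "\<And>v. v \<in> A t \<Longrightarrow> u \<bullet> b \<le> v \<bullet> b"
      using compact_attains_min_inner[of "A t" b] A[OF tM] by blast
    then show "A' t \<noteq> {}" by (auto simp: A'_def)
  qed
  fix F :: "'u set" assume F: "closed F"
  define H where "H r = {u. u \<bullet> b \<le> real_of_rat r}" for r
  have iff: "A' t \<inter> F \<noteq> {} \<longleftrightarrow> (\<forall>r. A t \<inter> H r \<noteq> {} \<longrightarrow> A t \<inter> (F \<inter> H r) \<noteq> {})"
    if t: "t \<in> space M" for t
  proof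
    assume "A' t \<inter> F \<noteq> {}"
    then obtain u where u: "u \<in> A t" "u \<in> F" "\<And>v. v \<in> A t \<Longrightarrow> u \<bullet> b \<le> v \<bullet> b"
      by (auto simp: A'_def)
    have "u \<in> H r" if "v \<in> A t" "v \<in> H r" for r v
      using u(3)[OF that(1)] that(2) by (auto simp: H_def)
    then show "\<forall>r. A t \<inter> H r \<noteq> {} \<longrightarrow> A t \<inter> (F \<inter> H r) \<noteq> {}"
      using u(1,2) by blast
  next
    assume *: "\<forall>r. A t \<inter> H r \<noteq> {} \<longrightarrow> A t \<inter> (F \<inter> H r) \<noteq> {}"
    obtain w where w: "w \<in> A t" "\<And>v. v \<in> A t \<Longrightarrow> w \<bullet> b \<le> v \<bullet> b"
      using compact_attains_min_inner[of "A t" b] A[OF t] by blast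
    obtain r0 where "w \<bullet> b < real_of_rat r0"
      using of_rat_dense[of "w \<bullet> b" "w \<bullet> b + 1"] by auto
    then have "A t \<inter> H r0 \<noteq> {}" using w(1) by (auto simp: H_def)
    then have ne: "A t \<inter> F \<noteq> {}" using * by blast
    have "compact (A t \<inter> F)" using A[OF t] F by (intro compact_Int_closed) auto
    then obtain u where u: "u \<in> A t \<inter> F" "\<And>v. v \<in> A t \<inter> F \<Longrightarrow> u \<bullet> b \<le> v \<bullet> b"
      using compact_attains_min_inner[of "A t \<inter> F" b] ne by blast
    have "u \<bullet> b \<le> w \<bullet> b"
    proof (rule ccontr)
      assume "\<not> u \<bullet> b \<le> w \<bullet> b"
      then obtain r where r: "w \<bullet> b < real_of_rat r" "real_of_rat r < u \<bullet> b"
        using of_rat_dense[of "w \<bullet> b" "u \<bullet> b"] by auto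
      then have "A t \<inter> H r \<noteq> {}" using w(1) by (auto simp: H_def)
      then obtain v where "v \<in> A t" "v \<in> F" "v \<in> H r" using * by blast
      then show False using u(2)[of v] r(2) by (auto simp: H_def)
    qed
    then have "u \<in> A' t" using u(1) w(2) by (fastforce simp: A'_def)
    then show "A' t \<inter> F \<noteq> {}" using u(1) by blast
  qed
  have "{t \<in> space M. A' t \<inter> F \<noteq> {}}
      = {t \<in> space M. \<forall>r. A t \<inter> H r \<noteq> {} \<longrightarrow> A t \<inter> (F \<inter> H r) \<noteq> {}}"
    by (rule Collect_cong, rule conj_cong[OF refl iff])
  also have "\<dots> \<in> sets M"
    by (intro sets.sets_Collect_countable_All sets.sets_Collect_imp meas closed_Int F)
      (simp_all add: H_def half)
  finally show "{t \<in> space M. A' t \<inter> F \<noteq> {}} \<in> sets M" .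
qed

text \<open>
  Minimizing the coordinates one after the other selects the lexicographically least point: after
  all coordinates every set is a singleton, and measurability of a singleton-valued map is
  measurability of its element.
\<close>

lemma measurable_compact_selection:
  fixes A :: "'t \<Rightarrow> 'u::euclidean_space set"
  assumes A: "\<And>t. t \<in> space M \<Longrightarrow> compact (A t) \<and> A t \<noteq> {}"
    and meas: "\<And>F. closed F \<Longrightarrow> {t \<in> space M. A t \<inter> F \<noteq> {}} \<in> sets M"
  obtains s where "s \<in> borel_measurable M" "\<And>t. t \<in> space M \<Longrightarrow> s t \<in> A t"
proof -
  \<comment> \<open>\<open>A'\<close> selects from \<open>A\<close> measurably and its values have constant coordinates along \<open>B\<close>.\<close>
  define good where "good B A' \<longleftrightarrow>
      (\<forall>t\<in>space M. compact (A' t) \<and> A' t \<noteq> {}) \<and> (\<forall>t\<in>space M. A' t \<subseteq> A t) \<and>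
      (\<forall>t\<in>space M. \<forall>u\<in>A' t. \<forall>v\<in>A' t. \<forall>b\<in>B. u \<bullet> b = v \<bullet> b) \<and>
      (\<forall>F. closed F \<longrightarrow> {t \<in> space M. A' t \<inter> F \<noteq> {}} \<in> sets M)"
    for B and A' :: "'t \<Rightarrow> 'u set"
  have "\<exists>A'. good B A'" if "finite B" for B
    using that
  proof induction
    case empty
    show ?case using A meas by (intro exI[of _ A]) (auto simp: good_def)
  next
    case (insert b B)
    then obtain A' where "good B A'" by blast
    then have A': "\<And>t. t \<in> space M \<Longrightarrow> compact (A' t) \<and> A' t \<noteq> {}"
      "\<And>t. t \<in> space M \<Longrightarrow> A' t \<subseteq> A t"
      "\<And>t u v b. t \<in> space M \<Longrightarrow> u \<in> A' t \<Longrightarrow> v \<in> A' t \<Longrightarrow> b \<in> B \<Longrightarrow> u \<bullet> b = v \<bullet> b"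
      "\<And>F. closed F \<Longrightarrow> {t \<in> space M. A' t \<inter> F \<noteq> {}} \<in> sets M"
      unfolding good_def by blast+
    define A'' where "A'' t = {u \<in> A' t. \<forall>v\<in>A' t. u \<bullet> b \<le> v \<bullet> b}" for t
    have "u \<bullet> c = v \<bullet> c" if "t \<in> space M" "u \<in> A'' t" "v \<in> A'' t" "c \<in> insert b B" for t u v c
      using that A'(3)[of t u v c] by (auto simp: A''_def intro: antisym)
    moreover have "A'' t \<subseteq> A t" if "t \<in> space M" for t
      using A'(2)[OF that] by (auto simp: A''_def)
    moreover have "compact (A'' t) \<and> A'' t \<noteq> {}" if "t \<in> space M" for t
      unfolding A''_def by (rule measurable_argmin_along(1)[of M A', OF A'(1,4) that])
    moreover have "{t \<in> space M. A'' t \<inter> F \<noteq> {}} \<in> sets M" if "closed F" for F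
      unfolding A''_def by (rule measurable_argmin_along(2)[of M A', OF A'(1,4) that])
    ultimately have "good (insert b B) A''" unfolding good_def by blast
    then show ?case by blast
  qed
  from this[OF finite_Basis] obtain A' where "good Basis A'" by blast
  then have A': "\<And>t. t \<in> space M \<Longrightarrow> A' t \<noteq> {}"
      "\<And>t. t \<in> space M \<Longrightarrow> A' t \<subseteq> A t"
      "\<And>t u v b. t \<in> space M \<Longrightarrow> u \<in> A' t \<Longrightarrow> v \<in> A' t \<Longrightarrow> b \<in> Basis \<Longrightarrow> u \<bullet> b = v \<bullet> b"
      "\<And>F. closed F \<Longrightarrow> {t \<in> space M. A' t \<inter> F \<noteq> {}} \<in> sets M"
    unfolding good_def by blast+
  define s where "s t = (SOME u. u \<in> A' t)" for t
  have s: "s t \<in> A' t" if "t \<in> space M" for t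
    using A'(1)[OF that] by (simp add: s_def some_in_eq)
  have single: "A' t = {s t}" if "t \<in> space M" for t
    using s[OF that] A'(3)[OF that] by (auto intro: euclidean_eqI)
  have "s \<in> borel_measurable M"
    unfolding borel_eq_closed
  proof (rule measurable_measure_of)
    fix F :: "'u set" assume "F \<in> Collect closed"
    then have "{t \<in> space M. A' t \<inter> F \<noteq> {}} \<in> sets M" using A'(4) by simp
    also have "{t \<in> space M. A' t \<inter> F \<noteq> {}} = s -` F \<inter> space M" using single by auto
    finally show "s -` F \<inter> space M \<in> sets M" .
  qed auto
  then show ?thesis using that s A'(2) by blast
qed

text \<open>
  For continuous \<open>g\<close> the times at which some minimizer lies in a closed set form a closed set, as the
  projection of a compact set.
\<close>

lemma measurable_argmin_selection:
  fixes g :: "real \<Rightarrow> 'u::euclidean_space \<Rightarrow> real"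
  assumes U: "compact U" "U \<noteq> {}" and g: "continuous_on ({a..b} \<times> U) (\<lambda>(t, u). g t u)"
  obtains s where "s \<in> borel_measurable (lebesgue_on {a..b})"
    "\<And>t. t \<in> {a..b} \<Longrightarrow> s t \<in> U" "\<And>t u. t \<in> {a..b} \<Longrightarrow> u \<in> U \<Longrightarrow> g t (s t) \<le> g t u"
proof -
  define A where "A t = {u \<in> U. \<forall>v\<in>U. g t u \<le> g t v}" for t
  have gt: "continuous_on U (g t)" if "t \<in> {a..b}" for t
    by (rule continuous_on_snd_section[OF g that])
  have closed_le: "closed {w \<in> {a..b} \<times> C. g (fst w) (snd w) \<le> g (fst w) v}"
    if "v \<in> U" "compact C" "C \<subseteq> U" for v C
  proof (rule continuous_on_closed_Collect_le)
    show "closed ({a..b} \<times> C)" using that by (intro closed_Times compact_imp_closed) auto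
    have "{a..b} \<times> C \<subseteq> {a..b} \<times> U" using that by auto
    from continuous_on_subset[OF g this]
    show "continuous_on ({a..b} \<times> C) (\<lambda>w. g (fst w) (snd w))" by (simp add: split_def)
    show "continuous_on ({a..b} \<times> C) (\<lambda>w. g (fst w) v)"
      using continuous_on_compose2[OF g, of "{a..b} \<times> C" "\<lambda>w. (fst w, v)"] that
      by (simp add: continuous_on_Pair continuous_on_fst image_subset_iff)
  qed
  have "compact (A t) \<and> A t \<noteq> {}" if t: "t \<in> {a..b}" for t
  proof
    obtain u where u: "u \<in> U" "\<And>v. v \<in> U \<Longrightarrow> g t u \<le> g t v"
      using continuous_attains_inf[OF U gt[OF t]] by auto
    then have "u \<in> A t" by (auto simp: A_def)
    then show "A t \<noteq> {}" by blast
    have "A t = {v \<in> U. g t v \<le> g t u}" using u by (force simp: A_def)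
    also have "\<dots> = U \<inter> {v \<in> U. g t v \<le> g t u}" by auto
    also have "compact \<dots>"
      by (intro compact_Int_closed continuous_on_closed_Collect_le gt t continuous_on_const
          compact_imp_closed U)
    finally show "compact (A t)" .
  qed
  moreover have "{t \<in> {a..b}. A t \<inter> F \<noteq> {}} \<in> sets (lebesgue_on {a..b})" if "closed F" for F
  proof -
    have C: "compact (U \<inter> F)" using U(1) that by (rule compact_Int_closed)
    let ?W = "\<Inter>v\<in>U. {w \<in> {a..b} \<times> (U \<inter> F). g (fst w) (snd w) \<le> g (fst w) v}"
    have "closed ?W" by (intro closed_INT ballI closed_le C) auto
    then have "compact (({a..b} \<times> (U \<inter> F)) \<inter> ?W)"
      by (rule compact_Int_closed[OF compact_Times[OF compact_Icc C]])
    then have "compact (fst ` (({a..b} \<times> (U \<inter> F)) \<inter> ?W))"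
      by (intro compact_continuous_image continuous_intros)
    moreover have "({a..b} \<times> (U \<inter> F)) \<inter> ?W = {(t, u). t \<in> {a..b} \<and> u \<in> A t \<inter> F}"
      by (auto simp: A_def)
    moreover have "fst ` {(t, u). t \<in> {a..b} \<and> u \<in> A t \<inter> F} = {t \<in> {a..b}. A t \<inter> F \<noteq> {}}"
      by (auto simp: image_def)
    ultimately have "{t \<in> {a..b}. A t \<inter> F \<noteq> {}} \<in> sets borel"
      by (auto intro: borel_closed compact_imp_closed)
    then have "{t \<in> {a..b}. A t \<inter> F \<noteq> {}} \<in> sets lebesgue" by simp
    moreover have "{t \<in> {a..b}. A t \<inter> F \<noteq> {}} \<subseteq> {a..b}" by blast
    ultimately show ?thesis by (simp add: sets_restrict_space_iff)
  qed
  ultimately obtain s where "s \<in> borel_measurable (lebesgue_on {a..b})" "\<And>t. t \<in> {a..b} \<Longrightarrow> s t \<in> A t"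
    using measurable_compact_selection[of "lebesgue_on {a..b}" A] by auto
  then show ?thesis using that unfolding A_def by blast
qed

section \<open>Step-size rule and descent sequences\<close>

text \<open>
  Every step \<open>c\<close> with \<open>C * c \<le> (1 - \<alpha>) * (- g)\<close> is accepted. So either the full step is taken, or the
  previous trial step \<open>\<beta> ^ (l - 1)\<close> was rejected and hence not small.
\<close>

lemma armijo_step_descent:
  fixes J :: "real \<Rightarrow> real"
  assumes \<alpha>: "0 < \<alpha>" "\<alpha> < 1" and \<beta>: "0 < \<beta>" "\<beta> < 1" and "C > 0" and "g < 0"
    and quad: "\<And>c. 0 \<le> c \<Longrightarrow> c \<le> 1 \<Longrightarrow> J c - J0 \<le> c * g + C * c\<^sup>2"
  defines "l \<equiv> LEAST l. J (\<beta> ^ l) - J0 \<le> \<alpha> * \<beta> ^ l * g"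
  shows "J (\<beta> ^ l) - J0 \<le> - (\<alpha> * (- g) * min 1 (\<beta> * (1 - \<alpha>) * (- g) / C))"
proof -
  define P where "P l \<longleftrightarrow> J (\<beta> ^ l) - J0 \<le> \<alpha> * \<beta> ^ l * g" for l
  have ok: "P l" if "C * \<beta> ^ l \<le> (1 - \<alpha>) * (- g)" for l
  proof -
    have b: "0 \<le> \<beta> ^ l" "\<beta> ^ l \<le> 1" using \<beta> by (auto simp: power_le_one)
    have "J (\<beta> ^ l) - J0 \<le> \<beta> ^ l * g + \<beta> ^ l * (C * \<beta> ^ l)"
      using quad[OF b] by (simp add: power2_eq_square ac_simps)
    also have "\<dots> \<le> \<beta> ^ l * g + \<beta> ^ l * ((1 - \<alpha>) * (- g))"
      by (intro add_left_mono mult_left_mono that b)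
    finally show ?thesis by (simp add: P_def algebra_simps)
  qed
  have "(\<lambda>l. C * \<beta> ^ l) \<longlonglongrightarrow> C * 0"
    using \<beta> by (intro tendsto_intros LIMSEQ_power_zero) auto
  moreover have "C * 0 < (1 - \<alpha>) * (- g)" using \<alpha> \<open>g < 0\<close> by (simp add: mult_less_0_iff)
  ultimately have "\<forall>\<^sub>F l in sequentially. C * \<beta> ^ l < (1 - \<alpha>) * (- g)"
    by (rule order_tendstoD(2))
  then obtain l1 where "C * \<beta> ^ l1 < (1 - \<alpha>) * (- g)" by (auto simp: eventually_sequentially)
  then have "P l1" by (intro ok) simp
  then have Pl: "P l" unfolding l_def P_def[symmetric] by (rule LeastI)
  have step: "min 1 (\<beta> * (1 - \<alpha>) * (- g) / C) \<le> \<beta> ^ l"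
  proof (cases l)
    case (Suc k)
    then have "\<not> P k" unfolding l_def P_def[symmetric] by (intro not_less_Least) simp
    then have "(1 - \<alpha>) * (- g) < C * \<beta> ^ k" using ok[of k] by linarith
    then have "\<beta> * ((1 - \<alpha>) * (- g)) \<le> \<beta> * (C * \<beta> ^ k)" using \<beta> by (intro mult_left_mono) auto
    then have "\<beta> * (1 - \<alpha>) * (- g) \<le> \<beta> ^ l * C" by (simp add: Suc ac_simps)
    then have "\<beta> * (1 - \<alpha>) * (- g) / C \<le> \<beta> ^ l" using \<open>C > 0\<close> by (subst pos_divide_le_eq) auto
    then show ?thesis by simp
  qed simp
  have "\<alpha> * (- g) * min 1 (\<beta> * (1 - \<alpha>) * (- g) / C) \<le> \<alpha> * (- g) * \<beta> ^ l"
    using step \<alpha> \<open>g < 0\<close> by (intro mult_left_mono) (auto simp: mult_nonneg_nonpos)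
  then show ?thesis using Pl by (simp add: P_def algebra_simps)
qed

text \<open>
  A decreasing sequence bounded below has vanishing decrements, while indices with \<open>s k \<ge> e\<close> have
  decrements bounded away from \<open>0\<close>.
\<close>

lemma sufficient_descent_tendsto_zero:
  fixes J s :: "nat \<Rightarrow> real"
  assumes s: "\<And>k. 0 \<le> s k" and bdd: "\<And>k. B \<le> J k" and "a > 0" "b > 0"
    and desc: "\<And>k. J (Suc k) - J k \<le> - (a * s k * min 1 (b * s k))"
  shows "s \<longlonglongrightarrow> 0"
proof (rule LIMSEQ_I)
  have dec: "J (Suc k) \<le> J k" for k
  proof -
    have "0 \<le> a * s k * min 1 (b * s k)" using s[of k] \<open>a > 0\<close> \<open>b > 0\<close> by simp
    then show ?thesis using desc[of k] by linarith
  qed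
  then have "decseq J" by (rule decseq_SucI)
  then obtain J' where J': "J \<longlonglongrightarrow> J'" using decseq_convergent[of J B] bdd by metis
  have lim: "(\<lambda>k. J k - J (Suc k)) \<longlonglongrightarrow> J' - J'"
    by (intro tendsto_diff J' LIMSEQ_Suc)
  fix e :: real assume "e > 0"
  define c where "c = a * e * min 1 (b * e)"
  have "c > 0" using \<open>a > 0\<close> \<open>b > 0\<close> \<open>e > 0\<close> by (simp add: c_def)
  have "\<forall>\<^sub>F k in sequentially. J k - J (Suc k) < c"
    by (rule order_tendstoD(2)[OF lim]) (use \<open>c > 0\<close> in simp)
  then obtain N where N: "\<And>k. k \<ge> N \<Longrightarrow> J k - J (Suc k) < c"
    by (auto simp: eventually_sequentially)
  show "\<exists>N. \<forall>k\<ge>N. norm (s k - 0) < e"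
  proof (intro exI[of _ N] allI impI)
    fix k assume "k \<ge> N"
    show "norm (s k - 0) < e"
    proof (rule ccontr)
      assume "\<not> norm (s k - 0) < e"
      then have "e \<le> s k" using s[of k] by simp
      then have "c \<le> a * s k * min 1 (b * s k)"
        unfolding c_def using \<open>a > 0\<close> \<open>b > 0\<close> \<open>e > 0\<close>
        by (intro mult_mono min.mono mult_left_mono) auto
      then show False using desc[of k] N[OF \<open>k \<ge> N\<close>] by linarith
    qed
  qed
qed

section \<open>The control problem\<close>

locale relaxed_control_problem =
  fixes U :: "(real^'k) set" and tf :: real and x0 :: "real^'n"
    and f :: "real^'n \<Rightarrow> real^'k \<Rightarrow> real^'n" and L :: "real^'n \<Rightarrow> real^'k \<Rightarrow> real"
  assumes compact_U: "compact U" and U_ne: "U \<noteq> {}" and tf_pos: "tf > 0"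
    and f_assm: "standing_assumption_f U f" and L_assm: "standing_assumption_L U L"
begin

lemma
  shows f_C1: "C1_in_x U f" and L_C1: "C1_in_x U L"
    and f_lip: "locally_lipschitz_on (UNIV \<times> U) (\<lambda>(x, u). f x u)"
    and df_lip: "locally_lipschitz_on (UNIV \<times> U) (\<lambda>(x, u). dx f x u)"
    and L_lip: "locally_lipschitz_on (UNIV \<times> U) (\<lambda>(x, u). L x u)"
    and dL_lip: "locally_lipschitz_on (UNIV \<times> U) (\<lambda>(x, u). dx L x u)"
  using f_assm L_assm by (auto simp: standing_assumption_f_def standing_assumption_L_def C2_in_x_def)

lemmas cont_f = locally_lipschitz_on_imp_continuous_on[OF f_lip]
  and cont_df = locally_lipschitz_on_imp_continuous_on[OF df_lip]
  and cont_L = locally_lipschitz_on_imp_continuous_on[OF L_lip]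
  and cont_dL = locally_lipschitz_on_imp_continuous_on[OF dL_lip]
lemmas cont_adjoint = continuous_on_adjoint_field[OF cont_df cont_dL]

abbreviation "controls \<equiv> relaxed_controls U tf"

lemma controlsD: "\<mu> \<in> controls \<Longrightarrow> t \<in> {0..tf} \<Longrightarrow> \<mu> t \<in> borel_probs U"
  by (simp add: relaxed_controls_def)

definition growth_const where "growth_const = (SOME c. c > 0 \<and> (\<forall>x. \<forall>u\<in>U. norm (f x u) \<le> c * (norm x + 1)))"

lemma growth_const: "growth_const > 0" "u \<in> U \<Longrightarrow> norm (f x u) \<le> growth_const * (norm x + 1)"
proof -
  have "\<exists>c. c > 0 \<and> (\<forall>x. \<forall>u\<in>U. norm (f x u) \<le> c * (norm x + 1))"
    using f_assm by (auto simp: standing_assumption_f_def)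
  from someI_ex[OF this] show "growth_const > 0" "u \<in> U \<Longrightarrow> norm (f x u) \<le> growth_const * (norm x + 1)"
    by (auto simp: growth_const_def)
qed

text \<open>Gronwall's bound on the norm of a state, given linear growth of \<open>f\<close>.\<close>

definition state_radius where "state_radius = (norm x0 + 1) * exp (growth_const * tf)"

definition regular_bound where
  "regular_bound c \<longleftrightarrow> (\<forall>u\<in>U.
     (\<forall>x\<in>cball 0 state_radius. norm (f x u) \<le> c \<and> norm (dx f x u) \<le> c \<and> norm (L x u) \<le> c \<and> norm (dx L x u) \<le> c) \<and>
     c-lipschitz_on (cball 0 state_radius) (\<lambda>x. f x u) \<and> c-lipschitz_on (cball 0 state_radius) (\<lambda>x. dx f x u) \<and>
     c-lipschitz_on (cball 0 state_radius) (\<lambda>x. L x u) \<and> c-lipschitz_on (cball 0 state_radius) (\<lambda>x. dx L x u))"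

lemma continuous_bounded:
  fixes \<Phi> :: "'z::euclidean_space \<Rightarrow> real^'k \<Rightarrow> 'c::real_normed_vector"
  assumes "continuous_on (UNIV \<times> U) (\<lambda>(z, u). \<Phi> z u)"
  obtains B where "\<And>z u. norm z \<le> r \<Longrightarrow> u \<in> U \<Longrightarrow> norm (\<Phi> z u) \<le> B"
proof -
  have "continuous_on (cball 0 r \<times> U) (\<lambda>(z, u). \<Phi> z u)"
    by (rule continuous_on_subset[OF assms]) auto
  then have "bounded ((\<lambda>(z, u). \<Phi> z u) ` (cball 0 r \<times> U))"
    by (intro compact_imp_bounded compact_continuous_image compact_Times compact_cball compact_U)
  then obtain B where B: "\<And>y. y \<in> (\<lambda>(z, u). \<Phi> z u) ` (cball 0 r \<times> U) \<Longrightarrow> norm y \<le> B"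
    unfolding bounded_iff by blast
  show ?thesis
  proof (rule that)
    fix z u assume "norm (z::'z) \<le> r" "u \<in> U"
    then have "(\<lambda>(z, u). \<Phi> z u) (z, u) \<in> (\<lambda>(z, u). \<Phi> z u) ` (cball 0 r \<times> U)"
      by (intro imageI) auto
    from B[OF this] show "norm (\<Phi> z u) \<le> B" by simp
  qed
qed

lemma regular_bound_exists: "\<exists>c>0. regular_bound c"
proof -
  obtain B1 where B1: "\<And>x u. norm x \<le> state_radius \<Longrightarrow> u \<in> U \<Longrightarrow> norm (f x u) \<le> B1"
    using continuous_bounded[OF cont_f, of state_radius] by blast
  obtain B2 where B2: "\<And>x u. norm x \<le> state_radius \<Longrightarrow> u \<in> U \<Longrightarrow> norm (dx f x u) \<le> B2"
    using continuous_bounded[OF cont_df, of state_radius] by blast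
  obtain B3 where B3: "\<And>x u. norm x \<le> state_radius \<Longrightarrow> u \<in> U \<Longrightarrow> norm (L x u) \<le> B3"
    using continuous_bounded[OF cont_L, of state_radius] by blast
  obtain B4 where B4: "\<And>x u. norm x \<le> state_radius \<Longrightarrow> u \<in> U \<Longrightarrow> norm (dx L x u) \<le> B4"
    using continuous_bounded[OF cont_dL, of state_radius] by blast
  obtain C1 where C1: "\<And>u. u \<in> U \<Longrightarrow> C1-lipschitz_on (cball 0 state_radius) (\<lambda>x. f x u)"
    using locally_lipschitz_on_uniform_fst[OF f_lip compact_U compact_cball[of 0 state_radius]] by blast
  obtain C2 where C2: "\<And>u. u \<in> U \<Longrightarrow> C2-lipschitz_on (cball 0 state_radius) (\<lambda>x. dx f x u)"
    using locally_lipschitz_on_uniform_fst[OF df_lip compact_U compact_cball[of 0 state_radius]] by blast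
  obtain C3 where C3: "\<And>u. u \<in> U \<Longrightarrow> C3-lipschitz_on (cball 0 state_radius) (\<lambda>x. L x u)"
    using locally_lipschitz_on_uniform_fst[OF L_lip compact_U compact_cball[of 0 state_radius]] by blast
  obtain C4 where C4: "\<And>u. u \<in> U \<Longrightarrow> C4-lipschitz_on (cball 0 state_radius) (\<lambda>x. dx L x u)"
    using locally_lipschitz_on_uniform_fst[OF dL_lip compact_U compact_cball[of 0 state_radius]] by blast
  define c where "c = Max {1, B1, B2, B3, B4, C1, C2, C3, C4}"
  have c: "1 \<le> c" "B1 \<le> c" "B2 \<le> c" "B3 \<le> c" "B4 \<le> c" "C1 \<le> c" "C2 \<le> c" "C3 \<le> c" "C4 \<le> c"
    unfolding c_def by (rule Max_ge; simp)+
  have "regular_bound c"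
    unfolding regular_bound_def
  proof (intro ballI conjI)
    fix u assume u: "u \<in> U"
    show "c-lipschitz_on (cball 0 state_radius) (\<lambda>x. f x u)" "c-lipschitz_on (cball 0 state_radius) (\<lambda>x. dx f x u)"
      "c-lipschitz_on (cball 0 state_radius) (\<lambda>x. L x u)" "c-lipschitz_on (cball 0 state_radius) (\<lambda>x. dx L x u)"
      using C1[OF u] C2[OF u] C3[OF u] C4[OF u] c by (auto intro: lipschitz_on_mono)
    fix x :: "real^'n" assume "x \<in> cball 0 state_radius"
    then have x: "norm x \<le> state_radius" by simp
    show "norm (f x u) \<le> c" "norm (dx f x u) \<le> c" "norm (L x u) \<le> c" "norm (dx L x u) \<le> c"
      using B1[OF x u] B2[OF x u] B3[OF x u] B4[OF x u] c by linarith+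
  qed
  then show ?thesis using c(1) by (intro exI[of _ c]) auto
qed

definition reg_const where "reg_const = (SOME c. c > 0 \<and> regular_bound c)"

lemma reg_const_pos: "reg_const > 0" and regular_reg_const: "regular_bound reg_const"
  using someI_ex[OF regular_bound_exists] by (simp_all add: reg_const_def)

lemma reg_const_bounds:
  assumes "u \<in> U" "norm x \<le> state_radius"
  shows "norm (f x u) \<le> reg_const" "norm (dx f x u) \<le> reg_const" "\<bar>L x u\<bar> \<le> reg_const" "norm (dx L x u) \<le> reg_const"
  using regular_reg_const assms by (auto simp: regular_bound_def)

lemma reg_const_lipschitz:
  assumes "u \<in> U"
  shows "reg_const-lipschitz_on (cball 0 state_radius) (\<lambda>x. f x u)" "reg_const-lipschitz_on (cball 0 state_radius) (\<lambda>x. dx f x u)"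
    "reg_const-lipschitz_on (cball 0 state_radius) (\<lambda>x. L x u)" "reg_const-lipschitz_on (cball 0 state_radius) (\<lambda>x. dx L x u)"
  using regular_reg_const assms by (auto simp: regular_bound_def)

lemma integrable_along:
  fixes \<Phi> :: "'z::euclidean_space \<Rightarrow> real^'k \<Rightarrow> 'c::euclidean_space"
  assumes \<mu>: "\<mu> \<in> controls" and \<Phi>: "continuous_on (UNIV \<times> U) (\<lambda>(z, u). \<Phi> z u)"
    and z: "continuous_on {0..tf} z"
  shows "integrable (lebesgue_on {0..tf}) (\<lambda>t. \<integral>u. \<Phi> (z t) u \<partial>\<mu> t)"
    and "\<exists>B. \<forall>t\<in>{0..tf}. norm (\<integral>u. \<Phi> (z t) u \<partial>\<mu> t) \<le> B"
proof -
  have "bounded (z ` {0..tf})"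
    using z by (intro compact_imp_bounded compact_continuous_image) auto
  then obtain r where r: "\<And>t. t \<in> {0..tf} \<Longrightarrow> norm (z t) \<le> r" unfolding bounded_iff by blast
  obtain B where B: "\<And>z u. norm z \<le> r \<Longrightarrow> u \<in> U \<Longrightarrow> norm (\<Phi> z u) \<le> B"
    using continuous_bounded[OF \<Phi>, of r] by blast
  have le: "norm (\<integral>u. \<Phi> (z t) u \<partial>\<mu> t) \<le> B" if t: "t \<in> {0..tf}" for t
    by (rule borel_probs_norm_integral_le[OF compact_U controlsD[OF \<mu> t] continuous_on_snd_section[OF \<Phi>] B])
      (use r[OF t] in auto)
  then show "\<exists>B. \<forall>t\<in>{0..tf}. norm (\<integral>u. \<Phi> (z t) u \<partial>\<mu> t) \<le> B" by blast
  have "(\<lambda>t. \<integral>u. \<Phi> (z t) u \<partial>\<mu> t) \<in> borel_measurable (lebesgue_on {0..tf})"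
    by (rule relaxed_control_integral_measurable[OF compact_U \<mu> \<Phi>])
      (rule continuous_imp_measurable_on_sets_lebesgue[OF z], simp)
  then show "integrable (lebesgue_on {0..tf}) (\<lambda>t. \<integral>u. \<Phi> (z t) u \<partial>\<mu> t)"
    by (rule borel_measurable_bounded_integrable_lebesgue_on[OF _ le])
qed

lemma integrable_on_along:
  fixes \<Phi> :: "'z::euclidean_space \<Rightarrow> real^'k \<Rightarrow> 'c::euclidean_space"
  assumes \<mu>: "\<mu> \<in> controls" and \<Phi>: "continuous_on (UNIV \<times> U) (\<lambda>(z, u). \<Phi> z u)"
    and z: "continuous_on {0..tf} z" and ab: "{a..b} \<subseteq> {0..tf}"
  shows "(\<lambda>t. \<integral>u. \<Phi> (z t) u \<partial>\<mu> t) integrable_on {a..b}"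
  using integrable_on_subinterval[OF integrable_on_lebesgue_on[OF integrable_along(1)[OF \<mu> \<Phi> z]] ab]
  by simp

subsection \<open>States\<close>

lemma gronwall_along:
  assumes g: "continuous_on {0..tf} g" and c: "c > 0"
    and le: "\<And>t. t \<in> {0..tf} \<Longrightarrow> norm (g t - x0) \<le> integral {0..t} (\<lambda>s. c * (norm (g s) + 1))"
    and t: "t \<in> {0..tf}"
  shows "norm (g t) + 1 \<le> (norm x0 + 1) * exp (c * tf)"
proof -
  have "norm (g t) + 1 \<le> (norm x0 + 1) * exp (c * t)"
  proof (rule gronwall[OF _ _ _ t])
    show "continuous_on {0..tf} (\<lambda>t. norm (g t) + 1)" by (intro continuous_intros g)
    show "0 \<le> c" using c by simp
    fix s assume s: "s \<in> {0..tf}"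
    have "norm (g s) \<le> norm x0 + norm (g s - x0)" by (metis norm_triangle_sub)
    with le[OF s] show "norm (g s) + 1 \<le> norm x0 + 1 + c * integral {0..s} (\<lambda>t. norm (g t) + 1)"
      by simp
  qed
  also have "\<dots> \<le> (norm x0 + 1) * exp (c * tf)"
    using c t by (intro mult_left_mono) auto
  finally show ?thesis .
qed

lemma
  assumes \<mu>: "\<mu> \<in> controls" and x: "is_state tf x0 f \<mu> x"
  shows state_continuous: "continuous_on {0..tf} x"
    and state_has_integral: "\<And>t. t \<in> {0..tf} \<Longrightarrow>
        ((\<lambda>s. \<integral>u. f (x s) u \<partial>\<mu> s) has_integral x t - x0) {0..t}"
    and state_bound: "\<And>t. t \<in> {0..tf} \<Longrightarrow> norm (x t) \<le> state_radius"
proof -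
  show cont: "continuous_on {0..tf} x"
    using x by (intro abs_continuous_on_imp_continuous_on) (simp add: is_state_def)
  show int: "((\<lambda>s. \<integral>u. f (x s) u \<partial>\<mu> s) has_integral x t - x0) {0..t}" if "t \<in> {0..tf}" for t
    using abs_continuous_on_has_integral_initial[of 0 tf x t] x that by (simp add: is_state_def)
  fix t assume t: "t \<in> {0..tf}"
  have "norm (x s - x0) \<le> integral {0..s} (\<lambda>r. growth_const * (norm (x r) + 1))" if s: "s \<in> {0..tf}" for s
  proof -
    have sub: "{0..s} \<subseteq> {0..tf}" using s by auto
    have "norm (integral {0..s} (\<lambda>r. \<integral>u. f (x r) u \<partial>\<mu> r)) \<le> integral {0..s} (\<lambda>r. growth_const * (norm (x r) + 1))"
    proof (rule integral_norm_bound_integral)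
      show "(\<lambda>r. \<integral>u. f (x r) u \<partial>\<mu> r) integrable_on {0..s}"
        by (rule integrable_on_along[OF \<mu> cont_f cont sub])
      show "(\<lambda>r. growth_const * (norm (x r) + 1)) integrable_on {0..s}"
        by (intro integrable_continuous_interval continuous_intros continuous_on_subset[OF cont sub])
      fix r assume "r \<in> {0..s}"
      then have r: "r \<in> {0..tf}" using sub by auto
      show "norm (\<integral>u. f (x r) u \<partial>\<mu> r) \<le> growth_const * (norm (x r) + 1)"
        by (rule borel_probs_norm_integral_le[OF compact_U controlsD[OF \<mu> r] continuous_on_snd_section[OF cont_f] growth_const(2)]) auto
    qed
    then show ?thesis using integral_unique[OF int[OF s]] by simp
  qed
  from gronwall_along[OF cont growth_const(1) this t] show "norm (x t) \<le> state_radius" by (simp add: state_radius_def)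
qed

text \<open>
  The field \<open>f\<close> is Lipschitz only on bounded sets. Composing it with the projection onto the ball of
  radius \<open>state_radius\<close> makes it globally Lipschitz without spoiling linear growth; the solution of the
  modified equation never leaves the ball, so it solves the original one.
\<close>

lemma state_exists:
  assumes \<mu>: "\<mu> \<in> controls"
  shows "\<exists>x. is_state tf x0 f \<mu> x"
proof -
  have R0: "state_radius \<ge> 0" by (simp add: state_radius_def)
  define proj where "proj = closest_point (cball (0::real^'n) state_radius)"
  have proj: "convex (cball (0::real^'n) state_radius)" "closed (cball (0::real^'n) state_radius)" "cball (0::real^'n) state_radius \<noteq> {}"
    using R0 by auto
  have proj_in: "norm (proj y) \<le> state_radius" for y
    using closest_point_in_set[OF proj(2,3), of y] by (simp add: proj_def)
  have proj_id: "proj y = y" if "norm y \<le> state_radius" for y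
    using that by (simp add: proj_def closest_point_self)
  have proj_lip: "norm (proj y - proj z) \<le> norm (y - z)" for y z
    using closest_point_lipschitz[OF proj, of y z] by (simp add: proj_def dist_norm)
  have proj_le: "norm (proj y) \<le> norm y" for y
    using proj_lip[of y 0] proj_id[of 0] R0 by simp
  have proj_cont: "continuous_on S proj" for S
    unfolding proj_def by (rule continuous_on_closest_point[OF proj])
  define F where "F t y = (\<integral>u. f (proj y) u \<partial>\<mu> t)" for t y
  have f_cont: "continuous_on U (f y)" for y by (rule continuous_on_snd_section[OF cont_f]) simp
  have int: "(\<lambda>s. F s (y s)) integrable_on {0..tf}" if y: "continuous_on {0..tf} y" for y
    unfolding F_def
    by (rule integrable_on_along[OF \<mu> cont_f continuous_on_compose2[OF proj_cont[of UNIV] y]]) auto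
  obtain x where x: "continuous_on {0..tf} x"
    "\<And>t. t \<in> {0..tf} \<Longrightarrow> x t = x0 + integral {0..t} (\<lambda>s. F s (x s))"
  proof (rule caratheodory_existence[OF reg_const_pos int])
    fix t y z assume t: "t \<in> {0..tf}"
    note \<mu>t = controlsD[OF \<mu> t]
    have "F t y - F t z = (\<integral>u. f (proj y) u - f (proj z) u \<partial>\<mu> t)"
      unfolding F_def
      by (rule Bochner_Integration.integral_diff[symmetric]; rule borel_probs_integrable[OF compact_U \<mu>t f_cont])
    also have "norm \<dots> \<le> reg_const * norm (y - z)"
    proof (rule borel_probs_norm_integral_le[OF compact_U \<mu>t])
      show "continuous_on U (\<lambda>u. f (proj y) u - f (proj z) u)" by (intro continuous_intros f_cont)
      fix u assume u: "u \<in> U"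
      have "norm (f (proj y) u - f (proj z) u) \<le> reg_const * norm (proj y - proj z)"
        using lipschitz_on_normD[OF reg_const_lipschitz(1)[OF u]] proj_in by simp
      also have "\<dots> \<le> reg_const * norm (y - z)" using proj_lip reg_const_pos by (intro mult_left_mono) auto
      finally show "norm (f (proj y) u - f (proj z) u) \<le> reg_const * norm (y - z)" .
    qed
    finally show "norm (F t y - F t z) \<le> reg_const * norm (y - z)" .
  qed blast+
  have "norm (x s - x0) \<le> integral {0..s} (\<lambda>r. growth_const * (norm (x r) + 1))" if s: "s \<in> {0..tf}" for s
  proof -
    have sub: "{0..s} \<subseteq> {0..tf}" using s by auto
    have "norm (integral {0..s} (\<lambda>r. F r (x r))) \<le> integral {0..s} (\<lambda>r. growth_const * (norm (x r) + 1))"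
    proof (rule integral_norm_bound_integral)
      show "(\<lambda>r. F r (x r)) integrable_on {0..s}"
        using integrable_on_subinterval[OF int[OF x(1)] sub] by simp
      show "(\<lambda>r. growth_const * (norm (x r) + 1)) integrable_on {0..s}"
        by (intro integrable_continuous_interval continuous_intros continuous_on_subset[OF x(1) sub])
      fix r assume "r \<in> {0..s}"
      then have r: "r \<in> {0..tf}" using sub by auto
      have "norm (F r (x r)) \<le> growth_const * (norm (proj (x r)) + 1)"
        unfolding F_def by (rule borel_probs_norm_integral_le[OF compact_U controlsD[OF \<mu> r] f_cont growth_const(2)])
      also have "\<dots> \<le> growth_const * (norm (x r) + 1)" using proj_le growth_const(1) by (intro mult_left_mono) auto
      finally show "norm (F r (x r)) \<le> growth_const * (norm (x r) + 1)" .
    qed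
    then show ?thesis using x(2)[OF s] by simp
  qed
  from gronwall_along[OF x(1) growth_const(1) this] have "norm (x t) \<le> state_radius" if "t \<in> {0..tf}" for t
    using that by (force simp: state_radius_def)
  then have F_eq: "F t (x t) = (\<integral>u. f (x t) u \<partial>\<mu> t)" if "t \<in> {0..tf}" for t
    using proj_id that by (simp add: F_def)
  have Fb: "norm (F t (x t)) \<le> reg_const" if t: "t \<in> {0..tf}" for t
    unfolding F_def
    by (rule borel_probs_norm_integral_le[OF compact_U controlsD[OF \<mu> t] f_cont reg_const_bounds(1)]) (use proj_in in auto)
  have ac: "abs_continuous_on {0..tf} x"
    "AE t in lebesgue_on {0..tf}. (x has_vector_derivative F t (x t)) (at t within {0..tf})"
    by (rule indefinite_integral_bounded_abs_continuous[OF int[OF x(1)] Fb x(2)]; assumption)+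
  have "AE t in lebesgue_on {0..tf}. (x has_vector_derivative (\<integral>u. f (x t) u \<partial>\<mu> t)) (at t within {0..tf})"
    using ac(2)
  proof (rule AE_mp, intro AE_I2 impI)
    fix t assume "t \<in> space (lebesgue_on {0..tf})"
      "(x has_vector_derivative F t (x t)) (at t within {0..tf})"
    then show "(x has_vector_derivative (\<integral>u. f (x t) u \<partial>\<mu> t)) (at t within {0..tf})"
      using F_eq by simp
  qed
  moreover have "x 0 = x0" using x(2)[of 0] tf_pos by simp
  ultimately show ?thesis using ac(1) unfolding is_state_def by blast
qed

lemma is_state_state_traj: "\<mu> \<in> controls \<Longrightarrow> is_state tf x0 f \<mu> (state_traj tf x0 f \<mu>)"
  unfolding state_traj_def by (rule someI_ex[OF state_exists])

subsection \<open>Costates\<close>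

text \<open>Gronwall's bound on the norm of a costate, run backwards from the value \<open>0\<close> at time \<open>tf\<close>.\<close>

definition costate_radius where "costate_radius = exp (reg_const * tf)"

lemma adjoint_integral_bounds:
  assumes \<nu>: "\<nu> \<in> borel_probs U" and x: "norm x \<le> state_radius"
  shows "norm (\<integral>u. adjoint_field f L x u p \<partial>\<nu>) \<le> reg_const * (norm p + 1)"
    and "norm ((\<integral>u. adjoint_field f L x u p \<partial>\<nu>) - (\<integral>u. adjoint_field f L x u q \<partial>\<nu>)) \<le> reg_const * norm (p - q)"
proof -
  have c: "continuous_on U (\<lambda>u. adjoint_field f L x u p)" for p
    using continuous_on_snd_section[OF cont_adjoint, of "(x, p)"] by simp
  note i = borel_probs_integrable[OF compact_U \<nu> c]
  note b = reg_const_bounds(2,4)[OF _ x]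
  show "norm (\<integral>u. adjoint_field f L x u p \<partial>\<nu>) \<le> reg_const * (norm p + 1)"
    by (rule borel_probs_norm_integral_le[OF compact_U \<nu> c]) (rule adjoint_field_bounds(1)[OF b])
  have "norm (\<integral>u. adjoint_field f L x u p - adjoint_field f L x u q \<partial>\<nu>) \<le> reg_const * norm (p - q)"
    by (rule borel_probs_norm_integral_le[OF compact_U \<nu>])
      (auto intro!: continuous_intros c adjoint_field_bounds(2) b)
  then show "norm ((\<integral>u. adjoint_field f L x u p \<partial>\<nu>) - (\<integral>u. adjoint_field f L x u q \<partial>\<nu>)) \<le> reg_const * norm (p - q)"
    using i by simp
qed

lemma adjoint_integrable_on:
  assumes "\<mu> \<in> controls" "continuous_on {0..tf} x" "continuous_on {0..tf} p" "{a..b} \<subseteq> {0..tf}"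
  shows "(\<lambda>t. \<integral>u. adjoint_field f L (x t) u (p t) \<partial>\<mu> t) integrable_on {a..b}"
  using integrable_on_along[OF assms(1) cont_adjoint continuous_on_Pair[OF assms(2,3)] assms(4)] by simp

lemma costate_exists:
  assumes \<mu>: "\<mu> \<in> controls" and x: "is_state tf x0 f \<mu> x"
  shows "\<exists>p. is_costate tf f L \<mu> x p"
proof -
  note x_cont = state_continuous[OF \<mu> x] and x_bound = state_bound[OF \<mu> x]
  define F where "F t p = (\<integral>u. adjoint_field f L (x t) u p \<partial>\<mu> t)" for t p
  have reversed: "continuous_on {0..tf} (\<lambda>t. q (tf - t))" if "continuous_on {0..tf} q" for q :: "real \<Rightarrow> real^'n"
    by (rule continuous_on_compose2[OF that]) (auto intro!: continuous_intros)
  have intF: "(\<lambda>t. F t (p t)) integrable_on {a..b}" if "continuous_on {0..tf} p" "{a..b} \<subseteq> {0..tf}" for p a b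
    unfolding F_def by (rule adjoint_integrable_on[OF \<mu> x_cont that])
  have intG: "(\<lambda>s. F (tf - s) (q s)) integrable_on {0..tf}" if "continuous_on {0..tf} q" for q
    using has_integral_reflect_around[OF integrable_integral[OF intF[OF reversed[OF that] order_refl]], of tf]
    by (auto simp: integrable_on_def)
  have lipG: "norm (F (tf - s) p - F (tf - s) q) \<le> reg_const * norm (p - q)" if "s \<in> {0..tf}" for s p q
    unfolding F_def using that by (intro adjoint_integral_bounds(2) controlsD[OF \<mu>] x_bound) auto
  obtain q where q: "continuous_on {0..tf} q"
    "\<And>t. t \<in> {0..tf} \<Longrightarrow> q t = 0 + integral {0..t} (\<lambda>s. F (tf - s) (q s))"
    using caratheodory_existence[OF reg_const_pos intG lipG, of 0] by blast
  define p where "p t = q (tf - t)" for t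
  have p_cont: "continuous_on {0..tf} p" unfolding p_def by (rule reversed[OF q(1)])
  have p_eq: "p t = integral {t..tf} (\<lambda>s. F s (p s))" if t: "t \<in> {0..tf}" for t
  proof -
    have "{t..tf} \<subseteq> {0..tf}" using t by auto
    from has_integral_reflect_around[OF integrable_integral[OF intF[OF p_cont this]], of tf]
    have "integral {0..tf - t} (\<lambda>s. F (tf - s) (q s)) = integral {t..tf} (\<lambda>s. F s (p s))"
      by (simp add: p_def integral_unique)
    then show ?thesis using q(2)[of "tf - t"] t by (simp add: p_def)
  qed
  have p_eq': "p t = p 0 + integral {0..t} (\<lambda>s. - F s (p s))" if t: "t \<in> {0..tf}" for t
  proof -
    have "integral {0..t} (\<lambda>s. F s (p s)) + integral {t..tf} (\<lambda>s. F s (p s)) = integral {0..tf} (\<lambda>s. F s (p s))"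
      by (intro Henstock_Kurzweil_Integration.integral_combine intF p_cont) (use t in auto)
    then show ?thesis using p_eq[OF t] p_eq[of 0] tf_pos by (simp add: algebra_simps)
  qed
  have "bounded (p ` {0..tf})"
    using p_cont by (intro compact_imp_bounded compact_continuous_image) auto
  then obtain B where B: "\<And>t. t \<in> {0..tf} \<Longrightarrow> norm (p t) \<le> B" unfolding bounded_iff by blast
  have Fb: "norm (- F t (p t)) \<le> reg_const * (B + 1)" if t: "t \<in> {0..tf}" for t
  proof -
    have "norm (F t (p t)) \<le> reg_const * (norm (p t) + 1)"
      unfolding F_def by (rule adjoint_integral_bounds(1)[OF controlsD[OF \<mu> t] x_bound[OF t]])
    also have "\<dots> \<le> reg_const * (B + 1)" using B[OF t] reg_const_pos by (intro mult_left_mono) auto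
    finally show ?thesis by simp
  qed
  have ac: "abs_continuous_on {0..tf} p"
    "AE t in lebesgue_on {0..tf}. (p has_vector_derivative - F t (p t)) (at t within {0..tf})"
    by (rule indefinite_integral_bounded_abs_continuous[OF integrable_neg[OF intF[OF p_cont order_refl]] Fb p_eq']; assumption)+
  moreover have "p tf = 0" using p_eq[of tf] tf_pos by simp
  ultimately show ?thesis unfolding is_costate_alt F_def by blast
qed

lemma
  assumes \<mu>: "\<mu> \<in> controls" and x: "is_state tf x0 f \<mu> x" and p: "is_costate tf f L \<mu> x p"
  shows costate_continuous: "continuous_on {0..tf} p"
    and costate_bound: "\<And>t. t \<in> {0..tf} \<Longrightarrow> norm (p t) \<le> costate_radius"
proof -
  note x_cont = state_continuous[OF \<mu> x] and x_bound = state_bound[OF \<mu> x]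
  have ac: "abs_continuous_on {0..tf} p" and ptf: "p tf = 0" using p by (auto simp: is_costate_def)
  show cont: "continuous_on {0..tf} p" by (rule abs_continuous_on_imp_continuous_on[OF ac])
  define F where "F t = (\<integral>u. adjoint_field f L (x t) u (p t) \<partial>\<mu> t)" for t
  have intF: "F integrable_on {a..b}" if "{a..b} \<subseteq> {0..tf}" for a b
    unfolding F_def by (rule adjoint_integrable_on[OF \<mu> x_cont cont that])
  have int: "((\<lambda>s. - F s) has_integral p t - p 0) {0..t}" if "t \<in> {0..tf}" for t
    using abs_continuous_on_has_integral_initial[OF ac that, of "\<lambda>s. - F s"] p
    by (simp add: is_costate_alt F_def)
  fix t assume t: "t \<in> {0..tf}"
  have "norm (p t) + 1 \<le> 1 * exp (reg_const * (tf - t))"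
  proof (rule gronwall_backward[OF _ _ _ t])
    show "continuous_on {0..tf} (\<lambda>t. norm (p t) + 1)" by (intro continuous_intros cont)
    show "0 \<le> reg_const" using reg_const_pos by simp
    fix s assume s: "s \<in> {0..tf}"
    then have sub: "{s..tf} \<subseteq> {0..tf}" "{0..s} \<subseteq> {0..tf}" by auto
    have *: "integral {0..s} F = p 0 - p s" if "s \<in> {0..tf}" for s
      using integral_unique[OF has_integral_neg[OF int[OF that]]] by simp
    have "integral {0..s} F + integral {s..tf} F = integral {0..tf} F"
      by (intro Henstock_Kurzweil_Integration.integral_combine intF) (use s in auto)
    then have "p s = integral {s..tf} F" using *[OF s] *[of tf] tf_pos ptf by simp
    also have "norm \<dots> \<le> integral {s..tf} (\<lambda>r. reg_const * (norm (p r) + 1))"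
    proof (rule integral_norm_bound_integral[OF intF[OF sub(1)]])
      show "(\<lambda>r. reg_const * (norm (p r) + 1)) integrable_on {s..tf}"
        by (intro integrable_continuous_interval continuous_intros continuous_on_subset[OF cont sub(1)])
      fix r assume "r \<in> {s..tf}"
      then have r: "r \<in> {0..tf}" using sub by auto
      show "norm (F r) \<le> reg_const * (norm (p r) + 1)"
        unfolding F_def by (rule adjoint_integral_bounds(1)[OF controlsD[OF \<mu> r] x_bound[OF r]])
    qed
    finally show "norm (p s) + 1 \<le> 1 + reg_const * integral {s..tf} (\<lambda>r. norm (p r) + 1)" by simp
  qed
  also have "\<dots> \<le> costate_radius" using reg_const_pos t by (simp add: costate_radius_def mult_left_mono)
  finally show "norm (p t) \<le> costate_radius" by simp
qed

abbreviation "state \<equiv> state_traj tf x0 f"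
abbreviation "costate \<equiv> costate_traj tf x0 f L"
abbreviation "J \<equiv> cost tf x0 f L"
abbreviation "gap \<equiv> hamiltonian_gap tf x0 f L"
abbreviation "\<theta> \<equiv> optimality_fun U tf x0 f L"

lemma is_costate_costate_traj: "\<mu> \<in> controls \<Longrightarrow> is_costate tf f L \<mu> (state \<mu>) (costate \<mu>)"
  unfolding costate_traj_def by (rule someI_ex[OF costate_exists[OF _ is_state_state_traj]])

lemma state_facts:
  assumes "\<mu> \<in> controls"
  shows "continuous_on {0..tf} (state \<mu>)"
    and "t \<in> {0..tf} \<Longrightarrow> ((\<lambda>s. \<integral>u. f (state \<mu> s) u \<partial>\<mu> s) has_integral state \<mu> t - x0) {0..t}"
    and "t \<in> {0..tf} \<Longrightarrow> norm (state \<mu> t) \<le> state_radius"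
  using state_continuous state_has_integral state_bound is_state_state_traj assms by blast+

lemma costate_facts:
  assumes "\<mu> \<in> controls"
  shows "continuous_on {0..tf} (costate \<mu>)"
    and "t \<in> {0..tf} \<Longrightarrow> norm (costate \<mu> t) \<le> costate_radius"
  using costate_continuous costate_bound is_state_state_traj is_costate_costate_traj assms by blast+

subsection \<open>Hamiltonian\<close>

lemma cont_hamiltonian_integrand:
  "continuous_on (UNIV \<times> U) (\<lambda>(z, u). snd z \<bullet> f (fst z) u + L (fst z) u)"
proof -
  have p: "continuous_on (UNIV \<times> U) (\<lambda>w::((real^'n) \<times> (real^'n)) \<times> (real^'k). (fst (fst w), snd w))"
    by (intro continuous_intros)
  have "continuous_on (UNIV \<times> U) (\<lambda>w::((real^'n) \<times> (real^'n)) \<times> (real^'k). f (fst (fst w)) (snd w))"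
    using continuous_on_compose2[OF cont_f p] by force
  moreover have "continuous_on (UNIV \<times> U) (\<lambda>w::((real^'n) \<times> (real^'n)) \<times> (real^'k). L (fst (fst w)) (snd w))"
    using continuous_on_compose2[OF cont_L p] by force
  ultimately have "continuous_on (UNIV \<times> U) (\<lambda>w. snd (fst w) \<bullet> f (fst (fst w)) (snd w) + L (fst (fst w)) (snd w))"
    by (intro continuous_intros)
  then show ?thesis by (simp add: split_def)
qed

lemma hamiltonian_integrable:
  assumes "\<mu> \<in> controls" "continuous_on {0..tf} x" "continuous_on {0..tf} p"
  shows "integrable (lebesgue_on {0..tf}) (\<lambda>t. hamiltonian f L (x t) (\<mu> t) (p t))"
  using integrable_along(1)[OF assms(1) cont_hamiltonian_integrand continuous_on_Pair[OF assms(2,3)]]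
  by (simp add: hamiltonian_def)

lemma U_sections:
  "continuous_on U (f x)" "continuous_on U (L x)" "continuous_on U (dx f x)" "continuous_on U (dx L x)"
  by (rule continuous_on_snd_section[OF cont_f] continuous_on_snd_section[OF cont_L]
      continuous_on_snd_section[OF cont_df] continuous_on_snd_section[OF cont_dL]; simp)+

lemma hamiltonian_split:
  assumes "\<nu> \<in> borel_probs U"
  shows "hamiltonian f L x \<nu> p = p \<bullet> (\<integral>u. f x u \<partial>\<nu>) + (\<integral>u. L x u \<partial>\<nu>)"
  using borel_probs_integrable[OF compact_U assms U_sections(1)]
    borel_probs_integrable[OF compact_U assms U_sections(2)]
  by (simp add: hamiltonian_def)

lemma hamiltonian_continuous_section: "continuous_on U (\<lambda>u. p \<bullet> f x u + L x u)"
  by (intro continuous_intros U_sections)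

lemma hamiltonian_mix:
  assumes "\<mu> \<in> borel_probs U" "\<nu> \<in> borel_probs U" "0 \<le> c" "c \<le> 1"
  shows "hamiltonian f L x (mix_measure c \<mu> \<nu>) p = (1 - c) * hamiltonian f L x \<mu> p + c * hamiltonian f L x \<nu> p"
  unfolding hamiltonian_def
  by (rule integral_mix_measure_real[OF compact_U assms hamiltonian_continuous_section])

lemma hamiltonian_lipschitz:
  assumes \<nu>: "\<nu> \<in> borel_probs U" and xy: "norm x \<le> state_radius" "norm y \<le> state_radius" and p: "norm p \<le> costate_radius"
  shows "\<bar>hamiltonian f L y \<nu> p - hamiltonian f L x \<nu> p\<bar> \<le> (costate_radius + 1) * reg_const * norm (y - x)"
proof -
  have "hamiltonian f L y \<nu> p - hamiltonian f L x \<nu> p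
      = (\<integral>u. (p \<bullet> f y u + L y u) - (p \<bullet> f x u + L x u) \<partial>\<nu>)"
    unfolding hamiltonian_def
    by (rule Bochner_Integration.integral_diff[symmetric];
        rule borel_probs_integrable[OF compact_U \<nu> hamiltonian_continuous_section])
  also have "norm \<dots> \<le> (costate_radius + 1) * reg_const * norm (y - x)"
  proof (rule borel_probs_norm_integral_le[OF compact_U \<nu>])
    show "continuous_on U (\<lambda>u. (p \<bullet> f y u + L y u) - (p \<bullet> f x u + L x u))"
      by (intro continuous_intros U_sections)
    fix u assume u: "u \<in> U"
    have lip: "norm (f y u - f x u) \<le> reg_const * norm (y - x)" "norm (L y u - L x u) \<le> reg_const * norm (y - x)"
      using lipschitz_on_normD[OF reg_const_lipschitz(1)[OF u], of y x]
        lipschitz_on_normD[OF reg_const_lipschitz(3)[OF u], of y x] xy by auto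
    have "(p \<bullet> f y u + L y u) - (p \<bullet> f x u + L x u) = p \<bullet> (f y u - f x u) + (L y u - L x u)"
      by (simp add: inner_diff_right)
    also have "norm \<dots> \<le> norm p * norm (f y u - f x u) + norm (L y u - L x u)"
      by (intro norm_triangle_le add_mono) (auto simp: Cauchy_Schwarz_ineq2)
    also have "\<dots> \<le> costate_radius * (reg_const * norm (y - x)) + reg_const * norm (y - x)"
      using lip p by (intro add_mono mult_mono) (auto simp: costate_radius_def)
    finally show "norm ((p \<bullet> f y u + L y u) - (p \<bullet> f x u + L x u)) \<le> (costate_radius + 1) * reg_const * norm (y - x)"
      by (simp add: algebra_simps)
  qed
  finally show ?thesis by simp
qed

text \<open>
  The integral of \<open>adjoint_field\<close> is the state gradient of the Hamiltonian, so the costate equation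
  cancels the first-order effect of a change of state.
\<close>

lemma hamiltonian_linearization:
  assumes \<nu>: "\<nu> \<in> borel_probs U" and xy: "norm x \<le> state_radius" "norm y \<le> state_radius" and p: "norm p \<le> costate_radius"
  shows "\<bar>hamiltonian f L y \<nu> p - hamiltonian f L x \<nu> p - (\<integral>u. adjoint_field f L x u p \<partial>\<nu>) \<bullet> (y - x)\<bar>
    \<le> (costate_radius + 1) * reg_const * (norm (y - x))\<^sup>2"
proof -
  have c: "continuous_on U (\<lambda>u. adjoint_field f L x u p)"
    using continuous_on_snd_section[OF cont_adjoint, of "(x, p)"] by simp
  note i = borel_probs_integrable[OF compact_U \<nu> hamiltonian_continuous_section]
    borel_probs_integrable[OF compact_U \<nu> c]
  have "hamiltonian f L y \<nu> p - hamiltonian f L x \<nu> p - (\<integral>u. adjoint_field f L x u p \<partial>\<nu>) \<bullet> (y - x)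
      = (\<integral>u. (p \<bullet> f y u + L y u) - (p \<bullet> f x u + L x u) - adjoint_field f L x u p \<bullet> (y - x) \<partial>\<nu>)"
    unfolding hamiltonian_def using i by simp
  also have "norm \<dots> \<le> (costate_radius + 1) * reg_const * (norm (y - x))\<^sup>2"
  proof (rule borel_probs_norm_integral_le[OF compact_U \<nu>])
    show "continuous_on U (\<lambda>u. (p \<bullet> f y u + L y u) - (p \<bullet> f x u + L x u) - adjoint_field f L x u p \<bullet> (y - x))"
      by (intro continuous_intros U_sections c)
    fix u assume u: "u \<in> U"
    have lin: "norm (f y u - f x u - blinfun_apply (dx f x u) (y - x)) \<le> reg_const * (norm (y - x))\<^sup>2"
      "norm (L y u - L x u - blinfun_apply (dx L x u) (y - x)) \<le> reg_const * (norm (y - x))\<^sup>2"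
      using dx_linearization_error[OF f_C1 u convex_cball[of 0 state_radius] _ _ reg_const_lipschitz(2)[OF u], of x y]
        dx_linearization_error[OF L_C1 u convex_cball[of 0 state_radius] _ _ reg_const_lipschitz(4)[OF u], of x y] xy by auto
    have "(p \<bullet> f y u + L y u) - (p \<bullet> f x u + L x u) - adjoint_field f L x u p \<bullet> (y - x)
        = p \<bullet> (f y u - f x u - blinfun_apply (dx f x u) (y - x))
          + (L y u - L x u - blinfun_apply (dx L x u) (y - x))"
      by (simp only: inner_adjoint_field) (simp add: inner_diff_right)
    also have "norm \<dots> \<le> norm p * norm (f y u - f x u - blinfun_apply (dx f x u) (y - x))
        + norm (L y u - L x u - blinfun_apply (dx L x u) (y - x))"
      by (intro norm_triangle_le add_mono) (auto simp: Cauchy_Schwarz_ineq2)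
    also have "\<dots> \<le> costate_radius * (reg_const * (norm (y - x))\<^sup>2) + reg_const * (norm (y - x))\<^sup>2"
      using lin p by (intro add_mono mult_mono) (auto simp: costate_radius_def)
    finally show "norm ((p \<bullet> f y u + L y u) - (p \<bullet> f x u + L x u) - adjoint_field f L x u p \<bullet> (y - x))
        \<le> (costate_radius + 1) * reg_const * (norm (y - x))\<^sup>2"
      by (simp add: algebra_simps)
  qed
  finally show ?thesis by simp
qed

subsection \<open>First-order expansion of the cost\<close>

text \<open>Gronwall's bound on the displacement of the state per unit of the mixing weight.\<close>

definition drift_const where "drift_const = 2 * reg_const * tf * exp (reg_const * tf)"

text \<open>
  Mixing with weight \<open>c\<close> changes the velocity at a fixed state by at most \<open>2 * reg_const * c\<close>; the
  displacement itself feeds back with Lipschitz constant \<open>reg_const\<close>.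
\<close>

lemma state_perturbation:
  assumes \<mu>: "\<mu> \<in> controls" and \<nu>: "\<nu> \<in> controls" and c: "0 \<le> c" "c \<le> 1" and t: "t \<in> {0..tf}"
  shows "norm (state (mix_control c \<mu> \<nu>) t - state \<mu> t) \<le> drift_const * c"
proof -
  let ?x = "state \<mu>" and ?y = "state (mix_control c \<mu> \<nu>)"
  have mix: "mix_control c \<mu> \<nu> \<in> controls" by (rule mix_control_in_relaxed_controls[OF compact_U \<mu> \<nu> c])
  note x = state_facts[OF \<mu>] and y = state_facts[OF mix]
  have rhs: "norm ((\<integral>u. f (?y s) u \<partial>mix_control c \<mu> \<nu> s) - (\<integral>u. f (?x s) u \<partial>\<mu> s))
      \<le> reg_const * norm (?y s - ?x s) + 2 * reg_const * c" if s: "s \<in> {0..tf}" for s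
  proof -
    note \<mu>s = controlsD[OF \<mu> s] and \<nu>s = controlsD[OF \<nu> s]
    let ?I = "\<lambda>\<kappa> z. \<integral>u. f z u \<partial>\<kappa> s"
    have b: "norm (?I \<mu> (?y s)) \<le> reg_const" "norm (?I \<nu> (?y s)) \<le> reg_const"
      by (rule borel_probs_norm_integral_le[OF compact_U \<mu>s U_sections(1) reg_const_bounds(1)[OF _ y(3)[OF s]]]
          borel_probs_norm_integral_le[OF compact_U \<nu>s U_sections(1) reg_const_bounds(1)[OF _ y(3)[OF s]]]; assumption)+
    have "?I \<mu> (?y s) - ?I \<mu> (?x s) = (\<integral>u. f (?y s) u - f (?x s) u \<partial>\<mu> s)"
      by (rule Bochner_Integration.integral_diff[symmetric];
        rule borel_probs_integrable[OF compact_U \<mu>s U_sections(1)])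
    also have "norm \<dots> \<le> reg_const * norm (?y s - ?x s)"
    proof (rule borel_probs_norm_integral_le[OF compact_U \<mu>s])
      show "norm (f (?y s) u - f (?x s) u) \<le> reg_const * norm (?y s - ?x s)" if "u \<in> U" for u
        using lipschitz_on_normD[OF reg_const_lipschitz(1)[OF that]] x(3)[OF s] y(3)[OF s] by simp
    qed (intro continuous_intros U_sections)
    finally have d: "norm (?I \<mu> (?y s) - ?I \<mu> (?x s)) \<le> reg_const * norm (?y s - ?x s)" .
    have eq: "?I (mix_control c \<mu> \<nu>) (?y s) - ?I \<mu> (?x s)
        = (?I \<mu> (?y s) - ?I \<mu> (?x s)) + c *\<^sub>R (?I \<nu> (?y s) - ?I \<mu> (?y s))"
      unfolding mix_control_def
      by (subst integral_mix_measure[OF compact_U \<mu>s \<nu>s c U_sections(1)]) (simp add: algebra_simps)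
    have "norm (?I (mix_control c \<mu> \<nu>) (?y s) - ?I \<mu> (?x s))
        \<le> norm (?I \<mu> (?y s) - ?I \<mu> (?x s)) + norm (c *\<^sub>R (?I \<nu> (?y s) - ?I \<mu> (?y s)))"
      unfolding eq by (rule norm_triangle_ineq)
    also have "\<dots> \<le> reg_const * norm (?y s - ?x s) + c * (reg_const + reg_const)"
      using c norm_triangle_le_diff[of "?I \<nu> (?y s)" "?I \<mu> (?y s)" "reg_const + reg_const"] b
      by (intro add_mono d) (simp add: mult_left_mono)
    finally show ?thesis by (simp add: algebra_simps)
  qed
  have "norm (?y t - ?x t) \<le> (2 * reg_const * c * tf) * exp (reg_const * t)"
  proof (rule gronwall[OF _ _ _ t])
    show "continuous_on {0..tf} (\<lambda>t. norm (?y t - ?x t))" by (intro continuous_intros x(1) y(1))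
    show "0 \<le> reg_const" using reg_const_pos by simp
    fix s assume s: "s \<in> {0..tf}"
    then have sub: "{0..s} \<subseteq> {0..tf}" by auto
    have v: "(\<lambda>r. norm (?y r - ?x r)) integrable_on {0..s}"
      by (intro integrable_continuous_interval continuous_intros
          continuous_on_subset[OF x(1) sub] continuous_on_subset[OF y(1) sub])
    note i = has_integral_diff[OF y(2)[OF s] x(2)[OF s]]
    have "norm (?y s - ?x s) = norm (integral {0..s}
        (\<lambda>r. (\<integral>u. f (?y r) u \<partial>mix_control c \<mu> \<nu> r) - (\<integral>u. f (?x r) u \<partial>\<mu> r)))"
      using integral_unique[OF i] by simp
    also have "\<dots> \<le> integral {0..s} (\<lambda>r. reg_const * norm (?y r - ?x r) + 2 * reg_const * c)"
    proof (rule integral_norm_bound_integral)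
      show "(\<lambda>r. (\<integral>u. f (?y r) u \<partial>mix_control c \<mu> \<nu> r) - (\<integral>u. f (?x r) u \<partial>\<mu> r)) integrable_on {0..s}"
        using i by blast
      show "(\<lambda>r. reg_const * norm (?y r - ?x r) + 2 * reg_const * c) integrable_on {0..s}"
        by (intro integrable_add integrable_on_mult_right v) auto
    qed (use rhs sub in auto)
    also have "\<dots> = reg_const * integral {0..s} (\<lambda>r. norm (?y r - ?x r)) + s * (2 * reg_const * c)"
      using s by (subst Henstock_Kurzweil_Integration.integral_add)
        (auto intro!: integrable_on_mult_right v)
    also have "\<dots> \<le> reg_const * integral {0..s} (\<lambda>r. norm (?y r - ?x r)) + tf * (2 * reg_const * c)"
      using s reg_const_pos c by (intro add_left_mono mult_right_mono) auto
    finally show "norm (?y s - ?x s) \<le> 2 * reg_const * c * tf + reg_const * integral {0..s} (\<lambda>t. norm (?y t - ?x t))"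
      by (simp add: algebra_simps)
  qed
  also have "\<dots> \<le> (2 * reg_const * c * tf) * exp (reg_const * tf)"
    using t reg_const_pos c tf_pos by (intro mult_left_mono) auto
  finally show ?thesis by (simp add: drift_const_def algebra_simps)
qed

text \<open>
  The coefficient of \<open>c\<^sup>2\<close> in the expansion of the cost: the linearization error is quadratic in the
  displacement \<open>drift_const * c\<close>, the interaction of displacement and mixing is linear in it but
  carries another factor \<open>c\<close>.
\<close>

definition curv_const where "curv_const = ((costate_radius + 1) * reg_const * drift_const\<^sup>2 + 2 * ((costate_radius + 1) * reg_const * drift_const)) * tf"

lemma costate_radius_pos: "costate_radius > 0" and curv_const_pos: "curv_const > 0"
proof -
  show costate_radius: "costate_radius > 0" by (simp add: costate_radius_def)
  have drift_const: "drift_const > 0" using reg_const_pos tf_pos by (simp add: drift_const_def)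
  show "curv_const > 0" using costate_radius drift_const reg_const_pos tf_pos by (simp add: curv_const_def add_pos_pos)
qed

lemma cost_has_integral:
  assumes "\<mu> \<in> controls"
  shows "((\<lambda>t. \<integral>u. L (state \<mu> t) u \<partial>\<mu> t) has_integral J \<mu>) {0..tf}"
  unfolding cost_def
  by (rule has_integral_integral_lebesgue_on[OF integrable_along(1)[OF assms cont_L state_facts(1)[OF assms]]]) simp

lemma gap_has_integral:
  assumes \<mu>: "\<mu> \<in> controls" and \<nu>: "\<nu> \<in> controls"
  shows "((\<lambda>t. hamiltonian f L (state \<mu> t) (\<nu> t) (costate \<mu> t) - hamiltonian f L (state \<mu> t) (\<mu> t) (costate \<mu> t))
     has_integral gap \<mu> \<nu>) {0..tf}"
  unfolding hamiltonian_gap_def Let_def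
  by (rule has_integral_integral_lebesgue_on)
    (auto intro!: hamiltonian_integrable \<mu> \<nu> state_facts(1) costate_facts(1))

text \<open>
  The function \<open>E\<close> below collects the cost difference, the derivative of \<open>p \<bullet> (y - x)\<close>, whose integral
  vanishes, and minus \<open>c\<close> times the integrand of the gap. It is bounded pointwise by a multiple of
  \<open>c\<^sup>2\<close>.
\<close>

lemma cost_expansion:
  assumes \<mu>: "\<mu> \<in> controls" and \<nu>: "\<nu> \<in> controls" and c: "0 \<le> c" "c \<le> 1"
  shows "J (mix_control c \<mu> \<nu>) - J \<mu> \<le> c * gap \<mu> \<nu> + curv_const * c\<^sup>2"
proof -
  define m where "m = mix_control c \<mu> \<nu>"
  have m: "m \<in> controls" unfolding m_def by (rule mix_control_in_relaxed_controls[OF compact_U \<mu> \<nu> c])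
  define x where "x = state \<mu>"
  define y where "y = state m"
  define p where "p = costate \<mu>"
  define X where "X t = (\<integral>u. f (x t) u \<partial>\<mu> t)" for t
  define Y where "Y t = (\<integral>u. f (y t) u \<partial>m t)" for t
  define A where "A t = (\<integral>u. adjoint_field f L (x t) u (p t) \<partial>\<mu> t)" for t
  define H where "H z \<kappa> t = hamiltonian f L (z t) (\<kappa> t) (p t)" for z \<kappa> t
  note sx = is_state_state_traj[OF \<mu>, folded x_def] and sy = is_state_state_traj[OF m, folded y_def]
    and sp = is_costate_costate_traj[OF \<mu>, folded x_def p_def]
  have px: "((\<lambda>t. p t \<bullet> X t + - A t \<bullet> x t) has_integral p tf \<bullet> x tf - p 0 \<bullet> x 0) {0..tf}"
    by (rule has_integral_by_parts_inner)
      (use sx sp tf_pos in \<open>auto simp: is_state_def is_costate_alt X_def A_def\<close>)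
  have py: "((\<lambda>t. p t \<bullet> Y t + - A t \<bullet> y t) has_integral p tf \<bullet> y tf - p 0 \<bullet> y 0) {0..tf}"
    by (rule has_integral_by_parts_inner)
      (use sy sp tf_pos in \<open>auto simp: is_state_def is_costate_alt Y_def A_def\<close>)
  have ends: "p tf = 0" "x 0 = x0" "y 0 = x0"
    using sx sy sp by (auto simp: is_state_def is_costate_def)
  define E where "E t = ((\<integral>u. L (y t) u \<partial>m t) - (\<integral>u. L (x t) u \<partial>\<mu> t))
      + ((p t \<bullet> Y t + - A t \<bullet> y t) - (p t \<bullet> X t + - A t \<bullet> x t)) - c * (H x \<nu> t - H x \<mu> t)" for t
  have intE: "(E has_integral (J m - J \<mu>) + ((p tf \<bullet> y tf - p 0 \<bullet> y 0) - (p tf \<bullet> x tf - p 0 \<bullet> x 0))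
      - c * gap \<mu> \<nu>) {0..tf}"
    unfolding E_def H_def
    by (intro has_integral_diff has_integral_add has_integral_mult_right px py
        cost_has_integral[OF m, folded y_def] cost_has_integral[OF \<mu>, folded x_def]
        gap_has_integral[OF \<mu> \<nu>, folded x_def p_def])
  have Eb: "E t \<le> ((costate_radius + 1) * reg_const * drift_const\<^sup>2 + 2 * ((costate_radius + 1) * reg_const * drift_const)) * c\<^sup>2" if t: "t \<in> {0..tf}" for t
  proof -
    note \<mu>t = controlsD[OF \<mu> t] and \<nu>t = controlsD[OF \<nu> t] and mt = controlsD[OF m t]
    have xR: "norm (x t) \<le> state_radius" and yR: "norm (y t) \<le> state_radius" and pP: "norm (p t) \<le> costate_radius"
      unfolding x_def y_def p_def by (rule state_facts(3) costate_facts(2); fact \<mu> m t)+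
    have d: "norm (y t - x t) \<le> drift_const * c"
      unfolding x_def y_def m_def by (rule state_perturbation[OF \<mu> \<nu> c t])
    have Hm: "H y m t = (1 - c) * H y \<mu> t + c * H y \<nu> t"
      unfolding H_def m_def mix_control_def by (rule hamiltonian_mix[OF \<mu>t \<nu>t c])
    have "E t = H y m t - H x \<mu> t - A t \<bullet> (y t - x t) - c * (H x \<nu> t - H x \<mu> t)"
      unfolding E_def H_def hamiltonian_split[OF \<mu>t] hamiltonian_split[OF \<nu>t] hamiltonian_split[OF mt] X_def Y_def
      by (simp add: inner_diff_right)
    \<comment> \<open>The linearization error at \<open>\<mu>\<close>, plus \<open>c\<close> times the change of \<open>H \<nu> - H \<mu>\<close> from \<open>x\<close> to \<open>y\<close>.\<close>
    also have "\<dots> = (H y \<mu> t - H x \<mu> t - A t \<bullet> (y t - x t)) + c * ((H y \<nu> t - H x \<nu> t) - (H y \<mu> t - H x \<mu> t))"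
      unfolding Hm by (simp add: algebra_simps)
    also have "\<dots> \<le> (costate_radius + 1) * reg_const * (norm (y t - x t))\<^sup>2 + c * (2 * ((costate_radius + 1) * reg_const * norm (y t - x t)))"
    proof (intro add_mono mult_left_mono c)
      show "H y \<mu> t - H x \<mu> t - A t \<bullet> (y t - x t) \<le> (costate_radius + 1) * reg_const * (norm (y t - x t))\<^sup>2"
        using hamiltonian_linearization[OF \<mu>t xR yR pP] unfolding H_def A_def by linarith
      show "(H y \<nu> t - H x \<nu> t) - (H y \<mu> t - H x \<mu> t) \<le> 2 * ((costate_radius + 1) * reg_const * norm (y t - x t))"
        using hamiltonian_lipschitz[OF \<mu>t xR yR pP] hamiltonian_lipschitz[OF \<nu>t xR yR pP]
        unfolding H_def by linarith
    qed
    also have "\<dots> \<le> (costate_radius + 1) * reg_const * (drift_const * c)\<^sup>2 + c * (2 * ((costate_radius + 1) * reg_const * (drift_const * c)))"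
      using d costate_radius_pos reg_const_pos c by (intro add_mono mult_left_mono power_mono) auto
    also have "\<dots> = ((costate_radius + 1) * reg_const * drift_const\<^sup>2 + 2 * ((costate_radius + 1) * reg_const * drift_const)) * c\<^sup>2"
      by (simp add: power2_eq_square algebra_simps)
    finally show ?thesis .
  qed
  have "(J m - J \<mu>) + ((p tf \<bullet> y tf - p 0 \<bullet> y 0) - (p tf \<bullet> x tf - p 0 \<bullet> x 0)) - c * gap \<mu> \<nu>
      \<le> measure lborel {0..tf} *\<^sub>R (((costate_radius + 1) * reg_const * drift_const\<^sup>2 + 2 * ((costate_radius + 1) * reg_const * drift_const)) * c\<^sup>2)"
    by (rule has_integral_le[OF intE has_integral_const_real Eb])
  also have "\<dots> = curv_const * c\<^sup>2" using tf_pos by (simp add: curv_const_def)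
  finally show ?thesis by (simp add: ends m_def)
qed

lemma cost_lower_bound:
  assumes \<mu>: "\<mu> \<in> controls"
  shows "- (reg_const * tf) \<le> J \<mu>"
proof -
  have "measure lborel {0..tf} *\<^sub>R (- reg_const) \<le> J \<mu>"
  proof (rule has_integral_le[OF has_integral_const_real cost_has_integral[OF \<mu>]])
    fix t assume t: "t \<in> {0..tf}"
    have "norm (\<integral>u. L (state \<mu> t) u \<partial>\<mu> t) \<le> reg_const"
      by (rule borel_probs_norm_integral_le[OF compact_U controlsD[OF \<mu> t] U_sections(2)])
        (use reg_const_bounds(3) state_facts(3)[OF \<mu> t] in auto)
    then show "- reg_const \<le> (\<integral>u. L (state \<mu> t) u \<partial>\<mu> t)" by (simp add: abs_le_iff)
  qed
  then show ?thesis using tf_pos by (simp add: mult.commute)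
qed

subsection \<open>The optimality function\<close>

lemma return_in_borel_probs:
  assumes "u \<in> U"
  shows "return (restrict_space borel U) u \<in> borel_probs U"
  using assms by (auto simp: borel_probs_def space_restrict_space intro!: prob_space_return)

lemma integral_return_restrict:
  fixes g :: "real^'k \<Rightarrow> real"
  assumes "u \<in> U" "continuous_on U g"
  shows "(\<integral>v. g v \<partial>return (restrict_space borel U) u) = g u"
  using assms borel_measurable_continuous_on_restrict[OF assms(2)]
  by (intro integral_return) (auto simp: space_restrict_space)

text \<open>
  Dirac measures at a measurably selected minimizer of \<open>u \<mapsto> p t \<bullet> f (x t) u + L (x t) u\<close> minimize
  the integrand of the gap at every time.
\<close>

lemma pointwise_minimizer_exists:
  assumes \<mu>: "\<mu> \<in> controls"
  shows "\<exists>\<nu>\<in>controls. \<forall>\<kappa>\<in>controls. gap \<mu> \<nu> \<le> gap \<mu> \<kappa>"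
proof -
  define x where "x = state \<mu>"
  define p where "p = costate \<mu>"
  have xp: "continuous_on {0..tf} x" "continuous_on {0..tf} p"
    unfolding x_def p_def by (rule state_facts(1)[OF \<mu>] costate_facts(1)[OF \<mu>])+
  define h where "h t u = p t \<bullet> f (x t) u + L (x t) u" for t u
  have "continuous_on ({0..tf} \<times> U) (\<lambda>w. ((x (fst w), p (fst w)), snd w))"
    by (intro continuous_intros continuous_on_compose2[OF xp(1)] continuous_on_compose2[OF xp(2)]) auto
  from continuous_on_compose2[OF cont_hamiltonian_integrand this]
  have "continuous_on ({0..tf} \<times> U) (\<lambda>(t, u). h t u)"
    by (simp add: h_def split_def image_subset_iff)
  then obtain s where s: "s \<in> borel_measurable (lebesgue_on {0..tf})"
    "\<And>t. t \<in> {0..tf} \<Longrightarrow> s t \<in> U" "\<And>t u. t \<in> {0..tf} \<Longrightarrow> u \<in> U \<Longrightarrow> h t (s t) \<le> h t u"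
    using measurable_argmin_selection[OF compact_U U_ne] by metis
  define \<nu> where "\<nu> t = return (restrict_space borel U) (s t)" for t
  have sU: "s \<in> lebesgue_on {0..tf} \<rightarrow>\<^sub>M restrict_space borel U"
    by (rule measurable_restrict_space2[OF _ s(1)]) (use s(2) in auto)
  have \<nu>: "\<nu> \<in> controls"
    unfolding relaxed_controls_def
  proof (intro CollectI conjI ballI allI impI)
    fix t assume "t \<in> {0..tf}"
    then show "\<nu> t \<in> borel_probs U" unfolding \<nu>_def by (intro return_in_borel_probs s(2))
  next
    fix \<phi> :: "real^'k \<Rightarrow> real" assume \<phi>: "continuous_on U \<phi>"
    have "(\<lambda>t. \<phi> (s t)) \<in> borel_measurable (lebesgue_on {0..tf})"
      by (rule measurable_compose[OF sU borel_measurable_continuous_on_restrict[OF \<phi>]])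
    then show "(\<lambda>t. \<integral>u. \<phi> u \<partial>\<nu> t) \<in> borel_measurable (lebesgue_on {0..tf})"
    proof (rule measurable_cong[THEN iffD1, rotated])
      fix t assume "t \<in> space (lebesgue_on {0..tf})"
      then show "\<phi> (s t) = (\<integral>u. \<phi> u \<partial>\<nu> t)"
        unfolding \<nu>_def using s(2) by (simp add: integral_return_restrict[OF _ \<phi>])
    qed
  qed
  have "gap \<mu> \<nu> \<le> gap \<mu> \<kappa>" if \<kappa>: "\<kappa> \<in> controls" for \<kappa>
  proof (rule has_integral_le[OF gap_has_integral[OF \<mu> \<nu>] gap_has_integral[OF \<mu> \<kappa>]])
    fix t assume t: "t \<in> {0..tf}"
    interpret prob_space "\<kappa> t" by (rule borel_probsD(1)[OF controlsD[OF \<kappa> t]])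
    have hU: "continuous_on U (h t)" unfolding h_def by (rule hamiltonian_continuous_section)
    have "hamiltonian f L (x t) (\<nu> t) (p t) = h t (s t)"
      unfolding hamiltonian_def \<nu>_def using integral_return_restrict[OF s(2)[OF t] hU]
      by (simp add: h_def)
    also have "\<dots> = (\<integral>u. h t (s t) \<partial>\<kappa> t)" by (simp add: prob_space)
    also have "\<dots> \<le> (\<integral>u. h t u \<partial>\<kappa> t)"
      using s(3)[OF t] borel_probsD(3)[OF controlsD[OF \<kappa> t]]
      by (intro integral_mono borel_probs_integrable[OF compact_U controlsD[OF \<kappa> t] hU]) auto
    also have "\<dots> = hamiltonian f L (x t) (\<kappa> t) (p t)" by (simp add: hamiltonian_def h_def)
    finally show "hamiltonian f L (state \<mu> t) (\<nu> t) (costate \<mu> t) - hamiltonian f L (state \<mu> t) (\<mu> t) (costate \<mu> t)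
        \<le> hamiltonian f L (state \<mu> t) (\<kappa> t) (costate \<mu> t) - hamiltonian f L (state \<mu> t) (\<mu> t) (costate \<mu> t)"
      by (simp add: x_def p_def)
  qed
  with \<nu> show ?thesis by blast
qed

lemma optimality_fun_nonpos:
  assumes \<mu>: "\<mu> \<in> controls"
  shows "\<theta> \<mu> \<le> 0"
proof -
  obtain \<nu> where \<nu>: "\<nu> \<in> controls" "\<And>\<kappa>. \<kappa> \<in> controls \<Longrightarrow> gap \<mu> \<nu> \<le> gap \<mu> \<kappa>"
    using pointwise_minimizer_exists[OF \<mu>] by blast
  have "\<theta> \<mu> = gap \<mu> \<nu>"
    unfolding optimality_fun_def by (rule Least_equality) (use \<nu> in auto)
  also have "\<dots> \<le> gap \<mu> \<mu>" by (rule \<nu>(2)[OF \<mu>])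
  also have "\<dots> = 0" by (simp add: hamiltonian_gap_def Let_def)
  finally show ?thesis .
qed

subsection \<open>Descent of the algorithm\<close>

text \<open>
  The state selected for a control depends only on the control on \<open>{0..tf}\<close>, because the defining
  predicates of two controls agreeing there are equal.
\<close>

lemma cost_cong:
  assumes "\<And>t. t \<in> {0..tf} \<Longrightarrow> \<mu> t = \<nu> t"
  shows "J \<mu> = J \<nu>"
proof -
  have "is_state tf x0 f \<mu> = is_state tf x0 f \<nu>"
    unfolding is_state_def fun_eq_iff using assms
    by (intro allI conj_cong refl AE_cong) simp
  then have "state \<mu> = state \<nu>" by (simp add: state_traj_def)
  then show ?thesis unfolding cost_def using assms
    by (intro Bochner_Integration.integral_cong) auto
qed

lemma algorithm_step_descent:
  assumes \<alpha>: "\<alpha> \<in> {0<..<1}" and \<beta>: "\<beta> \<in> {0<..<1}" and \<eta>: "\<eta> \<in> {0<..<1}"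
    and \<mu>: "\<mu> \<in> controls" and step: "algorithm_step U tf x0 f L \<alpha> \<beta> \<eta> \<mu> \<mu>'"
  shows "J \<mu>' - J \<mu> \<le> - (\<alpha> * \<eta> * (- \<theta> \<mu>) * min 1 (\<beta> * (1 - \<alpha>) * \<eta> / curv_const * (- \<theta> \<mu>)))"
proof (cases "\<theta> \<mu> = 0")
  case True
  then have "J \<mu>' = J \<mu>" using step by (intro cost_cong) (simp add: algorithm_step_def)
  then show ?thesis using True by simp
next
  case False
  then have neg: "\<theta> \<mu> < 0" using optimality_fun_nonpos[OF \<mu>] by simp
  define g where "g = \<eta> * \<theta> \<mu>"
  have "g < 0" using neg \<eta> by (simp add: g_def mult_pos_neg)
  obtain \<nu> where \<nu>: "\<nu> \<in> controls" "gap \<mu> \<nu> \<le> g"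
    and eq: "\<And>t. t \<in> {0..tf} \<Longrightarrow> \<mu>' t = mix_control (\<beta> ^ armijo_exponent U tf x0 f L \<alpha> \<beta> \<eta> \<mu> \<nu>) \<mu> \<nu> t"
    using step False unfolding algorithm_step_def g_def by auto
  define F where "F c = J (mix_control c \<mu> \<nu>)" for c
  have exponent: "armijo_exponent U tf x0 f L \<alpha> \<beta> \<eta> \<mu> \<nu> = (LEAST l. F (\<beta> ^ l) - J \<mu> \<le> \<alpha> * \<beta> ^ l * g)"
    by (simp add: armijo_exponent_def F_def g_def mult.assoc)
  have quad: "F c - J \<mu> \<le> c * g + curv_const * c\<^sup>2" if c: "0 \<le> c" "c \<le> 1" for c
    using cost_expansion[OF \<mu> \<nu>(1) c] mult_left_mono[OF \<nu>(2) c(1)] by (simp add: F_def)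
  have "J \<mu>' - J \<mu> = F (\<beta> ^ (LEAST l. F (\<beta> ^ l) - J \<mu> \<le> \<alpha> * \<beta> ^ l * g)) - J \<mu>"
    using cost_cong[OF eq] by (simp add: F_def exponent)
  also have "\<dots> \<le> - (\<alpha> * (- g) * min 1 (\<beta> * (1 - \<alpha>) * (- g) / curv_const))"
    by (rule armijo_step_descent[OF _ _ _ _ curv_const_pos \<open>g < 0\<close> quad]) (use \<alpha> \<beta> in auto)
  also have "\<dots> = - (\<alpha> * \<eta> * (- \<theta> \<mu>) * min 1 (\<beta> * (1 - \<alpha>) * \<eta> / curv_const * (- \<theta> \<mu>)))"
    by (simp add: g_def ac_simps)
  finally show ?thesis .
qed

lemma algorithm_optimality_tendsto_zero:
  assumes \<alpha>: "\<alpha> \<in> {0<..<1}" and \<beta>: "\<beta> \<in> {0<..<1}" and \<eta>: "\<eta> \<in> {0<..<1}"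
    and \<mu>: "\<And>k. \<mu> k \<in> controls" and step: "\<And>k. algorithm_step U tf x0 f L \<alpha> \<beta> \<eta> (\<mu> k) (\<mu> (Suc k))"
  shows "(\<lambda>k. \<theta> (\<mu> k)) \<longlonglongrightarrow> 0"
proof -
  have "(\<lambda>k. - \<theta> (\<mu> k)) \<longlonglongrightarrow> 0"
  proof (rule sufficient_descent_tendsto_zero)
    show "0 \<le> - \<theta> (\<mu> k)" for k using optimality_fun_nonpos[OF \<mu>] by simp
    show "- (reg_const * tf) \<le> J (\<mu> k)" for k by (rule cost_lower_bound[OF \<mu>])
    show "\<alpha> * \<eta> > 0" "\<beta> * (1 - \<alpha>) * \<eta> / curv_const > 0" using \<alpha> \<beta> \<eta> curv_const_pos by auto
    show "J (\<mu> (Suc k)) - J (\<mu> k)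
        \<le> - (\<alpha> * \<eta> * (- \<theta> (\<mu> k)) * min 1 (\<beta> * (1 - \<alpha>) * \<eta> / curv_const * (- \<theta> (\<mu> k))))" for k
      by (rule algorithm_step_descent[OF \<alpha> \<beta> \<eta> \<mu> step])
  qed
  then show ?thesis using tendsto_minus_cancel[of "\<lambda>k. \<theta> (\<mu> k)" 0 sequentially] by simp
qed

end

theorem proposition3p4:
  fixes U :: "(real^'k) set" and tf :: real and x0 :: "real^'n"
    and f :: "real^'n \<Rightarrow> real^'k \<Rightarrow> real^'n" and L :: "real^'n \<Rightarrow> real^'k \<Rightarrow> real"
    and \<alpha> \<beta> \<eta> :: real and \<mu> :: "nat \<Rightarrow> real \<Rightarrow> (real^'k) measure"
  assumes "compact U" and "tf > 0"
    and "standing_assumption_f U f" and "standing_assumption_L U L"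
    and "\<alpha> \<in> {0<..<1}" and "\<beta> \<in> {0<..<1}" and "\<eta> \<in> {0<..<1}"
    and "\<And>k. k \<ge> 1 \<Longrightarrow> \<mu> k \<in> relaxed_controls U tf"
    and "\<And>k. k \<ge> 1 \<Longrightarrow> algorithm_step U tf x0 f L \<alpha> \<beta> \<eta> (\<mu> k) (\<mu> (Suc k))"
  shows "(\<lambda>k. optimality_fun U tf x0 f L (\<mu> k)) \<longlonglongrightarrow> 0"
proof -
  have "\<mu> 1 0 \<in> borel_probs U"
    using assms(2) assms(8)[of 1] by (simp add: relaxed_controls_def)
  then have "U \<noteq> {}"
    using prob_space.not_empty borel_probsD(1,3) by metis
  then interpret relaxed_control_problem U tf x0 f L
    by unfold_locales (use assms in auto)
  have "(\<lambda>k. optimality_fun U tf x0 f L (\<mu> (Suc k))) \<longlonglongrightarrow> 0"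
    by (rule algorithm_optimality_tendsto_zero[OF assms(5-7)]) (use assms(8,9) in auto)
  then show ?thesis by (rule LIMSEQ_imp_Suc)
qed

end
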